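(* Let $F$ be an algebraically closed field of characteristic $0$, let $H$ be an associative algebra with $1$ over $F$, and let $A$ be a finite dimensional associative algebra over $F$ with a generalized $H$-action. Suppose that the Jacobson radical $J:=J(A)$ is an $H$-submodule of $A$ and that $A/J = B_1 \oplus \ldots \oplus B_q$ (direct sum of $H$-invariant ideals) where the $B_i$ are $H$-simple algebras. Then the limit $$\mathrm{PIexp}^H(A):=\lim_{n\to\infty} \sqrt[n]{c^H_n(A)}$$ exists and is a nonnegative integer.
   Context: Algebras are not assumed to have a unit unless stated; $\mathbb N=\{1,2,3,\ldots\}$. If $A$ is nilpotent, then $A/J=0$ and the decomposition of $A/J$ is the empty one ($q=0$). Generalized $H$-action: an associative algebra $A$ over $F$ is an algebra with a generalized $H$-action if it is endowed with a (unital) algebra homomorphism $H \to \mathrm{End}_F(A)$ such that for every $h \in H$ there exist $k\in \mathbb N$ and $h'_i, h''_i, h'''_i, h''''_i \in H$, $1\leqslant i \leqslant k$, with $h(ab)=\sum_{i=1}^k\bigl((h'_i a)(h''_i b) + (h'''_i b)(h''''_i a)\bigr)$ for all $a,b \in A$. If $J$ is an $H$-invariant ideal, $A/J$ carries the induced generalized $H$-action. An algebra $B$ with a generalized $H$-action is $H$-simple if $B^2\neq 0$ and $B$ has no $H$-invariant two-sided ideals other than $0$ and $B$. $H$-polynomials: choose a basis $(\gamma_\beta)_{\beta \in \Lambda}$ of $H$ and let $F \langle X | H \rangle$ be the free associative algebra over $F$ with free generators $x_i^{\gamma_\beta}$, $\beta \in \Lambda$, $i \in \mathbb N$. For $h=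 \sum_{\beta} \alpha_\beta \gamma_\beta$ (finite sum, $\alpha_\beta\in F$) put $x_i^h := \sum_{\beta} \alpha_\beta x_i^{\gamma_\beta}$, and $x_i:=x_i^1$, $X=\{x_1,x_2,\ldots\}$. Any map $\psi\colon X\to A$ extends uniquely to an algebra homomorphism $\bar\psi\colon F\langle X|H\rangle\to A$ with $\bar\psi(x_i^h)=h\psi(x_i)$. An element $f\in F\langle X|H\rangle$ is an $H$-identity of $A$ if $\bar\psi(f)=0$ for all $\psi$; $\mathrm{Id}^H(A)$ is the set of all $H$-identities of $A$. Let $P^H_n = \langle x^{h_1}_{\sigma(1)} x^{h_2}_{\sigma(2)}\ldots x^{h_n}_{\sigma(n)} \mid h_i \in H, \sigma\in S_n \rangle_F$ and $c^H_n(A):=\dim\left(P^H_n/(P^H_n \cap \mathrm{Id}^H(A))\right)$ (the $n$th $H$-codimension). *)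

theory Defs
  imports
    Complex_Main
    "HOL-Library.FuncSet"
    "HOL-Library.Set_Algebras"
    "HOL-Library.Poly_Mapping"
    "HOL-Combinatorics.Permutations"
    "HOL-Computational_Algebra.Polynomial"
begin

section \<open>Algebras and generalized actions\<close>

text \<open>Class \<open>ring\<close> has no unit, so this locale describes not necessarily unital algebras.\<close>

locale assoc_algebra = vector_space scale
  for scale :: "'f::field \<Rightarrow> 'a::ring \<Rightarrow> 'a" +
  assumes scale_mult_left: "scale c x * y = scale c (x * y)"
    and scale_mult_right: "x * scale c y = scale c (x * y)"

text \<open>Unital algebras are taken over the sort \<open>{ring, monoid_mult}\<close> instead of \<open>ring_1\<close>, because
  the latter excludes the zero algebra.\<close>

locale generalized_action =
  H: assoc_algebra scaleH + A: assoc_algebra scaleA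
  for scaleH :: "'f::field \<Rightarrow> 'h::{ring, monoid_mult} \<Rightarrow> 'h"
    and scaleA :: "'f \<Rightarrow> 'a::ring \<Rightarrow> 'a" +
  fixes act :: "'h \<Rightarrow> 'a \<Rightarrow> 'a"
  assumes act_linear: "Vector_Spaces.linear scaleA scaleA (act h)"
    and act_add: "act (g + h) a = act g a + act h a"
    and act_scale: "act (scaleH c h) a = scaleA c (act h a)"
    and act_one: "act 1 a = a"
    and act_mult: "act (g * h) a = act g (act h a)"
    and act_product: "\<exists>k\<ge>1. \<exists>h1 h2 h3 h4 :: nat \<Rightarrow> 'h. \<forall>a b.
      act h (a * b) = (\<Sum>i = 1..k. act (h1 i) a * act (h2 i) b + act (h3 i) b * act (h4 i) a)"


section \<open>The Jacobson radical\<close>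

definition left_ideal :: "('f::field \<Rightarrow> 'a::ring \<Rightarrow> 'a) \<Rightarrow> 'a set \<Rightarrow> bool" where
  "left_ideal scale L \<longleftrightarrow> module.subspace scale L \<and> (\<forall>a. \<forall>x\<in>L. a * x \<in> L)"

text \<open>Without a unit only the modular (regular) maximal left ideals are relevant: those \<open>L\<close>
  possessing a right unit modulo \<open>L\<close>.\<close>

definition modular_maximal_left_ideal ::
    "('f::field \<Rightarrow> 'a::ring \<Rightarrow> 'a) \<Rightarrow> 'a set \<Rightarrow> bool" where
  "modular_maximal_left_ideal scale L \<longleftrightarrow>
     left_ideal scale L \<and> L \<noteq> UNIV \<and>
     (\<forall>L'. left_ideal scale L' \<and> L \<subseteq> L' \<longrightarrow> L' = L \<or> L' = UNIV) \<and>
     (\<exists>e. \<forall>a. a - a * e \<in> L)"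

text \<open>The empty intersection is the whole algebra.\<close>

definition jacobson_radical :: "('f::field \<Rightarrow> 'a::ring \<Rightarrow> 'a) \<Rightarrow> 'a set" where
  "jacobson_radical scale = \<Inter>{L. modular_maximal_left_ideal scale L}"


section \<open>Quotients, H-invariant ideals, H-simplicity\<close>

text \<open>A quotient by a variable ideal is not a type, so quotients, and ideals of quotients
  regarded as algebras, are structures with an explicit carrier.\<close>

record ('f, 'h, 'v) H_structure =
  hcarrier :: "'v set"
  hzero :: 'v
  hadd :: "'v \<Rightarrow> 'v \<Rightarrow> 'v"
  hmult :: "'v \<Rightarrow> 'v \<Rightarrow> 'v"
  hscale :: "'f \<Rightarrow> 'v \<Rightarrow> 'v"
  hact :: "'h \<Rightarrow> 'v \<Rightarrow> 'v"

definition H_invariant_ideal :: "('f, 'h, 'v) H_structure \<Rightarrow> 'v set \<Rightarrow> bool" where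
  "H_invariant_ideal R I \<longleftrightarrow>
     I \<subseteq> hcarrier R \<and> hzero R \<in> I \<and>
     (\<forall>x\<in>I. \<forall>y\<in>I. hadd R x y \<in> I) \<and>
     (\<forall>c. \<forall>x\<in>I. hscale R c x \<in> I) \<and>
     (\<forall>r\<in>hcarrier R. \<forall>x\<in>I. hmult R r x \<in> I \<and> hmult R x r \<in> I) \<and>
     (\<forall>h. \<forall>x\<in>I. hact R h x \<in> I)"

definition H_simple :: "('f, 'h, 'v) H_structure \<Rightarrow> bool" where
  "H_simple R \<longleftrightarrow>
     (\<exists>x\<in>hcarrier R. \<exists>y\<in>hcarrier R. hmult R x y \<noteq> hzero R) \<and>
     (\<forall>I. H_invariant_ideal R I \<longrightarrow> I = {hzero R} \<or> I = hcarrier R)"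

text \<open>Operations on cosets use the elementwise operations on sets; adding \<open>J\<close> completes a subset
  of a coset to the coset (see the lemmas below).\<close>

definition quotient_H_structure ::
    "('f \<Rightarrow> 'a::ring \<Rightarrow> 'a) \<Rightarrow> ('h \<Rightarrow> 'a \<Rightarrow> 'a) \<Rightarrow> 'a set \<Rightarrow> ('f, 'h, 'a set) H_structure" where
  "quotient_H_structure scale act J =
     \<lparr>hcarrier = range (\<lambda>a. a +o J),
      hzero = J,
      hadd = (\<lambda>X Y. X + Y),
      hmult = (\<lambda>X Y. X * Y + J),
      hscale = (\<lambda>c X. scale c ` X + J),
      hact = (\<lambda>h X. act h ` X + J)\<rparr>"

text \<open>The sum in \<open>R\<close> of \<open>b 0, \<dots>, b (q - 1)\<close>; it is \<open>hzero R\<close> for \<open>q = 0\<close>.\<close>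

definition hsum :: "('f, 'h, 'v) H_structure \<Rightarrow> nat \<Rightarrow> (nat \<Rightarrow> 'v) \<Rightarrow> 'v" where
  "hsum R q b = foldr (\<lambda>i s. hadd R (b i) s) [0..<q] (hzero R)"

definition direct_sum_of_ideals ::
    "('f, 'h, 'v) H_structure \<Rightarrow> nat \<Rightarrow> (nat \<Rightarrow> 'v set) \<Rightarrow> bool" where
  "direct_sum_of_ideals R q B \<longleftrightarrow>
     (\<forall>i<q. H_invariant_ideal R (B i)) \<and>
     (\<forall>x\<in>hcarrier R. \<exists>!b. b \<in> (\<Pi>\<^sub>E i\<in>{..<q}. B i) \<and> x = hsum R q b)"

context generalized_action
begin

context
  fixes J :: "'a set"
  assumes J_subspace: "A.subspace J"
    and J_ideal: "\<And>a x. x \<in> J \<Longrightarrow> a * x \<in> J \<and> x * a \<in> J"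
    and J_invariant: "\<And>h x. x \<in> J \<Longrightarrow> act h x \<in> J"
begin

lemma quotient_add:
  "hadd (quotient_H_structure scaleA act J) (a +o J) (b +o J) = (a + b) +o J"
proof -
  have "x \<in> (a +o J) + (b +o J) \<longleftrightarrow> x \<in> (a + b) +o J" for x
  proof
    assume "x \<in> (a +o J) + (b +o J)"
    then obtain u v where uv: "u \<in> J" "v \<in> J" "x = a + u + (b + v)"
      by (auto simp: set_plus_def elt_set_plus_def)
    then have "x = (a + b) + (u + v)" "u + v \<in> J"
      using A.subspace_add[OF J_subspace] by (auto simp: algebra_simps)
    then show "x \<in> (a + b) +o J" by (auto simp: elt_set_plus_def)
  next
    assume "x \<in> (a + b) +o J"
    then obtain u where "u \<in> J" "x = (a + u) + (b + 0)"
      by (auto simp: elt_set_plus_def algebra_simps)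
    then show "x \<in> (a +o J) + (b +o J)"
      using A.subspace_0[OF J_subspace] by (auto simp: set_plus_def elt_set_plus_def)
  qed
  then show ?thesis by (auto simp: quotient_H_structure_def)
qed

lemma coset_completion:
  assumes "X \<subseteq> a +o J" and "X \<noteq> {}"
  shows "X + J = a +o J"
proof -
  have "x \<in> X + J \<longleftrightarrow> x \<in> a +o J" for x
  proof
    assume "x \<in> X + J"
    then obtain u v where uv: "u \<in> J" "v \<in> J" "x = a + u + v"
      using assms(1) by (auto simp: set_plus_def elt_set_plus_def)
    then have "x = a + (u + v)" "u + v \<in> J"
      using A.subspace_add[OF J_subspace] by (auto simp: algebra_simps)
    then show "x \<in> a +o J" by (auto simp: elt_set_plus_def)
  next
    assume "x \<in> a +o J"
    then obtain u where u: "u \<in> J" "x = a + u" by (auto simp: elt_set_plus_def)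
    obtain v where v: "v \<in> J" "a + v \<in> X" using assms by (auto simp: elt_set_plus_def)
    have "x = (a + v) + (u - v)" "u - v \<in> J"
      using u v A.subspace_diff[OF J_subspace] by auto
    then show "x \<in> X + J" using v(2) unfolding set_plus_def by blast
  qed
  then show ?thesis by auto
qed

lemma quotient_mult:
  "hmult (quotient_H_structure scaleA act J) (a +o J) (b +o J) = (a * b) +o J"
proof -
  have "(a +o J) * (b +o J) \<subseteq> (a * b) +o J"
  proof
    fix x assume "x \<in> (a +o J) * (b +o J)"
    then obtain u v where uv: "u \<in> J" "v \<in> J" "x = (a + u) * (b + v)"
      by (auto simp: set_times_def elt_set_plus_def)
    then have "x = a * b + (a * v + u * b + u * v)" by (simp add: algebra_simps)
    moreover have "a * v + u * b + u * v \<in> J"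
      using uv J_ideal A.subspace_add[OF J_subspace] by auto
    ultimately show "x \<in> (a * b) +o J" by (auto simp: elt_set_plus_def)
  qed
  moreover have "(a +o J) * (b +o J) \<noteq> {}"
    using A.subspace_0[OF J_subspace] by (auto simp: set_times_def elt_set_plus_def)
  ultimately show ?thesis
    using coset_completion by (auto simp: quotient_H_structure_def)
qed

lemma quotient_scale:
  "hscale (quotient_H_structure scaleA act J) c (a +o J) = scaleA c a +o J"
proof -
  have "scaleA c ` (a +o J) \<subseteq> scaleA c a +o J"
    using A.subspace_scale[OF J_subspace] by (auto simp: elt_set_plus_def A.scale_right_distrib)
  moreover have "scaleA c ` (a +o J) \<noteq> {}"
    using A.subspace_0[OF J_subspace] by (auto simp: elt_set_plus_def)
  ultimately show ?thesis
    using coset_completion by (auto simp: quotient_H_structure_def)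
qed

lemma quotient_act:
  "hact (quotient_H_structure scaleA act J) h (a +o J) = act h a +o J"
proof -
  interpret lin: Vector_Spaces.linear scaleA scaleA "act h" by (rule act_linear)
  have "act h ` (a +o J) \<subseteq> act h a +o J"
    using J_invariant by (auto simp: elt_set_plus_def lin.add)
  moreover have "act h ` (a +o J) \<noteq> {}"
    using A.subspace_0[OF J_subspace] by (auto simp: elt_set_plus_def)
  ultimately show ?thesis
    using coset_completion by (auto simp: quotient_H_structure_def)
qed

end

end


section \<open>H-polynomials\<close>

text \<open>The free monoid, written additively as required by the convolution product of
  \<open>Poly_Mapping\<close>: finitely supported functions on words form the unital free algebra.\<close>

datatype 'x word = Word (letters: "'x list")

instantiation word :: (type) monoid_add
begin

definition zero_word :: "'a word" where "0 = Word []"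

definition plus_word :: "'a word \<Rightarrow> 'a word \<Rightarrow> 'a word" where
  "v + w = Word (letters v @ letters w)"

instance
  by standard (auto simp: zero_word_def plus_word_def)

end

lemma letters_plus [simp]: "letters (v + w) = letters v @ letters w"
  by (simp add: plus_word_def)

type_synonym ('f, 'h) H_poly = "(nat \<times> 'h) word \<Rightarrow>\<^sub>0 'f"

definition H_poly_scale :: "'f::field \<Rightarrow> ('f, 'h) H_poly \<Rightarrow> ('f, 'h) H_poly" where
  "H_poly_scale c f = Poly_Mapping.map ((*) c) f"

lemma lookup_H_poly_scale [simp]:
  "Poly_Mapping.lookup (H_poly_scale c f) w = c * Poly_Mapping.lookup f w"
  by (simp add: H_poly_scale_def Poly_Mapping.map.rep_eq when_def)

interpretation H_poly: vector_space H_poly_scale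
  by unfold_locales (auto intro!: poly_mapping_eqI simp: lookup_add algebra_simps)

text \<open>The algebra \<open>F\<langle>X|H\<rangle>\<close> for the basis \<open>\<Gamma>\<close> of \<open>H\<close>, which indexes itself: the letter \<open>(i, \<gamma>)\<close> is
  the free generator with lower index \<open>i \<ge> 1\<close> and upper index \<open>\<gamma>\<close>. The algebra has no unit, so the
  empty word is excluded.\<close>

definition free_H_algebra :: "'h set \<Rightarrow> ('f::field, 'h) H_poly set" where
  "free_H_algebra \<Gamma> =
     {f. \<forall>w\<in>Poly_Mapping.keys f. letters w \<noteq> [] \<and> set (letters w) \<subseteq> {1..} \<times> \<Gamma>}"

text \<open>The element \<open>x\<^sub>i\<^sup>h\<close>, by expansion of \<open>h\<close> in the basis \<open>\<Gamma>\<close>.\<close>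

definition H_var :: "('f::field \<Rightarrow> 'h::ab_group_add \<Rightarrow> 'h) \<Rightarrow> 'h set \<Rightarrow> nat \<Rightarrow> 'h \<Rightarrow> ('f, 'h) H_poly" where
  "H_var scaleH \<Gamma> i h =
     (\<Sum>\<gamma> | module.representation scaleH \<Gamma> h \<gamma> \<noteq> 0.
        Poly_Mapping.single (Word [(i, \<gamma>)]) (module.representation scaleH \<Gamma> h \<gamma>))"

text \<open>The value for the empty word is irrelevant, because that word does not occur in
  \<open>free_H_algebra\<close>.\<close>

fun word_value :: "('h \<Rightarrow> 'a::ring \<Rightarrow> 'a) \<Rightarrow> (nat \<Rightarrow> 'a) \<Rightarrow> (nat \<times> 'h) list \<Rightarrow> 'a" where
  "word_value act \<psi> [] = 0"
| "word_value act \<psi> [(i, \<gamma>)] = act \<gamma> (\<psi> i)"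
| "word_value act \<psi> ((i, \<gamma>) # l # ls) = act \<gamma> (\<psi> i) * word_value act \<psi> (l # ls)"

text \<open>The homomorphism \<open>F\<langle>X|H\<rangle> \<rightarrow> A\<close> extending \<open>x\<^sub>i \<mapsto> \<psi> i\<close>; see \<open>H_eval_linear\<close>, \<open>H_eval_mult\<close> and
  \<open>H_eval_H_var\<close>.\<close>

definition H_eval ::
    "('f::field \<Rightarrow> 'a::ring \<Rightarrow> 'a) \<Rightarrow> ('h \<Rightarrow> 'a \<Rightarrow> 'a) \<Rightarrow> (nat \<Rightarrow> 'a) \<Rightarrow> ('f, 'h) H_poly \<Rightarrow> 'a" where
  "H_eval scaleA act \<psi> f =
     (\<Sum>w\<in>Poly_Mapping.keys f.
        scaleA (Poly_Mapping.lookup f w) (word_value act \<psi> (letters w)))"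

definition H_identities ::
    "('f::field \<Rightarrow> 'a::ring \<Rightarrow> 'a) \<Rightarrow> ('h \<Rightarrow> 'a \<Rightarrow> 'a) \<Rightarrow> 'h set \<Rightarrow> ('f, 'h) H_poly set" where
  "H_identities scaleA act \<Gamma> = {f \<in> free_H_algebra \<Gamma>. \<forall>\<psi>. H_eval scaleA act \<psi> f = 0}"

lemma sum_singles:
  "(\<Sum>w\<in>Poly_Mapping.keys f. Poly_Mapping.single w (Poly_Mapping.lookup f w)) = f"
  by (rule poly_mapping_eqI) (simp add: lookup_sum lookup_single when_def in_keys_iff)

lemma word_value_append:
  assumes "u \<noteq> []" "v \<noteq> []"
  shows "word_value act \<psi> (u @ v) = word_value act \<psi> u * word_value act \<psi> v"
  using assms
proof (induction u)
  case Nil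
  then show ?case by simp
next
  case (Cons p u)
  obtain i \<gamma> where p: "p = (i, \<gamma>)" by (cases p)
  show ?case
  proof (cases u)
    case Nil
    then show ?thesis using p Cons.prems by (cases v) auto
  next
    case (Cons l ls)
    then show ?thesis using p Cons.IH Cons.prems by (auto simp: mult.assoc)
  qed
qed

context assoc_algebra
begin

lemma H_eval_superset:
  assumes "finite S" "Poly_Mapping.keys f \<subseteq> S"
  shows "H_eval scale act \<psi> f =
    (\<Sum>w\<in>S. scale (Poly_Mapping.lookup f w) (word_value act \<psi> (letters w)))"
  unfolding H_eval_def
  by (rule sum.mono_neutral_left) (use assms in \<open>auto simp: in_keys_iff\<close>)

lemma H_eval_linear: "Vector_Spaces.linear H_poly_scale scale (H_eval scale act \<psi>)"
proof -
  have add: "H_eval scale act \<psi> (f + g) = H_eval scale act \<psi> f + H_eval scale act \<psi> g" for f g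
  proof -
    let ?S = "Poly_Mapping.keys f \<union> Poly_Mapping.keys g"
    have "Poly_Mapping.keys (f + g) \<subseteq> ?S" by (rule Poly_Mapping.keys_add)
    then show ?thesis
      by (simp add: H_eval_superset[of ?S] lookup_add scale_left_distrib sum.distrib)
  qed
  have scale: "H_eval scale act \<psi> (H_poly_scale c f) = scale c (H_eval scale act \<psi> f)" for c f
  proof -
    have "Poly_Mapping.keys (H_poly_scale c f) \<subseteq> Poly_Mapping.keys f"
      by (auto simp: in_keys_iff)
    then show ?thesis
      by (simp add: H_eval_superset[of "Poly_Mapping.keys f" "H_poly_scale c f"]
          H_eval_def[of _ _ _ f] scale_sum_right)
  qed
  show ?thesis
    by unfold_locales (simp_all add: add scale)
qed

lemma H_eval_single:
  "H_eval scale act \<psi> (Poly_Mapping.single w c) = scale c (word_value act \<psi> (letters w))"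
  by (simp add: H_eval_def)

lemma H_eval_mult:
  assumes "f \<in> free_H_algebra \<Gamma>" "g \<in> free_H_algebra \<Gamma>"
  shows "H_eval scale act \<psi> (f * g) = H_eval scale act \<psi> f * H_eval scale act \<psi> g"
proof -
  interpret lin: Vector_Spaces.linear H_poly_scale scale "H_eval scale act \<psi>"
    by (rule H_eval_linear)
  let ?f = "Poly_Mapping.lookup f" and ?g = "Poly_Mapping.lookup g"
  let ?val = "\<lambda>w. word_value act \<psi> (letters w)"
  have "f * g = (\<Sum>u\<in>Poly_Mapping.keys f. Poly_Mapping.single u (?f u)) *
      (\<Sum>v\<in>Poly_Mapping.keys g. Poly_Mapping.single v (?g v))"
    by (simp add: sum_singles)
  also have "\<dots> = (\<Sum>u\<in>Poly_Mapping.keys f. \<Sum>v\<in>Poly_Mapping.keys g.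
      Poly_Mapping.single (u + v) (?f u * ?g v))"
    by (simp add: sum_product mult_single)
  finally have "H_eval scale act \<psi> (f * g) =
      (\<Sum>u\<in>Poly_Mapping.keys f. \<Sum>v\<in>Poly_Mapping.keys g. scale (?f u * ?g v) (?val (u + v)))"
    by (simp add: lin.sum H_eval_single)
  also have "\<dots> = (\<Sum>u\<in>Poly_Mapping.keys f. \<Sum>v\<in>Poly_Mapping.keys g.
      scale (?f u) (?val u) * scale (?g v) (?val v))"
  proof (intro sum.cong refl)
    fix u v assume "u \<in> Poly_Mapping.keys f" "v \<in> Poly_Mapping.keys g"
    then have "?val (u + v) = ?val u * ?val v"
      using assms by (auto simp: free_H_algebra_def intro!: word_value_append)
    then show "scale (?f u * ?g v) (?val (u + v)) = scale (?f u) (?val u) * scale (?g v) (?val v)"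
      by (simp add: scale_mult_left scale_mult_right)
  qed
  finally show ?thesis by (simp add: H_eval_def sum_product)
qed

end

lemma (in generalized_action) H_eval_H_var:
  assumes "H.independent \<Gamma>" "H.span \<Gamma> = UNIV"
  shows "H_eval scaleA act \<psi> (H_var scaleH \<Gamma> i h) = act h (\<psi> i)"
proof -
  interpret lin: Vector_Spaces.linear H_poly_scale scaleA "H_eval scaleA act \<psi>"
    by (rule A.H_eval_linear)
  interpret act_lin: Vector_Spaces.linear scaleH scaleA "\<lambda>h. act h (\<psi> i)"
    by unfold_locales (simp_all add: act_add act_scale)
  let ?r = "H.representation \<Gamma> h"
  have "act h (\<psi> i) = act (\<Sum>\<gamma> | ?r \<gamma> \<noteq> 0. scaleH (?r \<gamma>) \<gamma>) (\<psi> i)"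
    using H.sum_nonzero_representation_eq[OF assms(1), of h] assms(2) by simp
  also have "\<dots> = (\<Sum>\<gamma> | ?r \<gamma> \<noteq> 0. scaleA (?r \<gamma>) (act \<gamma> (\<psi> i)))"
    by (simp add: act_lin.sum act_scale)
  finally show ?thesis
    by (simp add: H_var_def lin.sum A.H_eval_single)
qed


section \<open>H-codimensions\<close>

definition multilinear_H_polys ::
    "('f::field \<Rightarrow> 'h::ab_group_add \<Rightarrow> 'h) \<Rightarrow> 'h set \<Rightarrow> nat \<Rightarrow> ('f, 'h) H_poly set" where
  "multilinear_H_polys scaleH \<Gamma> n = module.span H_poly_scale
     {prod_list (map (\<lambda>j. H_var scaleH \<Gamma> (\<sigma> j) (h j)) [1..<Suc n]) | \<sigma> h. \<sigma> permutes {1..n}}"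

text \<open>Dimension of \<open>V / W\<close>. A basis of the quotient is given by representatives:
  \<open>basis_modulo scale V W B\<close> says that \<open>B \<subseteq> V\<close> is mapped injectively onto a basis of \<open>V / W\<close>.
  As for \<open>dim\<close>, an infinite-dimensional quotient gets the value 0.\<close>

definition basis_modulo ::
    "('f::field \<Rightarrow> 'v::ab_group_add \<Rightarrow> 'v) \<Rightarrow> 'v set \<Rightarrow> 'v set \<Rightarrow> 'v set \<Rightarrow> bool" where
  "basis_modulo scale V W B \<longleftrightarrow> B \<subseteq> V \<and>
     (\<forall>T u. finite T \<and> T \<subseteq> B \<and> (\<Sum>b\<in>T. scale (u b) b) \<in> W \<longrightarrow> (\<forall>b\<in>T. u b = 0)) \<and>
     (\<forall>v\<in>V. \<exists>s\<in>module.span scale B. v - s \<in> W)"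

definition quotient_dim ::
    "('f::field \<Rightarrow> 'v::ab_group_add \<Rightarrow> 'v) \<Rightarrow> 'v set \<Rightarrow> 'v set \<Rightarrow> nat" where
  "quotient_dim scale V W = card (SOME B. basis_modulo scale V W B)"

definition H_codim ::
    "('f::field \<Rightarrow> 'h::ab_group_add \<Rightarrow> 'h) \<Rightarrow> ('f \<Rightarrow> 'a::ring \<Rightarrow> 'a) \<Rightarrow> ('h \<Rightarrow> 'a \<Rightarrow> 'a) \<Rightarrow>
     'h set \<Rightarrow> nat \<Rightarrow> nat" where
  "H_codim scaleH scaleA act \<Gamma> n =
     quotient_dim H_poly_scale (multilinear_H_polys scaleH \<Gamma> n)
       (multilinear_H_polys scaleH \<Gamma> n \<inter> H_identities scaleA act \<Gamma>)"

end

theory Submission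
  imports Defs "HOL-Library.Function_Algebras" "HOL-Combinatorics.Multiset_Permutations"
begin

text \<open>
  Let \<open>J\<close> be the radical. Choose for each simple summand \<open>B\<^sub>i\<close> of \<open>A / J\<close> a smallest
  H-invariant ideal \<open>I\<^sub>i\<close> of \<open>A\<close> covering it, and a basis of \<open>A\<close> adapted to \<open>J\<close> and the
  \<open>I\<^sub>i\<close>. A set \<open>S\<close> of summands is admissible if a nonzero product has a factor from every
  \<open>I\<^sub>i\<close> with \<open>i \<in> S\<close>, the other factors being from \<open>J\<close> or any of the \<open>I\<^sub>i\<close>. The limit is
  the maximum \<open>d\<close> of \<open>\<Sum>i\<in>S. dim B\<^sub>i\<close> over the admissible sets \<open>S\<close>.

  Upper bound: the codimension is at most \<open>dim A\<close> times the number of tuples of basis elements on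
  which some multilinear H-polynomial does not vanish. In such a tuple the simple
  labels form an admissible set, and the number of radical elements is less than a constant
  \<open>p\<close>; giving the latter the weight \<open>\<epsilon>\<close>, one finds at most
  \<open>2\<^sup>q (d + \<epsilon> dim J)\<^sup>n / \<epsilon>\<^sup>p\<close> of them.

  Lower bound: let \<open>S\<close> be an admissible set of dimension \<open>d\<close>. Take a nonzero product for \<open>S\<close> with the maximal
  number of factors in \<open>J\<close>. Substituting elements of another summand or of \<open>J\<close>
  into the place of a simple factor would produce a further radical factor and hence gives 0.
  With Burnside's density theorem this yields a multilinear H-polynomial with some constants that equals
  \<open>det(x) w\<close> on \<open>A\<^sub>S = \<Sum>i\<in>S. I\<^sub>i\<close>, \<open>w \<noteq> 0\<close>. Replacing one argument \<open>x\<^sub>l\<close> of it by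
  \<open>\<phi> x\<^sub>l\<close> and summing over \<open>l\<close> multiplies it by \<open>tr \<phi>\<close>, so it can be multiplied by the
  values \<open>tr (u v)\<close> of the trace form, which is nondegenerate on \<open>A\<^sub>S / J\<close> in characteristic 0, and
  then by determinants of these. Products of such determinants, indexed by pairs of words with balanced
  letters, form a diagonal system at points given by dual bases, so that the codimension is at least the
  number of these pairs, which has growth rate \<open>d\<close>.
\<close>

section \<open>Linear algebra\<close>

text \<open>No H-invariant subalgebra complementing \<open>J\<close> is given, so
  \<open>A / J\<close> is never lifted: facts about it are kept as congruences modulo
  \<open>J\<close> on the preimages of the \<open>B_i\<close>, and unwanted substitutions are
  excluded by counting radical factors. As \<open>B_i\<close> need not be simple without
  \<open>H\<close>, density is applied to the operators generated by multiplications and by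
  \<open>H\<close> together. The function \<open>det(x) w\<close> has a fixed number of arguments,
  part of them constants, so its alternation alone yields no growth; the growth has to come from
  arbitrarily many further variables free of constants. The trace form supplies them, and a
  determinant of values \<open>tr (u_i v_j)\<close> alternates in the \<open>u_i\<close> and in the
  \<open>v_j\<close>: hence words come in pairs, one letter per variable. Instead of representations
  of symmetric groups, a triangularity argument separates the words: the columns of the determinants
  are sheared across successive blocks and the first \<open>d\<close> blocks are held fixed. Balance
  lets the columns fill all blocks exactly; it costs each block only a factor polynomial in
  \<open>m\<close>, which disappears in the limit of large \<open>m\<close>.\<close>

lemma (in vector_space) family_dependent:
  assumes "finite I" "finite T" "w ` I \<subseteq> span T" "card T < card I"
  shows "\<exists>u. (\<exists>i\<in>I. u i \<noteq> 0) \<and> (\<Sum>i\<in>I. scale (u i) (w i)) = 0"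
proof (cases "inj_on w I")
  case True
  then have "card (w ` I) = card I" by (rule card_image)
  then have "dependent (w ` I)"
    using independent_span_bound[of T "w ` I"] assms(2-4) by linarith
  then obtain u where u: "\<exists>v\<in>w ` I. u v \<noteq> 0" "(\<Sum>v\<in>w ` I. scale (u v) v) = 0"
    using dependent_finite[of "w ` I"] assms(1) by auto
  have "(\<Sum>i\<in>I. scale ((u \<circ> w) i) (w i)) = 0"
    using u(2) by (simp add: sum.reindex[OF True])
  then show ?thesis using u(1) by (intro exI[of _ "u \<circ> w"]) auto
next
  case False
  then obtain i j where ij: "i \<in> I" "j \<in> I" "i \<noteq> j" "w i = w j" by (auto simp: inj_on_def)
  define u :: "'c \<Rightarrow> 'a" where "u k = (if k = i then 1 else 0) - (if k = j then 1 else 0)" for k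
  have "(\<Sum>k\<in>I. scale (u k) (w k)) =
      (\<Sum>k\<in>I. (if k = i then w k else 0) - (if k = j then w k else 0))"
    by (rule sum.cong) (auto simp: u_def)
  also have "\<dots> = w i - w j"
    using ij assms(1) by (simp add: sum_subtractf)
  finally show ?thesis using ij by (intro exI[of _ u]) (auto simp: u_def)
qed

text \<open>Among the nonzero polynomials that annihilate \<open>v\<close> under \<open>f\<close>
  take \<open>p\<close> of least degree. A root \<open>c\<close> splits off a linear factor,
  \<open>p = (X - c) q\<close>, and \<open>q\<close> applied to \<open>v\<close> is the eigenvector:
  it is nonzero by minimality and lies in \<open>U\<close> because \<open>U\<close> is
  invariant.\<close>

lemma eigenvector_exists:
  fixes scale :: "'f::alg_closed_field \<Rightarrow> 'v::ab_group_add \<Rightarrow> 'v"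
  assumes "finite_dimensional_vector_space scale E"
    and "Vector_Spaces.linear scale scale f"
    and U: "module.subspace scale U" "f ` U \<subseteq> U" "v \<in> U" "v \<noteq> 0"
  obtains c x where "x \<in> U" "x \<noteq> 0" "f x = scale c x"
proof -
  interpret finite_dimensional_vector_space scale E by fact
  interpret f: Vector_Spaces.linear scale scale f by fact
  have pow_U: "(f ^^ i) v \<in> U" for i
    by (induction i) (use U in auto)
  define ev where "ev p = (\<Sum>i\<le>degree p. scale (coeff p i) ((f ^^ i) v))" for p
  have ev_eq: "ev p = (\<Sum>i\<le>n. scale (coeff p i) ((f ^^ i) v))" if "degree p \<le> n" for p n
    unfolding ev_def
    by (rule sum.mono_neutral_left) (use that in \<open>auto simp: coeff_eq_0\<close>)
  have ev_U: "ev p \<in> U" for p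
    unfolding ev_def by (intro subspace_sum subspace_scale U pow_U)
  have ev_linear_factor: "ev ([:-c, 1:] * q) = f (ev q) - scale c (ev q)" for c q
  proof -
    let ?n = "Suc (degree q)"
    have "degree ([:-c, 1:] * q) \<le> ?n"
      using degree_mult_le[of "[:-c, 1:]" q] by simp
    then have "ev ([:-c, 1:] * q) = (\<Sum>i\<le>?n. scale (coeff ([:-c, 1:] * q) i) ((f ^^ i) v))"
      by (rule ev_eq)
    also have "\<dots> = (\<Sum>i\<le>?n. scale (coeff (pCons 0 q) i) ((f ^^ i) v))
        - (\<Sum>i\<le>?n. scale (c * coeff q i) ((f ^^ i) v))"
      by (simp add: sum_subtractf[symmetric] scale_left_diff_distrib)
    also have "(\<Sum>i\<le>?n. scale (coeff (pCons 0 q) i) ((f ^^ i) v)) = f (ev q)"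
      by (simp only: sum.atMost_Suc_shift) (simp add: ev_def f.sum f.scale)
    also have "(\<Sum>i\<le>?n. scale (c * coeff q i) ((f ^^ i) v)) = scale c (ev q)"
      unfolding ev_eq[of q ?n, OF le_SucI[OF order_refl]] by (simp add: scale_sum_right del: sum.atMost_Suc)
    finally show ?thesis .
  qed
  have "\<exists>p. p \<noteq> 0 \<and> ev p = 0"
  proof -
    have "\<exists>u. (\<exists>i\<in>{..card E}. u i \<noteq> 0) \<and> (\<Sum>i\<in>{..card E}. scale (u i) ((f ^^ i) v)) = 0"
      by (rule family_dependent[of _ E]) (use finite_Basis span_Basis in auto)
    then obtain u j where u: "j \<le> card E" "u j \<noteq> 0" "(\<Sum>i\<le>card E. scale (u i) ((f ^^ i) v)) = 0"
      by auto
    define p where "p = (\<Sum>i\<le>card E. monom (u i) i)"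
    have c: "coeff p i = (if i \<le> card E then u i else 0)" for i
      by (simp add: p_def coeff_sum)
    then have "coeff p j \<noteq> 0" using u by simp
    moreover have "degree p \<le> card E" by (rule degree_le) (simp add: c)
    then have "ev p = 0" using u(3) by (subst ev_eq[of p "card E"]) (auto simp: c)
    ultimately show ?thesis by (intro exI[of _ p]) auto
  qed
  then obtain p where p: "p \<noteq> 0" "ev p = 0"
    and min: "\<And>r. r \<noteq> 0 \<Longrightarrow> ev r = 0 \<Longrightarrow> degree p \<le> degree r"
    using ex_has_least_nat[of "\<lambda>p. p \<noteq> 0 \<and> ev p = 0" _ degree] by blast
  have "degree p > 0"
  proof (rule ccontr)
    assume "\<not> degree p > 0"
    then have "ev p = scale (coeff p 0) v" by (simp add: ev_def)
    moreover have "coeff p 0 \<noteq> 0" using \<open>\<not> degree p > 0\<close> p(1) leading_coeff_0_iff[of p] by simp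
    ultimately show False using p U by simp
  qed
  then obtain c where "poly p c = 0" using alg_closed_imp_poly_has_root by blast
  then obtain q where q: "p = [:-c, 1:] * q" by (auto simp: poly_eq_0_iff_dvd)
  then have "q \<noteq> 0" using p by auto
  then have "degree p = Suc (degree q)" unfolding q by (subst degree_mult_eq) auto
  then have "ev q \<noteq> 0" using min[of q] \<open>q \<noteq> 0\<close> by force
  moreover have "f (ev q) = scale c (ev q)" using p q ev_linear_factor by auto
  ultimately show ?thesis using that ev_U by blast
qed

text \<open>In a basis of \<open>U\<close> that contains \<open>z\<close>, the images of the other
  basis vectors already span the image of \<open>U\<close>. This drop of rank is what contradicts
  minimality in the next lemma.\<close>

lemma (in finite_dimensional_vector_space) dim_image_less:
  assumes "Vector_Spaces.linear scale scale g" "subspace U" "z \<in> U" "z \<noteq> 0" "g z = 0"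
  shows "dim (g ` U) < dim U"
proof -
  interpret g: Vector_Spaces.linear scale scale g by fact
  obtain B where B: "{z} \<subseteq> B" "B \<subseteq> U" "independent B" "U \<subseteq> span B"
    using maximal_independent_subset_extend[of "{z}" U] assms by auto
  have fB: "finite B" using B finiteI_independent by auto
  have "g ` U \<subseteq> g ` span B" using B by auto
  also have "\<dots> = span (g ` B)" by (simp add: g.span_image)
  also have "g ` B \<subseteq> insert 0 (g ` (B - {z}))" using assms by auto
  then have "span (g ` B) \<subseteq> span (g ` (B - {z}))" using span_mono span_insert_0 by blast
  finally have "dim (g ` U) \<le> card (g ` (B - {z}))" using fB by (intro dim_le_card) auto
  also have "\<dots> \<le> card (B - {z})" using fB by (intro card_image_le) auto
  also have "\<dots> < card B" using B fB by (intro psubset_card_mono) auto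
  also have "card B = dim U" using B by (intro basis_card_eq_dim)
  finally show ?thesis .
qed

text \<open>A nonzero operator \<open>T\<close> of minimal rank has rank one: otherwise \<open>T x\<^sub>1, T x\<^sub>2\<close> are
  independent for some \<open>x\<^sub>1, x\<^sub>2\<close>, and for \<open>A\<close> with \<open>A T x\<^sub>1 = x\<^sub>2\<close> and an eigenvalue \<open>c\<close> of \<open>T A\<close>
  on the range of \<open>T\<close> the operator \<open>T A T - c T\<close> is nonzero of smaller rank.\<close>

lemma transitive_operators_rank_one:
  fixes scale :: "'f::alg_closed_field \<Rightarrow> 'v::ab_group_add \<Rightarrow> 'v"
  assumes "finite_dimensional_vector_space scale E"
    and V: "module.subspace scale V" "v \<in> V" "v \<noteq> 0"
    and lin: "\<And>T. T \<in> \<A> \<Longrightarrow> Vector_Spaces.linear scale scale T"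
    and pres: "\<And>T x. T \<in> \<A> \<Longrightarrow> x \<in> V \<Longrightarrow> T x \<in> V"
    and add: "\<And>S T. S \<in> \<A> \<Longrightarrow> T \<in> \<A> \<Longrightarrow> (\<lambda>x. S x + T x) \<in> \<A>"
    and scale: "\<And>c T. T \<in> \<A> \<Longrightarrow> (\<lambda>x. scale c (T x)) \<in> \<A>"
    and comp: "\<And>S T. S \<in> \<A> \<Longrightarrow> T \<in> \<A> \<Longrightarrow> \<exists>R\<in>\<A>. \<forall>x\<in>V. R x = S (T x)"
    and trans: "\<And>x y. x \<in> V \<Longrightarrow> x \<noteq> 0 \<Longrightarrow> y \<in> V \<Longrightarrow> \<exists>T\<in>\<A>. T x = y"
  shows "\<exists>T\<in>\<A>. \<exists>y\<in>V. y \<noteq> 0 \<and> T ` V = module.span scale {y}"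
proof -
  interpret finite_dimensional_vector_space scale E by fact
  let ?P = "\<lambda>T. T \<in> \<A> \<and> (\<exists>x\<in>V. T x \<noteq> 0)"
  obtain T1 where "T1 \<in> \<A>" "T1 v = v" using trans[OF V(2,3) V(2)] by auto
  then have "?P T1" using V by (auto intro!: bexI[of _ v])
  then obtain T where T: "?P T" and min: "\<And>S. ?P S \<Longrightarrow> dim (T ` V) \<le> dim (S ` V)"
    using ex_has_least_nat[of ?P T1 "\<lambda>T. dim (T ` V)"] by blast
  interpret T: Vector_Spaces.linear scale scale T using T lin by auto
  obtain x1 where x1: "x1 \<in> V" "T x1 \<noteq> 0" using T by auto
  have "T ` V \<subseteq> span {T x1}"
  proof (rule ccontr)
    assume "\<not> ?thesis"
    then obtain x2 where x2: "x2 \<in> V" "T x2 \<notin> span {T x1}" by auto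
    obtain A where A: "A \<in> \<A>" "A (T x1) = x2" using trans[OF pres[of T x1] x1(2) x2(1)] T x1 by auto
    obtain R where R: "R \<in> \<A>" "\<forall>x\<in>V. R x = T (A x)" using comp[of T A] T A by auto
    obtain R' where R': "R' \<in> \<A>" "\<forall>x\<in>V. R' x = R (T x)" using comp[of R T] T R by auto
    interpret R: Vector_Spaces.linear scale scale R using R lin by auto
    have TV: "T x \<in> V" if "x \<in> V" for x using that pres T by auto
    have sub: "subspace (T ` V)" by (rule T.subspace_image[OF V(1)])
    have "R (T x) \<in> T ` V" if "x \<in> V" for x
      using that R(2) pres[OF A(1)] TV by auto
    then have inv: "R ` (T ` V) \<subseteq> T ` V" by auto
    have "T x1 \<in> T ` V" using x1 by auto
    then obtain c z where z: "z \<in> T ` V" "z \<noteq> 0" "R z = scale c z"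
      by (rule eigenvector_exists[OF assms(1) R.linear_axioms sub inv _ x1(2)])
    define S where "S = (\<lambda>x. R' x + scale (-c) (T x))"
    have SA: "S \<in> \<A>" unfolding S_def by (rule add[OF R'(1) scale]) (use T in auto)
    define g where "g x = R x - scale c x" for x
    have g: "Vector_Spaces.linear scale scale g"
      by unfold_locales
        (simp_all add: g_def R.add R.scale scale_right_distrib scale_right_diff_distrib mult.commute)
    have S: "S x = g (T x)" if "x \<in> V" for x using that R' by (simp add: S_def g_def)
    then have "S ` V = g ` (T ` V)" by (simp add: image_image)
    then have "dim (S ` V) < dim (T ` V)"
      using dim_image_less[OF g sub z(1,2)] z(3) by (simp add: g_def)
    moreover have "S x1 \<noteq> 0"
    proof
      assume "S x1 = 0"
      then have "T x2 = scale c (T x1)" using S x1 R(2) A TV by (simp add: g_def)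
      then show False using x2(2) by (simp add: span_scale span_base)
    qed
    then have "?P S" using SA x1 by auto
    ultimately show False using min[of S] by auto
  qed
  moreover have "span {T x1} \<subseteq> T ` V"
    using x1 T.subspace_image[OF V(1)] by (intro span_minimal) auto
  ultimately have "T ` V = span {T x1}" by (rule subset_antisym)
  then show ?thesis using T x1 pres by (intro bexI[of _ T] bexI[of _ "T x1"]) auto
qed

text \<open>Induction on \<open>B\<close> with a Gram-Schmidt step: a functional that does not
  vanish on the part of \<open>b\<close> transversal to \<open>span B\<close> is corrected by the
  dual functionals already found. \<open>\<Phi>\<close> may be a proper space of functionals, known
  only through its closure properties; it will consist of compositions with multiplication
  operators, and later of the functionals \<open>tr (x * v)\<close>.\<close>

lemma (in vector_space) dual_functionals_exist:
  fixes \<Phi> :: "('b \<Rightarrow> 'a) set"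
  assumes "finite B" "independent B"
    and lin: "\<And>\<phi>. \<phi> \<in> \<Phi> \<Longrightarrow> Vector_Spaces.linear scale (*) \<phi>"
    and add: "\<And>\<phi> \<psi>. \<phi> \<in> \<Phi> \<Longrightarrow> \<psi> \<in> \<Phi> \<Longrightarrow> (\<lambda>x. \<phi> x + \<psi> x) \<in> \<Phi>"
    and scale: "\<And>c \<phi>. \<phi> \<in> \<Phi> \<Longrightarrow> (\<lambda>x. c * \<phi> x) \<in> \<Phi>"
    and sep: "\<And>x. x \<in> span B \<Longrightarrow> x \<noteq> 0 \<Longrightarrow> \<exists>\<phi>\<in>\<Phi>. \<phi> x \<noteq> 0"
  shows "\<forall>b\<in>B. \<exists>\<phi>\<in>\<Phi>. \<forall>b'\<in>B. \<phi> b' = (if b' = b then 1 else 0)"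
  using assms(1,2) sep
proof (induction B)
  case empty
  then show ?case by simp
next
  case (insert b B)
  have ind: "independent B" using insert.prems(1) by (rule independent_mono) auto
  moreover have "\<exists>\<phi>\<in>\<Phi>. \<phi> x \<noteq> 0" if "x \<in> span B" "x \<noteq> 0" for x
    using that insert.prems(2)[of x] span_mono[of B "insert b B"] by auto
  ultimately have "\<forall>b\<in>B. \<exists>\<phi>\<in>\<Phi>. \<forall>b'\<in>B. \<phi> b' = (if b' = b then 1 else 0)"
    using insert.IH by blast
  then have "\<forall>a\<in>B. \<exists>\<phi>. \<phi> \<in> \<Phi> \<and> (\<forall>b'\<in>B. \<phi> b' = (if b' = a then 1 else 0))" by (simp add: Bex_def)
  from bchoice[OF this] obtain D
    where D0: "\<forall>a\<in>B. D a \<in> \<Phi> \<and> (\<forall>b'\<in>B. D a b' = (if b' = a then 1 else 0))" ..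
  have D: "\<And>a. a \<in> B \<Longrightarrow> D a \<in> \<Phi>"
    "\<And>a a'. a \<in> B \<Longrightarrow> a' \<in> B \<Longrightarrow> D a a' = (if a' = a then 1 else 0)"
    using D0 by auto
  define x where "x = b - (\<Sum>a\<in>B. scale (D a b) a)"
  have bB: "b \<notin> span B" using insert by (simp add: independent_insert)
  have "x \<noteq> 0"
  proof
    assume "x = 0"
    then have "b = (\<Sum>a\<in>B. scale (D a b) a)" by (simp add: x_def)
    moreover have "(\<Sum>a\<in>B. scale (D a b) a) \<in> span B" by (intro span_sum span_scale span_base)
    ultimately show False using bB by simp
  qed
  moreover have "x \<in> span (insert b B)"
    unfolding x_def by (intro span_diff span_sum span_scale span_base) auto
  ultimately obtain \<phi> where \<phi>: "\<phi> \<in> \<Phi>" "\<phi> x \<noteq> 0" using insert.prems(2)[of x] by auto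
  \<comment> \<open>Starting the sum at \<open>\<phi>\<close> gives the induction over
    \<open>C\<close> a base case in \<open>\<Phi>\<close>.\<close>
  have sum_closed: "(\<lambda>y. \<phi> y + (\<Sum>a\<in>C. c a * D a y)) \<in> \<Phi>" if "C \<subseteq> B" for c C
    using finite_subset[OF that insert.hyps(1)] that
  proof (induction C)
    case empty
    then show ?case using \<phi> by simp
  next
    case (insert a C)
    then have "(\<lambda>y. (\<phi> y + (\<Sum>a\<in>C. c a * D a y)) + c a * D a y) \<in> \<Phi>"
      by (intro add[of "\<lambda>y. \<phi> y + (\<Sum>a\<in>C. c a * D a y)"] scale[OF D(1)]) auto
    then show ?case using insert by (simp add: algebra_simps)
  qed
  \<comment> \<open>The correction makes the functional vanish on \<open>B\<close>; its value at
    \<open>b\<close> becomes \<open>\<phi> x\<close>, which was chosen nonzero.\<close>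
  define \<psi> where "\<psi> y = \<phi> y + (\<Sum>a\<in>B. (- \<phi> a) * D a y)" for y
  have \<psi>: "\<psi> \<in> \<Phi>" unfolding \<psi>_def[abs_def] using sum_closed[of B "\<lambda>a. - \<phi> a"] by simp
  have \<psi>0: "\<psi> a = 0" if "a \<in> B" for a
  proof -
    have "(\<Sum>a'\<in>B. (- \<phi> a') * D a' a) = (\<Sum>a'\<in>B. if a = a' then - \<phi> a' else 0)"
      using that D by (intro sum.cong) auto
    then show ?thesis using that insert.hyps by (simp add: \<psi>_def)
  qed
  have "\<psi> b = \<phi> x"
  proof -
    interpret l: Vector_Spaces.linear scale "(*)" \<phi> by (rule lin) (fact \<phi>)
    show ?thesis by (simp add: \<psi>_def x_def l.diff l.sum l.scale sum_negf mult.commute)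
  qed
  then have b: "\<psi> b \<noteq> 0" using \<phi> by simp
  have bn: "b \<notin> B" using insert.hyps by auto
  show ?case
  proof
    fix c assume c: "c \<in> insert b B"
    show "\<exists>\<phi>\<in>\<Phi>. \<forall>b'\<in>insert b B. \<phi> b' = (if b' = c then 1 else 0)"
    proof (cases "c = b")
      case True
      show ?thesis
        by (rule bexI[OF _ scale[OF \<psi>, of "1 / \<psi> b"]]) (use True \<psi>0 b bn in auto)
    next
      case False
      then have cB: "c \<in> B" using c by auto
      have "(\<lambda>y. D c y + (- D c b / \<psi> b) * \<psi> y) \<in> \<Phi>"
        by (rule add[OF D(1)[OF cB] scale[OF \<psi>]])
      then show ?thesis
        by (rule bexI[rotated]) (use False cB \<psi>0 b bn D in auto)
    qed
  qed
qed

text \<open>In a basis composed of a basis \<open>R\<close> of the range and a basis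
  \<open>K\<close> of the kernel, \<open>p\<close> is diagonal with entries 1 and 0. That the trace
  does not depend on the basis is seen by expanding over both bases and exchanging the sums.\<close>

lemma (in finite_dimensional_vector_space) trace_idempotent:
  assumes E: "independent E" "span E = UNIV"
    and "Vector_Spaces.linear scale scale p" and idem: "\<And>x. p (p x) = p x"
  shows "(\<Sum>e\<in>E. representation E (p e) e) = of_nat (dim (range p))"
proof -
  interpret p: Vector_Spaces.linear scale scale p by fact
  have fE: "finite E" using E finiteI_independent by auto
  obtain R where R: "R \<subseteq> range p" "independent R" "range p \<subseteq> span R" "card R = dim (range p)"
    using basis_exists by blast
  obtain K where K: "K \<subseteq> {x. p x = 0}" "independent K" "{x. p x = 0} \<subseteq> span K"
    using basis_exists by blast
  have fin: "finite R" "finite K" using R K finiteI_independent by auto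
  have pR: "p x = x" if "x \<in> span R" for x
  proof -
    have "span R \<subseteq> range p" using R p.subspace_image[of UNIV] by (intro span_minimal) auto
    then show ?thesis using that idem by auto
  qed
  have pK: "p x = 0" if "x \<in> span K" for x
    using that K p.eq_0_on_span[of K] by blast
  have disj: "R \<inter> K = {}"
  proof -
    have "x = 0" if "x \<in> R" "x \<in> K" for x
      using that pR[of x] pK[of x] by (simp add: span_base)
    then show ?thesis using R dependent_zero by auto
  qed
  define B where "B = R \<union> K"
  have fB: "finite B" using fin by (simp add: B_def)
  have "independent B"
  proof (rule independent_if_scalars_zero[OF fB])
    fix u x assume u: "(\<Sum>x\<in>B. scale (u x) x) = 0" and x: "x \<in> B"
    have split: "(\<Sum>x\<in>R. scale (u x) x) + (\<Sum>x\<in>K. scale (u x) x) = 0"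
      using u disj fin by (simp add: B_def sum.union_disjoint)
    have "p ((\<Sum>x\<in>R. scale (u x) x) + (\<Sum>x\<in>K. scale (u x) x)) = (\<Sum>x\<in>R. scale (u x) x)"
      by (simp only: p.add) (simp add: pR pK span_sum span_scale span_base)
    then have "(\<Sum>x\<in>R. scale (u x) x) = 0" using split by simp
    moreover then have "(\<Sum>x\<in>K. scale (u x) x) = 0" using split by simp
    ultimately show "u x = 0"
      using x independentD[OF R(2) fin(1)] independentD[OF K(2) fin(2)] by (auto simp: B_def)
  qed
  moreover have sB: "span B = UNIV"
  proof -
    have "x \<in> span B" for x
    proof -
      have "p x \<in> span B" using R span_mono[of R B] by (auto simp: B_def)
      moreover have "x - p x \<in> span B"
      proof -
        have "x - p x \<in> span K" using K idem by (auto simp: p.diff)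
        then show ?thesis using span_mono[of K B] by (auto simp: B_def)
      qed
      ultimately show ?thesis using span_add by force
    qed
    then show ?thesis by auto
  qed
  ultimately have B: "independent B" "span B = UNIV" by auto
  have "(\<Sum>e\<in>E. representation E (p e) e) =
      (\<Sum>e\<in>E. \<Sum>b\<in>B. representation B e b * representation E (p b) e)"
  proof (rule sum.cong[OF refl])
    fix e assume "e \<in> E"
    have "p e = p (\<Sum>b\<in>B. scale (representation B e b) b)"
      using sum_representation_eq[OF B(1), of e B] B fB by simp
    then have "p e = (\<Sum>b\<in>B. scale (representation B e b) (p b))" by (simp add: p.sum p.scale)
    then have "representation E (p e) = (\<lambda>c. \<Sum>b\<in>B. representation B e b * representation E (p b) c)"
      using E by (simp add: representation_sum representation_scale)
    then show "representation E (p e) e = (\<Sum>b\<in>B. representation B e b * representation E (p b) e)"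
      by simp
  qed
  also have "\<dots> = (\<Sum>b\<in>B. \<Sum>e\<in>E. representation B e b * representation E (p b) e)"
    by (rule sum.swap)
  also have "\<dots> = (\<Sum>b\<in>B. representation B (p b) b)"
  proof (rule sum.cong[OF refl])
    fix b assume "b \<in> B"
    have "p b = (\<Sum>e\<in>E. scale (representation E (p b) e) e)"
      using sum_representation_eq[OF E(1), of "p b" E] E fE by simp
    then have "representation B (p b) =
        representation B (\<Sum>e\<in>E. scale (representation E (p b) e) e)" by simp
    also have "\<dots> = (\<lambda>c. \<Sum>e\<in>E. representation E (p b) e * representation B e c)"
      using B by (simp add: representation_sum representation_scale)
    finally show "(\<Sum>e\<in>E. representation B e b * representation E (p b) e) = representation B (p b) b"
      by (simp add: mult.commute)
  qed
  also have "\<dots> = (\<Sum>b\<in>R. representation B (p b) b) + (\<Sum>b\<in>K. representation B (p b) b)"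
    using fin disj by (simp add: B_def sum.union_disjoint)
  also have "(\<Sum>b\<in>R. representation B (p b) b) = (\<Sum>b\<in>R. 1)"
    by (rule sum.cong) (use B in \<open>auto simp: pR span_base representation_basis B_def\<close>)
  also have "(\<Sum>b\<in>K. representation B (p b) b) = 0"
    by (rule sum.neutral) (auto simp: pK span_base representation_zero)
  finally show ?thesis using R by simp
qed

text \<open>The trace is the rank read in the field, and the last hypothesis is characteristic 0.
  This is the point at which the characteristic makes the trace form nondegenerate.\<close>

lemma (in finite_dimensional_vector_space) idempotent_trace_zero:
  assumes "independent E" "span E = UNIV"
    and "Vector_Spaces.linear scale scale p" and "\<And>x. p (p x) = p x"
    and "(\<Sum>e\<in>E. representation E (p e) e) = 0" "\<And>n. (of_nat n :: 'a) = 0 \<Longrightarrow> n = 0"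
  shows "p x = 0"
proof -
  have "dim (range p) = 0" using trace_idempotent[OF assms(1-4)] assms(5,6) by metis
  then have "range p \<subseteq> {0}" by (simp only: dim_eq_0)
  then show ?thesis by auto
qed

section \<open>Products and the radical of a finite-dimensional algebra\<close>

text \<open>The value 0 for the empty list is a convention in the absence of a unit: a list with
  nonzero product is then automatically nonempty.\<close>

fun lprod :: "'a::ring list \<Rightarrow> 'a" where
  "lprod [] = 0"
| "lprod [x] = x"
| "lprod (x # y # ys) = x * lprod (y # ys)"

lemma lprod_Cons: "xs \<noteq> [] \<Longrightarrow> lprod (x # xs) = x * lprod xs"
  by (cases xs) auto

lemma lprod_append: "xs \<noteq> [] \<Longrightarrow> ys \<noteq> [] \<Longrightarrow> lprod (xs @ ys) = lprod xs * lprod ys"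
proof (induction xs)
  case (Cons x xs)
  then show ?case by (cases "xs = []") (auto simp: lprod_Cons mult.assoc)
qed simp

text \<open>In the absence of a unit, \<open>npow x n\<close> is the power with exponent \<open>n + 1\<close>.\<close>

fun npow :: "'a::ring \<Rightarrow> nat \<Rightarrow> 'a" where
  "npow x 0 = x"
| "npow x (Suc n) = x * npow x n"

lemma npow_mult: "npow x m * npow x n = npow x (Suc (m + n))"
  by (induction m) (auto simp: mult.assoc)

lemma npow_Suc_right: "npow x (Suc n) = npow x n * x"
  using npow_mult[of x n 0] by simp

text \<open>Transfers nilpotency from \<open>y * x\<close> to \<open>x * y\<close>.\<close>

lemma npow_swap: "npow (x * y) (Suc n) = x * npow (y * x) n * y"
  by (induction n) (simp_all add: mult.assoc)

definition nilpotent_elem :: "'a::ring \<Rightarrow> bool" where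
  "nilpotent_elem x \<longleftrightarrow> (\<exists>n. npow x n = 0)"

locale fd_algebra = assoc_algebra scale + finite_dimensional_vector_space scale Basis
  for scale :: "'f::field \<Rightarrow> 'a::ring \<Rightarrow> 'a" and Basis :: "'a set"
begin

lemma linear_mult_left: "Vector_Spaces.linear scale scale ((*) a)"
  by unfold_locales (simp_all add: distrib_left scale_mult_right)

lemma linear_mult_right: "Vector_Spaces.linear scale scale (\<lambda>x. x * a)"
  by unfold_locales (simp_all add: distrib_right scale_mult_left)

lemma span_products:
  assumes "x \<in> span X" "y \<in> span Y" "\<And>u v. u \<in> X \<Longrightarrow> v \<in> Y \<Longrightarrow> u * v \<in> W" "subspace W"
  shows "x * y \<in> W"
proof -
  have 1: "u * y \<in> W" if "u \<in> X" for u
  proof -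
    have "subspace {y. u * y \<in> W}"
      using assms(4) by (auto simp: subspace_def distrib_left scale_mult_right)
    then show ?thesis using span_minimal[of Y "{y. u * y \<in> W}"] assms(2,3) that by auto
  qed
  have "subspace {x. x * y \<in> W}"
    using assms(4) by (auto simp: subspace_def distrib_right scale_mult_left)
  then show ?thesis using span_minimal[of X "{x. x * y \<in> W}"] assms(1) 1 by auto
qed

text \<open>In the commutative algebra \<open>C\<close> spanned by the powers of \<open>x\<close>,
  the descending chain of the ideals \<open>D k\<close> becomes stationary. Hence a power
  \<open>y\<close> of \<open>x\<close> satisfies \<open>y = y * y * c\<close>, and then
  \<open>y * c\<close> is idempotent. It is a multiple of \<open>x\<close> from either side, so it
  lies in every one-sided ideal containing \<open>x\<close>.\<close>

lemma idempotent_of_non_nilpotent: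
  fixes x :: 'a
  assumes "\<not> nilpotent_elem x"
  obtains e c where "e * e = e" "e \<noteq> 0" "e = x * c" "e = c * x"
proof -
  define C where "C = span (range (npow x))"
  have pC: "npow x n \<in> C" for n by (auto simp: C_def intro: span_base)
  have CC: "a * b \<in> C" if "a \<in> C" "b \<in> C" for a b
    using span_products[of a _ b] that pC unfolding C_def
    by (smt (verit, best) C_def imageE npow_mult subspace_span)
  have comm: "npow x n * c = c * npow x n" if "c \<in> C" for c n
  proof -
    have "subspace {c. npow x n * c = c * npow x n}"
      by (auto simp: subspace_def distrib_left distrib_right scale_mult_left scale_mult_right)
    then have "C \<subseteq> {c. npow x n * c = c * npow x n}"
      unfolding C_def by (intro span_minimal) (auto simp: npow_mult add.commute)
    then show ?thesis using that by auto
  qed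
  define D where "D k = (\<lambda>c. npow x k * c) ` C" for k
  have sD: "subspace (D k)" for k
  proof -
    interpret l: Vector_Spaces.linear scale scale "(*) (npow x k)" by (rule linear_mult_left)
    show ?thesis unfolding D_def C_def by (rule l.subspace_image) simp
  qed
  have D_mono: "D (Suc (k + j)) \<subseteq> D k" for k j
  proof
    fix y assume "y \<in> D (Suc (k + j))"
    then obtain c where "c \<in> C" "y = npow x k * (npow x j * c)"
      by (auto simp only: D_def npow_mult[symmetric] mult.assoc)
    then show "y \<in> D k" using CC pC by (auto simp: D_def)
  qed
  obtain k where k: "\<And>j. dim (D k) \<le> dim (D j)"
    using ex_has_least_nat[of "\<lambda>_. True" _ "\<lambda>k. dim (D k)"] by auto
  \<comment> \<open>The index is \<open>2 * k + 3\<close> because \<open>npow x (2 * k + 3)\<close>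
    equals \<open>y * y\<close> for \<open>y = npow x (Suc k)\<close>.\<close>
  have "D (Suc (k + (k + 2))) = D k"
    by (rule subspace_dim_equal[OF sD sD D_mono k])
  moreover have "npow x (Suc k) \<in> D k"
    using pC[of 0] by (auto simp: D_def npow_Suc_right simp del: npow.simps(2))
  ultimately obtain c where c: "c \<in> C" "npow x (Suc k) = npow x (Suc (Suc k + Suc k)) * c"
    by (auto simp: D_def)
  define y where "y = npow x (Suc k)"
  have yy: "y * y * c = y" unfolding y_def npow_mult by (rule c(2)[symmetric])
  have yc: "y * c = c * y" unfolding y_def by (rule comm[OF c(1)])
  have "y * c * (y * c) = y * y * c * c" using yc by (metis mult.assoc)
  then have "y * c * (y * c) = y * c" by (simp add: yy)
  moreover have "y * c \<noteq> 0"
  proof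
    assume "y * c = 0"
    then have "y = 0" using yy by (simp add: mult.assoc)
    then show False using assms unfolding nilpotent_elem_def y_def by blast
  qed
  moreover have "y * c = x * (npow x k * c)" by (simp add: y_def mult.assoc)
  moreover have "y * c = npow x k * c * x"
    using comm[OF c(1), of 0] by (simp only: y_def npow_Suc_right npow.simps(1) mult.assoc)
  ultimately show ?thesis using that by blast
qed

section \<open>The Jacobson radical, nil ideals and products with many radical factors\<close>

definition J where "J = jacobson_radical scale"

lemma left_idealD:
  assumes "left_ideal scale L"
  shows "subspace L" "x \<in> L \<Longrightarrow> a * x \<in> L"
  using assms by (auto simp: left_ideal_def)

lemma left_ideal_J: "left_ideal scale J"
proof -
  have "subspace J"
    unfolding J_def jacobson_radical_def
    by (rule subspace_Inter) (auto simp: modular_maximal_left_ideal_def left_ideal_def)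
  then show ?thesis
    by (auto simp: left_ideal_def J_def jacobson_radical_def modular_maximal_left_ideal_def)
qed

text \<open>If a modular maximal \<open>L\<close> does not contain \<open>K\<close>, then
  \<open>L\<close> and \<open>K\<close> together span the algebra, and the right unit modulo
  \<open>L\<close> can be replaced by an element \<open>k\<close> of \<open>K\<close>. All powers of
  \<open>k\<close> are then right units modulo \<open>L\<close>; one of them is 0, which makes
  \<open>L\<close> the whole algebra.\<close>

lemma nil_left_ideal_subset_J:
  assumes K: "left_ideal scale K" and nil: "\<And>x. x \<in> K \<Longrightarrow> nilpotent_elem x"
  shows "K \<subseteq> J"
proof -
  have "K \<subseteq> L" if L: "modular_maximal_left_ideal scale L" for L
  proof (rule ccontr)
    assume notin: "\<not> K \<subseteq> L"
    obtain e where e: "\<And>a. a - a * e \<in> L"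
      using L by (auto simp: modular_maximal_left_ideal_def)
    have lL: "left_ideal scale L" "L \<noteq> UNIV" using L by (auto simp: modular_maximal_left_ideal_def)
    note L' = left_idealD[OF lL(1)] and K' = left_idealD[OF K]
    define S where "S = {x + y | x y. x \<in> L \<and> y \<in> K}"
    have "left_ideal scale S"
      using subspace_sums[OF L'(1) K'(1)] L'(2) K'(2)
      unfolding left_ideal_def S_def by (auto simp: distrib_left) blast
    moreover have "L \<subseteq> S" using subspace_0[OF K'(1)] by (force simp: S_def)
    ultimately have "S = L \<or> S = UNIV"
      using L by (auto simp: modular_maximal_left_ideal_def)
    moreover have "K \<subseteq> S" using subspace_0[OF L'(1)] by (force simp: S_def)
    ultimately have "e \<in> S" using notin by auto
    then obtain l k where lk: "l \<in> L" "k \<in> K" "e = l + k" by (auto simp: S_def)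
    have step: "a - a * k \<in> L" for a
    proof -
      have "a - a * k = (a - a * e) + a * l" by (simp add: lk(3) distrib_left)
      then show ?thesis using e L' lk by (metis subspace_add)
    qed
    have pows: "a - a * npow k n \<in> L" for a n
    proof (induction n arbitrary: a)
      case 0
      then show ?case using step by simp
    next
      case (Suc n)
      have "a - a * npow k (Suc n) = (a - a * k) + (a * k - a * k * npow k n)"
        by (simp add: mult.assoc)
      then show ?case using step Suc L'(1) by (metis subspace_add)
    qed
    obtain n where "npow k n = 0" using nil[OF lk(2)] by (auto simp: nilpotent_elem_def)
    then have "a \<in> L" for a using pows[of a n] by simp
    then show False using lL by auto
  qed
  then show ?thesis by (auto simp: J_def jacobson_radical_def)
qed

text \<open>A non-nilpotent element would put a nonzero idempotent \<open>e\<close> into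
  \<open>J\<close>. The left ideal of all \<open>a - a * e\<close> is proper, and \<open>e\<close>
  is a right unit modulo it. A maximal left ideal above it is modular, so it contains
  \<open>J\<close> and with it \<open>e\<close>, and then every \<open>a\<close>.\<close>

lemma J_nil:
  assumes "x \<in> J"
  shows "nilpotent_elem x"
proof (rule ccontr)
  assume "\<not> nilpotent_elem x"
  then obtain e c where e: "e * e = e" "e \<noteq> 0" "e = c * x"
    using idempotent_of_non_nilpotent by metis
  have eJ: "e \<in> J" using left_idealD(2)[OF left_ideal_J assms] e(3) by simp
  define L0 where "L0 = range (\<lambda>a. a - a * e)"
  interpret l: Vector_Spaces.linear scale scale "\<lambda>a. a - a * e"
    by unfold_locales (simp_all add: distrib_right scale_mult_left scale_right_diff_distrib)
  have "subspace L0"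
    unfolding L0_def by (rule l.subspace_image) simp
  then have L0: "left_ideal scale L0"
    by (auto simp: left_ideal_def L0_def right_diff_distrib mult.assoc[symmetric])
  have "e \<notin> L0"
  proof
    assume "e \<in> L0"
    then obtain a where "e = a - a * e" by (auto simp: L0_def)
    then have "e * e = (a - a * e) * e" by simp
    then show False using e by (simp add: left_diff_distrib mult.assoc)
  qed
  then have "L0 \<noteq> UNIV" by auto
  \<comment> \<open>Largest dimension takes the place of Zorn's lemma; modularity is inherited from
    \<open>L0\<close> with the same \<open>e\<close>.\<close>
  let ?P = "\<lambda>L. left_ideal scale L \<and> L0 \<subseteq> L \<and> L \<noteq> UNIV"
  obtain L where L: "?P L" and max: "\<And>L'. ?P L' \<Longrightarrow> dim L' \<le> dim L"
    using ex_has_greatest_nat[of ?P L0 dim "Suc dimension"] L0 \<open>L0 \<noteq> UNIV\<close>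
      le_imp_less_Suc[OF dim_subset_UNIV] by auto
  have "L' = L \<or> L' = UNIV" if "left_ideal scale L'" "L \<subseteq> L'" for L'
  proof (cases "L' = UNIV")
    case False
    then have "dim L' \<le> dim L" using that L max by auto
    then have "L = L'" using that L left_idealD by (intro subspace_dim_equal) auto
    then show ?thesis by simp
  qed simp
  moreover have "\<exists>e. \<forall>a. a - a * e \<in> L" using L by (intro exI[of _ e]) (auto simp: L0_def)
  ultimately have "modular_maximal_left_ideal scale L"
    using L by (auto simp: modular_maximal_left_ideal_def)
  then have "e \<in> L" using eJ by (auto simp: J_def jacobson_radical_def)
  have "a \<in> L" for a
  proof -
    have "a - a * e \<in> L" using L by (auto simp: L0_def)
    moreover have "a * e \<in> L" using L \<open>e \<in> L\<close> left_idealD(2) by auto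
    ultimately show ?thesis using L left_idealD(1) subspace_add by fastforce
  qed
  then show False using L by auto
qed

text \<open>\<open>jacobson_radical\<close> is built from left ideals only. The right translate of
  \<open>J\<close> by \<open>a\<close> is a left ideal, and it is nil because each
  \<open>a * y\<close> with \<open>y\<close> in \<open>J\<close> is nilpotent, hence
  \<open>y * a\<close> as well.\<close>

lemma J_right:
  assumes "x \<in> J"
  shows "x * a \<in> J"
proof -
  have "left_ideal scale ((\<lambda>y. y * a) ` J)"
  proof -
    interpret l: Vector_Spaces.linear scale scale "\<lambda>y. y * a" by (rule linear_mult_right)
    show ?thesis
      using l.subspace_image left_idealD[OF left_ideal_J]
      by (auto simp: left_ideal_def mult.assoc[symmetric])
  qed
  moreover have "nilpotent_elem z" if "z \<in> (\<lambda>y. y * a) ` J" for z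
  proof -
    obtain y where y: "y \<in> J" "z = y * a" using \<open>z \<in> _\<close> by auto
    then obtain n where "npow (a * y) n = 0"
      using J_nil[of "a * y"] left_idealD(2)[OF left_ideal_J] by (auto simp: nilpotent_elem_def)
    then show ?thesis using y npow_swap[of y a n] by (auto simp: nilpotent_elem_def intro: exI[of _ "Suc n"])
  qed
  ultimately show ?thesis using nil_left_ideal_subset_J assms by blast
qed

lemma J_left: "x \<in> J \<Longrightarrow> a * x \<in> J"
  using left_idealD(2)[OF left_ideal_J] .

lemma subspace_J: "subspace J"
  using left_idealD(1)[OF left_ideal_J] .

text \<open>A minimal left ideal \<open>M \<subseteq> K\<close> with \<open>K M \<noteq> 0\<close> would be \<open>K m\<close> for some \<open>m\<close>, whence \<open>m = x m\<close>
  with \<open>x\<close> nilpotent.\<close>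

lemma nil_idempotent_ideal_zero:
  assumes K: "left_ideal scale K" and nil: "\<And>x. x \<in> K \<Longrightarrow> nilpotent_elem x"
    and KK: "K \<subseteq> span {x * y | x y. x \<in> K \<and> y \<in> K}"
  shows "K \<subseteq> {0}"
proof (rule ccontr)
  assume K0: "\<not> K \<subseteq> {0}"
  let ?P = "\<lambda>M. left_ideal scale M \<and> M \<subseteq> K \<and> (\<exists>x\<in>K. \<exists>m\<in>M. x * m \<noteq> 0)"
  have "?P K"
  proof -
    have "\<exists>x\<in>K. \<exists>m\<in>K. x * m \<noteq> 0"
    proof (rule ccontr)
      assume "\<not> ?thesis"
      then have "span {x * y | x y. x \<in> K \<and> y \<in> K} \<subseteq> {0}" by (intro span_minimal) auto
      then show False using KK K0 by auto
    qed
    then show ?thesis using K by auto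
  qed
  then obtain M where M: "?P M" and min: "\<And>M'. ?P M' \<Longrightarrow> dim M \<le> dim M'"
    using ex_has_least_nat[of ?P K dim] by blast
  then obtain x m where xm: "x \<in> K" "m \<in> M" "x * m \<noteq> 0" by blast
  define M' where "M' = (\<lambda>k. k * m) ` K"
  have M': "left_ideal scale M'"
  proof -
    interpret l: Vector_Spaces.linear scale scale "\<lambda>y. y * m" by (rule linear_mult_right)
    show ?thesis
      using l.subspace_image left_idealD[OF K]
      by (auto simp: left_ideal_def M'_def mult.assoc[symmetric])
  qed
  have sub: "M' \<subseteq> M" using M xm by (auto simp: M'_def left_ideal_def)
  have "\<exists>x\<in>K. \<exists>m\<in>M'. x * m \<noteq> 0"
  proof (rule ccontr)
    assume "\<not> ?thesis"
    then have "{x * y | x y. x \<in> K \<and> y \<in> K} \<subseteq> {z. z * m = 0}"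
      by (auto simp: M'_def mult.assoc)
    moreover have "subspace {z. z * m = 0}"
      by (auto simp: subspace_def distrib_right scale_mult_left)
    ultimately have "span {x * y | x y. x \<in> K \<and> y \<in> K} \<subseteq> {z. z * m = 0}" by (rule span_minimal)
    then show False using KK xm by auto
  qed
  then have "?P M'" using M' sub M by auto
  then have "dim M \<le> dim M'" by (rule min)
  then have "M' = M" using M M' sub left_idealD(1) by (intro subspace_dim_equal) auto
  then obtain y where y: "y \<in> K" "m = y * m" using xm by (auto simp: M'_def)
  have "m = npow y n * m" for n
    by (induction n) (use y in \<open>auto simp: mult.assoc\<close>)
  then have "m = 0" using nil[OF y(1)] by (metis mult_zero_left nilpotent_elem_def)
  then show False using xm by simp
qed

lemma lprod_in_J:
  assumes "z \<in> set zs" "z \<in> J"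
  shows "lprod zs \<in> J"
  using assms
proof (induction zs)
  case (Cons x zs)
  then show ?case by (cases "zs = []") (auto simp: lprod_Cons J_left J_right)
qed simp

text \<open>A discrete intermediate value argument: along the list the count grows by at most one
  per entry.\<close>

lemma split_at_count:
  assumes "k \<le> length (filter P zs)"
  shows "\<exists>us vs. zs = us @ vs \<and> length (filter P us) = k"
  using assms
proof (induction zs arbitrary: k)
  case (Cons z zs)
  show ?case
  proof (cases k)
    case 0
    then show ?thesis by (intro exI[of _ "[]"] exI[of _ "z # zs"]) auto
  next
    case (Suc k')
    then have "(if P z then k' else k) \<le> length (filter P zs)" using Cons.prems by auto
    then obtain us vs where "zs = us @ vs" "length (filter P us) = (if P z then k' else k)"
      using Cons.IH by blast
    then show ?thesis using Suc by (intro exI[of _ "z # us"] exI[of _ vs]) auto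
  qed
qed simp

text \<open>The spans \<open>N k\<close> of the products with at least \<open>k\<close> radical
  factors decrease, so \<open>N k = N (k + k)\<close> for some \<open>k\<close>. Cutting such
  products in two shows that \<open>N k\<close> is idempotent, and as a part of \<open>J\<close> it
  is nil; so it is 0. The remaining factors are arbitrary, as required for bounding the number of
  radical letters in a tuple.\<close>

lemma products_vanish:
  obtains p where "\<And>zs. p \<le> length (filter (\<lambda>z. z \<in> J) zs) \<Longrightarrow> lprod zs = 0"
proof -
  define c where "c zs = length (filter (\<lambda>z. z \<in> J) zs)" for zs
  define N where "N k = span {lprod zs | zs. k \<le> c zs}" for k
  have N_mono: "N (k + j) \<subseteq> N k" for k j unfolding N_def by (rule span_mono) auto
  obtain k0 where k0: "\<And>j. dim (N (Suc k0)) \<le> dim (N (Suc j))"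
    using ex_has_least_nat[of "\<lambda>_. True" _ "\<lambda>k. dim (N (Suc k))"] by auto
  \<comment> \<open>Positivity of \<open>k\<close> makes the lists nonempty and puts the products
    into \<open>J\<close>.\<close>
  define k where "k = Suc k0"
  define K where "K = N k"
  have "N (k + k) = N k"
  proof (rule subspace_dim_equal)
    show "dim (N k) \<le> dim (N (k + k))" using k0[of "k0 + k"] by (simp add: k_def)
  qed (use N_mono in \<open>simp_all add: N_def\<close>)
  have ne: "zs \<noteq> []" if "k \<le> c zs" for zs using that by (auto simp: c_def k_def)
  have KK: "K \<subseteq> span {x * y | x y. x \<in> K \<and> y \<in> K}"
  proof -
    have "lprod zs \<in> {x * y | x y. x \<in> K \<and> y \<in> K}" if zs: "k + k \<le> c zs" for zs
    proof -
      obtain us vs where uv: "zs = us @ vs" "c us = k"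
        using split_at_count[of k "\<lambda>z. z \<in> J" zs] zs by (auto simp: c_def)
      moreover have "k \<le> c vs" using zs uv by (simp add: c_def)
      moreover have "lprod us \<in> K" "lprod vs \<in> K"
        unfolding K_def N_def using \<open>k \<le> c vs\<close> uv by (auto intro!: span_base)
      ultimately show ?thesis using ne[of us] ne[of vs] by (auto simp: lprod_append)
    qed
    then have "N (k + k) \<subseteq> span {x * y | x y. x \<in> K \<and> y \<in> K}"
      unfolding N_def by (intro span_mono) auto
    then show ?thesis using \<open>N (k + k) = N k\<close> by (simp add: K_def)
  qed
  have "left_ideal scale K"
  proof -
    have "a * x \<in> K" if "x \<in> K" for a x
    proof -
      have "subspace {x. a * x \<in> K}"
        unfolding K_def N_def by (auto simp: subspace_def distrib_left scale_mult_right
          span_add span_scale span_zero)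
      moreover have "a * lprod zs \<in> K" if "k \<le> c zs" for zs
      proof -
        have "a * lprod zs = lprod (a # zs)" using ne[OF that] by (simp add: lprod_Cons)
        moreover have "k \<le> c (a # zs)" using that by (auto simp: c_def)
        ultimately show ?thesis unfolding K_def N_def by (auto intro!: span_base)
      qed
      ultimately show ?thesis
        using span_minimal[of "{lprod zs | zs. k \<le> c zs}" "{x. a * x \<in> K}"] that
        by (auto simp: K_def N_def)
    qed
    then show ?thesis by (auto simp: left_ideal_def K_def N_def)
  qed
  moreover have "K \<subseteq> J"
  proof -
    have "lprod zs \<in> J" if "k \<le> c zs" for zs
    proof -
      have "filter (\<lambda>z. z \<in> J) zs \<noteq> []" using that by (auto simp: c_def k_def)
      then show ?thesis using lprod_in_J by (auto simp: filter_empty_conv)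
    qed
    then show ?thesis unfolding K_def N_def using subspace_J by (intro span_minimal) auto
  qed
  ultimately have "K \<subseteq> {0}" using J_nil KK by (intro nil_idempotent_ideal_zero) auto
  then have "lprod zs = 0" if "k \<le> c zs" for zs
    using that unfolding K_def N_def by (auto dest!: subsetD intro: span_base)
  then show ?thesis using that unfolding c_def by blast
qed

lemma no_idempotent_in_J: "e \<in> J \<Longrightarrow> e * e = e \<Longrightarrow> e = 0"
proof -
  assume e: "e \<in> J" "e * e = e"
  obtain n where "npow e n = 0" using J_nil[OF e(1)] by (auto simp: nilpotent_elem_def)
  moreover have "npow e n = e" by (induction n) (use e in auto)
  ultimately show "e = 0" by simp
qed

end

section \<open>Multilinear H-polynomial functions and codimensions\<close>

lemma sum_fun_apply: "(\<Sum>i\<in>I. f i) x = (\<Sum>i\<in>I. f i x)" for f :: "'i \<Rightarrow> 'j \<Rightarrow> 'k::comm_monoid_add"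
  by (induction I rule: infinite_finite_induct) auto

section \<open>Quotients by the common kernel of finitely many functionals\<close>

context vector_space
begin

text \<open>The functionals embed \<open>V / W\<close> into the functions on \<open>D\<close>. A
  family longer than \<open>card D\<close> has linearly dependent value vectors there, and the same
  combination of the family falls into \<open>W\<close>.\<close>

lemma independent_modulo_card_le:
  fixes L :: "'i \<Rightarrow> 'b \<Rightarrow> 'a"
  assumes D: "finite D" and L: "\<And>i. i \<in> D \<Longrightarrow> Vector_Spaces.linear scale (*) (L i)"
    and V: "subspace V" and W: "W = {v \<in> V. \<forall>i\<in>D. L i v = 0}"
    and K: "finite K" "\<And>k. k \<in> K \<Longrightarrow> f k \<in> V"
    and ind: "\<And>u. (\<Sum>k\<in>K. scale (u k) (f k)) \<in> W \<Longrightarrow> \<forall>k\<in>K. u k = 0"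
  shows "card K \<le> card D"
proof (rule ccontr)
  assume neg: "\<not> card K \<le> card D"
  interpret F: vector_space "\<lambda>(c::'a) (g::'i \<Rightarrow> 'a) i. c * g i"
    by unfold_locales (auto simp: algebra_simps)
  define T where "T = (\<lambda>i j. if j = i then 1 else 0 :: 'a) ` D"
  define w where "w k = (\<lambda>i. if i \<in> D then L i (f k) else 0)" for k
  have "w k \<in> F.span T" for k
  proof -
    have "w k j = (\<Sum>i\<in>D. L i (f k) * (if j = i then 1 else 0))" for j
    proof -
      have "(\<Sum>i\<in>D. L i (f k) * (if j = i then 1 else 0)) = (\<Sum>i\<in>D. if j = i then L i (f k) else 0)"
        by (rule sum.cong) auto
      then show ?thesis using D by (simp add: w_def)
    qed
    then have "w k = (\<Sum>i\<in>D. (\<lambda>j. L i (f k) * (if j = i then 1 else 0)))"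
      by (simp add: fun_eq_iff sum_fun_apply)
    also have "\<dots> \<in> F.span T"
      by (intro F.span_sum F.span_scale F.span_base) (simp add: T_def)
    finally show ?thesis .
  qed
  moreover have "card T < card K"
    using neg card_image_le[OF D, of "\<lambda>i j. if j = i then 1 else 0 :: 'a"] by (simp add: T_def)
  moreover have "finite T" using D by (simp add: T_def)
  ultimately obtain u where u: "\<exists>k\<in>K. u k \<noteq> 0" "(\<Sum>k\<in>K. (\<lambda>i. u k * w k i)) = 0"
    using F.family_dependent[of K T w] K(1) by auto
  have "L i (\<Sum>k\<in>K. scale (u k) (f k)) = 0" if i: "i \<in> D" for i
  proof -
    interpret l: Vector_Spaces.linear scale "(*)" "L i" using L i by auto
    have "L i (\<Sum>k\<in>K. scale (u k) (f k)) = (\<Sum>k\<in>K. u k * w k i)"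
      using i by (simp add: l.sum l.scale w_def)
    also have "\<dots> = 0" using fun_cong[OF u(2), of i] by (simp add: sum_fun_apply)
    finally show ?thesis .
  qed
  moreover have "(\<Sum>k\<in>K. scale (u k) (f k)) \<in> V"
    using V K by (intro subspace_sum subspace_scale) auto
  ultimately have "(\<Sum>k\<in>K. scale (u k) (f k)) \<in> W" by (simp add: W)
  then show False using ind u(1) by auto
qed

text \<open>\<open>quotient_dim\<close> chooses some \<open>basis_modulo\<close>, so a basis must be
  shown to exist before anything can be said about the choice. A largest finite family independent
  modulo \<open>W\<close> is one, its size being bounded by the previous lemma. The bounds are then
  proved for the chosen basis, the second by the usual exchange argument.\<close>

lemma quotient_dim_bounds:
  fixes L :: "'i \<Rightarrow> 'b \<Rightarrow> 'a"
  assumes D: "finite D" and L: "\<And>i. i \<in> D \<Longrightarrow> Vector_Spaces.linear scale (*) (L i)"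
    and V: "subspace V" and W: "W = {v \<in> V. \<forall>i\<in>D. L i v = 0}"
  shows "quotient_dim scale V W \<le> card D"
    and "\<And>K f. \<lbrakk>finite K; \<And>k. k \<in> K \<Longrightarrow> f k \<in> V;
        \<And>u. (\<Sum>k\<in>K. scale (u k) (f k)) \<in> W \<Longrightarrow> \<forall>k\<in>K. u k = 0\<rbrakk> \<Longrightarrow> card K \<le> quotient_dim scale V W"
proof -
  note card_le = independent_modulo_card_le[OF D L V W]
  have sW: "subspace W"
  proof -
    have 1: "subspace {v. L i v = 0}" if "i \<in> D" for i
    proof -
      interpret l: Vector_Spaces.linear scale "(*)" "L i" using L that by auto
      show ?thesis by (rule l.subspace_kernel)
    qed
    have "W = V \<inter> (\<Inter>i\<in>D. {v. L i v = 0})" by (auto simp: W)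
    then show ?thesis using subspace_inter[OF V subspace_Int[of D, OF 1]] by simp
  qed
  define ind where "ind T \<longleftrightarrow> finite T \<and> T \<subseteq> V \<and> (\<forall>u. (\<Sum>k\<in>T. scale (u k) k) \<in> W \<longrightarrow> (\<forall>k\<in>T. u k = 0))" for T
  have ind_card: "card T \<le> card D" if "ind T" for T
    using that by (intro card_le[of T "\<lambda>x. x"]) (auto simp: ind_def)
  have "ind {}" by (simp add: ind_def)
  then obtain T where T: "ind T" and max: "\<And>T'. ind T' \<Longrightarrow> card T' \<le> card T"
    using ex_has_greatest_nat[of ind "{}" card "Suc (card D)"] ind_card by (auto simp: less_Suc_eq_le)
  have fT: "finite T" using T by (simp add: ind_def)
  have "basis_modulo scale V W T"
    unfolding basis_modulo_def
  proof (intro conjI allI impI ballI)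
    show "T \<subseteq> V" using T by (simp add: ind_def)
  next
    fix T' u b
    assume *: "finite T' \<and> T' \<subseteq> T \<and> (\<Sum>b\<in>T'. scale (u b) b) \<in> W" and b: "b \<in> T'"
    have "(\<Sum>b\<in>T. scale (if b \<in> T' then u b else 0) b) = (\<Sum>b\<in>T'. scale (u b) b)"
      using * fT by (intro sum.mono_neutral_cong_right) auto
    then have "(\<Sum>b\<in>T. scale (if b \<in> T' then u b else 0) b) \<in> W" using * by simp
    then have "\<forall>b\<in>T. (if b \<in> T' then u b else 0) = 0"
      by (rule mp[OF spec[where x = "\<lambda>b. if b \<in> T' then u b else 0",
            OF conjunct2[OF conjunct2[OF T[unfolded ind_def]]]]])
    moreover have "b \<in> T" using * b by auto
    ultimately show "u b = 0" using b by auto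
  next
    fix v assume v: "v \<in> V"
    show "\<exists>s\<in>span T. v - s \<in> W"
    proof (cases "v \<in> T")
      case True
      then show ?thesis using subspace_0[OF sW] by (intro bexI[of _ v]) (auto intro: span_base)
    next
      case False
      then have "\<not> ind (insert v T)" using max[of "insert v T"] fT by auto
      then obtain u k where u: "(\<Sum>k\<in>insert v T. scale (u k) k) \<in> W" "k \<in> insert v T" "u k \<noteq> 0"
        using v T unfolding ind_def by auto
      define s where "s = (\<Sum>k\<in>T. scale (u k) k)"
      have us: "scale (u v) v + s \<in> W" using u(1) False fT by (simp add: s_def)
      have "u v \<noteq> 0"
      proof
        assume "u v = 0"
        then have "s \<in> W" using us by simp
        then have "\<forall>k\<in>T. u k = 0" using T unfolding ind_def s_def by blast
        then show False using u \<open>u v = 0\<close> by auto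
      qed
      have "scale (1 / u v) (scale (u v) v + s) \<in> W" using sW us by (rule subspace_scale)
      then have "v - scale (- (1 / u v)) s \<in> W"
        using \<open>u v \<noteq> 0\<close> by (simp add: scale_right_distrib)
      moreover have "scale (- (1 / u v)) s \<in> span T"
        unfolding s_def by (intro span_scale span_sum span_base)
      ultimately show ?thesis by (rule bexI)
    qed
  qed
  then have B: "basis_modulo scale V W (SOME B. basis_modulo scale V W B)" (is "basis_modulo _ _ _ ?B")
    by (rule someI[of "basis_modulo scale V W"])
  have sub: "card T \<le> card D" if "T \<subseteq> ?B" "finite T" for T
    using that B by (intro ind_card) (auto simp: ind_def basis_modulo_def)
  then have fB: "finite ?B" using finite_if_finite_subsets_card_bdd by blast
  then show "quotient_dim scale V W \<le> card D" using sub by (simp add: quotient_dim_def)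
  fix K and f :: "'c \<Rightarrow> 'b"
  assume K: "finite K" "\<And>k. k \<in> K \<Longrightarrow> f k \<in> V"
    "\<And>u. (\<Sum>k\<in>K. scale (u k) (f k)) \<in> W \<Longrightarrow> \<forall>k\<in>K. u k = 0"
  show "card K \<le> quotient_dim scale V W"
  proof (rule ccontr)
    assume "\<not> ?thesis"
    then have lt: "card ?B < card K" by (simp add: quotient_dim_def)
    have "\<forall>k\<in>K. \<exists>s. s \<in> span ?B \<and> f k - s \<in> W"
      using B K(2) unfolding basis_modulo_def Bex_def by simp
    from bchoice[OF this] obtain s where s: "\<forall>k\<in>K. s k \<in> span ?B \<and> f k - s k \<in> W" ..
    obtain u where u: "\<exists>k\<in>K. u k \<noteq> 0" "(\<Sum>k\<in>K. scale (u k) (s k)) = 0"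
      using family_dependent[OF K(1) fB _ lt, of s] s by auto
    have "(\<Sum>k\<in>K. scale (u k) (f k)) = (\<Sum>k\<in>K. scale (u k) (f k - s k))"
      using u(2) by (simp add: scale_right_diff_distrib sum_subtractf)
    also have "\<dots> \<in> W" using s by (intro subspace_sum[OF sW] subspace_scale[OF sW]) auto
    finally show False using K(3) u(1) by auto
  qed
qed

end

locale fd_H_algebra = generalized_action scaleH scaleA act + A: fd_algebra scaleA Basis
  for scaleH :: "'f::field \<Rightarrow> 'h::{ring, monoid_mult} \<Rightarrow> 'h"
    and scaleA :: "'f \<Rightarrow> 'a::ring \<Rightarrow> 'a"
    and act :: "'h \<Rightarrow> 'a \<Rightarrow> 'a" and Basis :: "'a set"

section \<open>Functions given by multilinear H-polynomials\<close>

context generalized_action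
begin

text \<open>These are the functions induced by multilinear H-polynomials all of whose monomials
  contain each variable of \<open>X\<close> exactly once. The type of the variables is arbitrary, so
  that later constructions can name them by sums and tuples; \<open>Pfun_realized\<close> leads back
  to the free algebra.\<close>

inductive Pfun :: "'v set \<Rightarrow> (('v \<Rightarrow> 'a) \<Rightarrow> 'a) \<Rightarrow> bool" where
  zero: "Pfun X (\<lambda>\<psi>. 0)"
| var: "Pfun {x} (\<lambda>\<psi>. act h (\<psi> x))"
| mult: "Pfun X f \<Longrightarrow> Pfun Y g \<Longrightarrow> X \<inter> Y = {} \<Longrightarrow> Pfun (X \<union> Y) (\<lambda>\<psi>. f \<psi> * g \<psi>)"
| add: "Pfun X f \<Longrightarrow> Pfun X g \<Longrightarrow> Pfun X (\<lambda>\<psi>. f \<psi> + g \<psi>)"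
| scale: "Pfun X f \<Longrightarrow> Pfun X (\<lambda>\<psi>. scaleA c (f \<psi>))"

lemma act_sum: "act h (\<Sum>i\<in>I. g i) = (\<Sum>i\<in>I. act h (g i))"
proof -
  interpret l: Vector_Spaces.linear scaleA scaleA "act h" by (rule act_linear)
  show ?thesis by (rule l.sum)
qed

lemma act_zero [simp]: "act h 0 = 0"
  using act_sum[of h _ "{}"] by simp

lemma linearA_iff: "Vector_Spaces.linear scaleA scaleA f \<longleftrightarrow>
    (\<forall>x y. f (x + y) = f x + f y) \<and> (\<forall>c x. f (scaleA c x) = scaleA c (f x))"
  by (simp add: Vector_Spaces.linear_iff A.vector_space_axioms)

lemma act_plus: "act h (a + b) = act h a + act h b"
  and act_scaleA: "act h (scaleA c a) = scaleA c (act h a)"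
  using act_linear[of h] by (auto simp: linearA_iff)

lemma Pfun_sum:
  assumes "\<And>i. i \<in> I \<Longrightarrow> Pfun X (f i)"
  shows "Pfun X (\<lambda>\<psi>. \<Sum>i\<in>I. f i \<psi>)"
  using assms
proof (induction I rule: infinite_finite_induct)
  case (insert i I)
  then show ?case by (simp add: Pfun.add)
qed (simp_all add: Pfun.zero)

lemma Pfun_var: "Pfun {x} (\<lambda>\<psi>. \<psi> x)"
  using Pfun.var[of x 1] by (simp add: act_one)

text \<open>\<open>act_product\<close> moves \<open>h\<close> from a product to its factors. Its
  second kind of summand exchanges the factors, which is harmless because \<open>X\<close> records
  the variables and not their order.\<close>

lemma Pfun_act: "Pfun X f \<Longrightarrow> Pfun X (\<lambda>\<psi>. act h (f \<psi>))"
proof (induction arbitrary: h rule: Pfun.induct)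
  case (zero X)
  then show ?case by (simp add: Pfun.zero)
next
  case (var x g)
  then show ?case using Pfun.var[of x "h * g"] by (simp add: act_mult)
next
  case (mult X f Y g)
  obtain k :: nat and h1 h2 h3 h4 where p: "\<forall>a b. act h (a * b) =
      (\<Sum>i = 1..k. act (h1 i) a * act (h2 i) b + act (h3 i) b * act (h4 i) a)"
    using act_product[of h] by blast
  have 1: "Pfun (X \<union> Y) (\<lambda>\<psi>. act a (f \<psi>) * act b (g \<psi>))" for a b
    using mult by (intro Pfun.mult) auto
  have "Pfun (Y \<union> X) (\<lambda>\<psi>. act a (g \<psi>) * act b (f \<psi>))" for a b
    using mult by (intro Pfun.mult) auto
  then have 2: "Pfun (X \<union> Y) (\<lambda>\<psi>. act a (g \<psi>) * act b (f \<psi>))" for a b by (simp add: Un_commute)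
  show ?case
    unfolding p[rule_format] by (intro Pfun_sum Pfun.add 1 2)
next
  case (add X f g)
  then show ?case by (simp add: act_plus Pfun.add)
next
  case (scale X f c)
  then show ?case by (simp add: act_scaleA Pfun.scale)
qed

lemma Pfun_cong: "Pfun X f \<Longrightarrow> (\<And>x. x \<in> X \<Longrightarrow> \<psi> x = \<psi>' x) \<Longrightarrow> f \<psi> = f \<psi>'"
proof (induction rule: Pfun.induct)
  case (mult X f Y g)
  then have "f \<psi> = f \<psi>'" "g \<psi> = g \<psi>'" by auto
  then show ?case by simp
qed auto

lemma Pfun_update_other: "Pfun X f \<Longrightarrow> x \<notin> X \<Longrightarrow> f (\<psi>(x := u)) = f \<psi>"
  by (erule Pfun_cong) auto

lemma Pfun_update_linear:
  "Pfun X f \<Longrightarrow> x \<in> X \<Longrightarrow> Vector_Spaces.linear scaleA scaleA (\<lambda>u. f (\<psi>(x := u)))"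
proof (induction rule: Pfun.induct)
  case (mult X f Y g)
  show ?case
  proof (cases "x \<in> X")
    case True
    then have "g (\<psi>(x := u)) = g \<psi>" for u using mult by (intro Pfun_update_other[of Y]) auto
    then show ?thesis
      using mult.IH(1)[OF True] unfolding linearA_iff by (simp only: distrib_right A.scale_mult_left) simp
  next
    case False
    then have "f (\<psi>(x := u)) = f \<psi>" for u using mult by (intro Pfun_update_other[of X]) auto
    moreover have "x \<in> Y" using False mult.prems by auto
    ultimately show ?thesis
      using mult.IH(2) unfolding linearA_iff by (simp only: distrib_left A.scale_mult_right) simp
  qed
qed (auto simp: linearA_iff act_plus act_scaleA A.scale_right_distrib mult.commute)

lemma Pfun_rename:
  "Pfun X f \<Longrightarrow> inj_on \<pi> X \<Longrightarrow> Pfun (\<pi> ` X) (\<lambda>\<psi>. f (\<lambda>v. \<psi> (\<pi> v)))"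
proof (induction rule: Pfun.induct)
  case (mult X f Y g)
  have "inj_on \<pi> X" "inj_on \<pi> Y" "\<pi> ` X \<inter> \<pi> ` Y = {}"
    using inj_on_image_Int[OF mult.prems, of X Y] mult.prems mult.hyps(3) by (simp_all add: inj_on_Un)
  then show ?case using mult by (simp add: image_Un Pfun.mult)
qed (simp_all add: Pfun.intros)

text \<open>The function \<open>k\<close> may contain the variable \<open>x\<close> that it
  replaces; this is the case in the later substitution of \<open>g * x\<close> for
  \<open>x\<close>.\<close>

lemma Pfun_subst:
  "Pfun X f \<Longrightarrow> Pfun Y k \<Longrightarrow> x \<in> X \<Longrightarrow> Y \<inter> (X - {x}) = {} \<Longrightarrow>
    Pfun (X - {x} \<union> Y) (\<lambda>\<psi>. f (\<psi>(x := k \<psi>)))"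
proof (induction rule: Pfun.induct)
  case (var y h)
  then show ?case by (simp add: Pfun_act)
next
  case (mult X f Z g)
  show ?case
  proof (cases "x \<in> X")
    case True
    have "x \<notin> Z" using True mult by auto
    have g: "g (\<psi>(x := k \<psi>)) = g \<psi>" for \<psi>
      by (rule Pfun_update_other[OF mult.hyps(2) \<open>x \<notin> Z\<close>])
    have "Pfun ((X - {x} \<union> Y) \<union> Z) (\<lambda>\<psi>. f (\<psi>(x := k \<psi>)) * g \<psi>)"
    proof (rule Pfun.mult[OF mult.IH(1)[OF mult.prems(1) True] mult.hyps(2)])
    qed (use mult.prems mult.hyps(3) \<open>x \<notin> Z\<close> in blast)+
    moreover have "(X - {x} \<union> Y) \<union> Z = X \<union> Z - {x} \<union> Y" using \<open>x \<notin> Z\<close> by blast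
    ultimately show ?thesis by (simp only: g)
  next
    case False
    have f: "f (\<psi>(x := k \<psi>)) = f \<psi>" for \<psi>
      by (rule Pfun_update_other[OF mult.hyps(1) False])
    have "x \<in> Z" using False mult.prems by auto
    have "Pfun (X \<union> (Z - {x} \<union> Y)) (\<lambda>\<psi>. f \<psi> * g (\<psi>(x := k \<psi>)))"
    proof (rule Pfun.mult[OF mult.hyps(1) mult.IH(2)[OF mult.prems(1) \<open>x \<in> Z\<close>]])
    qed (use mult.prems mult.hyps(3) False in blast)+
    moreover have "X \<union> (Z - {x} \<union> Y) = X \<union> Z - {x} \<union> Y" using False by blast
    ultimately show ?thesis by (simp only: f)
  qed
qed (auto intro: Pfun.intros)

text \<open>Linearity in each variable allows the variables to be released from the spanning set one
  after another.\<close>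

lemma Pfun_zero_on_basis:
  assumes E: "A.span E = UNIV" and f: "Pfun X f" and "finite X"
    and zero: "\<And>t. t \<in> X \<rightarrow>\<^sub>E E \<Longrightarrow> f t = 0"
  shows "f \<psi> = 0"
proof -
  \<comment> \<open>\<open>Y\<close> holds the variables already released; the others still take
    values in \<open>E\<close>.\<close>
  have "f \<psi> = 0" if "Y \<subseteq> X" "\<And>x. x \<in> X - Y \<Longrightarrow> \<psi> x \<in> E" for Y \<psi>
    using finite_subset[OF that(1) \<open>finite X\<close>] that
  proof (induction Y arbitrary: \<psi>)
    case empty
    have "f \<psi> = f (restrict \<psi> X)" by (rule Pfun_cong[OF f]) auto
    also have "\<dots> = 0" using empty by (intro zero) auto
    finally show ?case .
  next
    case (insert y Y)
    interpret l: Vector_Spaces.linear scaleA scaleA "\<lambda>u. f (\<psi>(y := u))"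
      using insert.prems by (intro Pfun_update_linear[OF f]) auto
    have "f (\<psi>(y := u)) = 0" if "u \<in> E" for u
      using that insert.prems by (intro insert.IH) auto
    then have "f (\<psi>(y := \<psi> y)) = 0" using l.eq_0_on_span[of E "\<psi> y"] E by blast
    then show ?case by (simp only: fun_upd_triv)
  qed
  from this[of X \<psi>] show ?thesis by simp
qed

end

subsection \<open>Realization by H-polynomials\<close>

text \<open>Scaling is multiplication by a constant at the empty word, from either side;
  compatibility with products thereby becomes associativity.\<close>

lemma H_poly_scale_eq_left: "H_poly_scale c f = Poly_Mapping.single 0 c * f"
  and H_poly_scale_eq_right: "H_poly_scale c f = f * Poly_Mapping.single 0 c"
proof -
  have s: "H_poly_scale c f = (\<Sum>w\<in>Poly_Mapping.keys f. Poly_Mapping.single w (c * Poly_Mapping.lookup f w))"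
    (is "_ = ?S")
    by (rule poly_mapping_eqI) (simp add: lookup_sum lookup_single when_def in_keys_iff)
  have "?S = Poly_Mapping.single 0 c *
      (\<Sum>w\<in>Poly_Mapping.keys f. Poly_Mapping.single w (Poly_Mapping.lookup f w))"
    by (simp add: sum_distrib_left mult_single)
  then show "H_poly_scale c f = Poly_Mapping.single 0 c * f" using s by (simp add: sum_singles)
  have "?S = (\<Sum>w\<in>Poly_Mapping.keys f. Poly_Mapping.single w (Poly_Mapping.lookup f w)) *
      Poly_Mapping.single 0 c"
    by (simp add: sum_distrib_right mult_single mult.commute)
  then show "H_poly_scale c f = f * Poly_Mapping.single 0 c" using s by (simp add: sum_singles)
qed

lemma H_poly_scale_mult_left: "H_poly_scale c f * g = H_poly_scale c (f * g)"
  by (simp add: H_poly_scale_eq_left mult.assoc)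

lemma H_poly_scale_mult_right: "f * H_poly_scale c g = H_poly_scale c (f * g)"
  by (simp add: H_poly_scale_eq_right mult.assoc)

lemma free_H_algebra_subspace: "H_poly.subspace (free_H_algebra \<Gamma>)"
proof -
  have "Poly_Mapping.keys (H_poly_scale c x) \<subseteq> Poly_Mapping.keys x" for c and x :: "('f::field, 'h) H_poly"
    by (auto simp: in_keys_iff)
  then show ?thesis
    using Poly_Mapping.keys_add unfolding H_poly.subspace_def free_H_algebra_def by fastforce
qed

lemma free_H_algebra_mult:
  "f \<in> free_H_algebra \<Gamma> \<Longrightarrow> g \<in> free_H_algebra \<Gamma> \<Longrightarrow> f * g \<in> free_H_algebra \<Gamma>"
  using Poly_Mapping.keys_mult[of f g] unfolding free_H_algebra_def by fastforce

locale H_basis = generalized_action scaleH scaleA act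
  for scaleH :: "'f::field \<Rightarrow> 'h::{ring, monoid_mult} \<Rightarrow> 'h"
    and scaleA :: "'f \<Rightarrow> 'a::ring \<Rightarrow> 'a"
    and act :: "'h \<Rightarrow> 'a \<Rightarrow> 'a" +
  fixes \<Gamma> :: "'h set"
  assumes independent_\<Gamma>: "H.independent \<Gamma>" and span_\<Gamma>: "H.span \<Gamma> = UNIV"
begin

abbreviation ev :: "(nat \<Rightarrow> 'a) \<Rightarrow> ('f, 'h) H_poly \<Rightarrow> 'a" where
  "ev \<equiv> H_eval scaleA act"

lemma ev_linear: "Vector_Spaces.linear H_poly_scale scaleA (ev \<psi>)"
  by (rule A.H_eval_linear)

definition H_mono :: "(nat \<times> 'h) list \<Rightarrow> ('f, 'h) H_poly" where
  "H_mono l = prod_list (map (\<lambda>(i, h). H_var scaleH \<Gamma> i h) l)"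

text \<open>The exponents range over \<open>H\<close> and not only over \<open>\<Gamma>\<close>, as
  in \<open>multilinear_H_polys\<close>. Arbitrary index sets are allowed because the induction over
  \<open>Pfun\<close> passes through subsets of \<open>{1..n}\<close>.\<close>

definition H_monos :: "nat set \<Rightarrow> ('f, 'h) H_poly set" where
  "H_monos X = {H_mono l | l. l \<noteq> [] \<and> distinct (map fst l) \<and> set (map fst l) = X}"

lemma H_var_free: "1 \<le> i \<Longrightarrow> H_var scaleH \<Gamma> i h \<in> free_H_algebra \<Gamma>"
  unfolding H_var_def
  by (intro H_poly.subspace_sum[OF free_H_algebra_subspace])
    (auto simp: free_H_algebra_def dest: H.representation_ne_zero)

lemma H_mono_free: "l \<noteq> [] \<Longrightarrow> set (map fst l) \<subseteq> {1..} \<Longrightarrow> H_mono l \<in> free_H_algebra \<Gamma>"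
proof (induction l)
  case (Cons p l)
  then show ?case
    by (cases "l = []"; cases p) (auto simp: H_mono_def intro!: free_H_algebra_mult H_var_free)
qed simp

lemma ev_H_mono_Pfun:
  assumes "l \<noteq> []" "distinct (map fst l)" "set (map fst l) \<subseteq> {1..}"
  shows "Pfun (set (map fst l)) (\<lambda>\<psi>. ev \<psi> (H_mono l))"
  using assms
proof (induction l)
  case (Cons p l)
  obtain i h where p: "p = (i, h)" by (cases p)
  have v: "ev \<psi> (H_var scaleH \<Gamma> i h) = act h (\<psi> i)" for \<psi>
    by (rule H_eval_H_var[OF independent_\<Gamma> span_\<Gamma>])
  show ?case
  proof (cases "l = []")
    case True
    then show ?thesis using p by (simp add: H_mono_def v Pfun.var)
  next
    case False
    have "ev \<psi> (H_mono (p # l)) = act h (\<psi> i) * ev \<psi> (H_mono l)" for \<psi>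
      using A.H_eval_mult[OF H_var_free H_mono_free[OF False], of i act \<psi> h] Cons.prems p
      by (simp add: H_mono_def v)
    moreover have "Pfun ({i} \<union> set (map fst l)) (\<lambda>\<psi>. act h (\<psi> i) * ev \<psi> (H_mono l))"
      using Cons p False by (intro Pfun.mult Pfun.var) auto
    ultimately show ?thesis using p by simp
  qed
qed simp

text \<open>Each rule of \<open>Pfun\<close> is matched by an operation on polynomials. The
  condition on \<open>X\<close> keeps the factors of a product in \<open>free_H_algebra\<close>,
  where evaluation is multiplicative.\<close>

lemma Pfun_realized:
  "Pfun X f \<Longrightarrow> X \<subseteq> {1..} \<Longrightarrow> \<exists>p\<in>H_poly.span (H_monos X). \<forall>\<psi>. ev \<psi> p = f \<psi>"
proof (induction rule: Pfun.induct)
  case (zero X)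
  interpret l: Vector_Spaces.linear H_poly_scale scaleA "ev \<psi>" for \<psi> by (rule ev_linear)
  show ?case by (intro bexI[of _ 0]) (auto simp: l.zero H_poly.span_zero)
next
  case (var x h)
  have "H_mono [(x, h)] \<in> H_monos {x}" by (auto simp: H_monos_def intro!: exI[of _ "[(x, h)]"])
  moreover have "ev \<psi> (H_mono [(x, h)]) = act h (\<psi> x)" for \<psi>
    by (simp add: H_mono_def H_eval_H_var[OF independent_\<Gamma> span_\<Gamma>])
  ultimately show ?case by (intro bexI[of _ "H_mono [(x, h)]"]) (auto intro: H_poly.span_base)
next
  case (mult X f Y g)
  then obtain p r where p: "p \<in> H_poly.span (H_monos X)" "\<And>\<psi>. ev \<psi> p = f \<psi>"
    and r: "r \<in> H_poly.span (H_monos Y)" "\<And>\<psi>. ev \<psi> r = g \<psi>" by auto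
  have free: "p \<in> free_H_algebra \<Gamma>" if "p \<in> H_poly.span (H_monos Z)" "Z \<subseteq> {1..}" for p Z
  proof -
    have "H_monos Z \<subseteq> free_H_algebra \<Gamma>"
      using that(2) H_mono_free unfolding H_monos_def by blast
    then show ?thesis using that(1) H_poly.span_minimal[OF _ free_H_algebra_subspace] by auto
  qed
  have "u * v \<in> H_poly.span (H_monos (X \<union> Y))" if u: "u \<in> H_monos X" and v: "v \<in> H_monos Y" for u v
  proof -
    obtain l where "u = H_mono l" "l \<noteq> []" "distinct (map fst l)" "set (map fst l) = X"
      using u unfolding H_monos_def by blast
    moreover obtain k where "v = H_mono k" "distinct (map fst k)" "set (map fst k) = Y"
      using v unfolding H_monos_def by blast
    moreover have "H_mono l * H_mono k = H_mono (l @ k)" by (simp add: H_mono_def)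
    ultimately have "u * v = H_mono (l @ k) \<and> l @ k \<noteq> [] \<and> distinct (map fst (l @ k)) \<and>
        set (map fst (l @ k)) = X \<union> Y"
      using mult.hyps(3) by (simp only: map_append distinct_append set_append) simp
    then have "u * v \<in> H_monos (X \<union> Y)" unfolding H_monos_def by blast
    then show ?thesis by (simp add: H_poly.span_base)
  qed
  then have 1: "u * r \<in> H_poly.span (H_monos (X \<union> Y))" if "u \<in> H_monos X" for u
    using that H_poly.span_minimal[of "H_monos Y" "{v. u * v \<in> H_poly.span (H_monos (X \<union> Y))}"] r(1)
    by (auto simp: H_poly.subspace_def distrib_left H_poly_scale_mult_right
        H_poly.span_add H_poly.span_scale H_poly.span_zero)
  then have "p * r \<in> H_poly.span (H_monos (X \<union> Y))"
    using H_poly.span_minimal[of "H_monos X" "{u. u * r \<in> H_poly.span (H_monos (X \<union> Y))}"] p(1)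
    by (auto simp: H_poly.subspace_def distrib_right H_poly_scale_mult_left
        H_poly.span_add H_poly.span_scale H_poly.span_zero)
  moreover have "ev \<psi> (p * r) = f \<psi> * g \<psi>" for \<psi>
    using A.H_eval_mult[OF free[OF p(1)] free[OF r(1)]] p(2) r(2) mult.prems by auto
  ultimately show ?case by auto
next
  case (add X f g)
  then obtain p r where p: "p \<in> H_poly.span (H_monos X)" "\<And>\<psi>. ev \<psi> p = f \<psi>"
    and r: "r \<in> H_poly.span (H_monos X)" "\<And>\<psi>. ev \<psi> r = g \<psi>" by auto
  interpret l: Vector_Spaces.linear H_poly_scale scaleA "ev \<psi>" for \<psi> by (rule ev_linear)
  show ?case by (intro bexI[of _ "p + r"]) (auto simp: l.add p r H_poly.span_add)
next
  case (scale X f c)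
  then obtain p where p: "p \<in> H_poly.span (H_monos X)" "\<And>\<psi>. ev \<psi> p = f \<psi>" by auto
  interpret l: Vector_Spaces.linear H_poly_scale scaleA "ev \<psi>" for \<psi> by (rule ev_linear)
  show ?case by (intro bexI[of _ "H_poly_scale c p"]) (auto simp: l.scale p H_poly.span_scale)
qed

text \<open>A permutation together with exponents is the same as a list of pairs whose first
  components exhaust \<open>{1..n}\<close> without repetition. For \<open>n = 0\<close> the two
  sides differ: the left one is spanned by the empty product, the right one is 0.\<close>

lemma multilinear_H_polys_eq:
  assumes "n \<ge> 1"
  shows "multilinear_H_polys scaleH \<Gamma> n = H_poly.span (H_monos {1..n})"
proof -
  have "{prod_list (map (\<lambda>j. H_var scaleH \<Gamma> (\<sigma> j) (h j)) [1..<Suc n]) | \<sigma> h. \<sigma> permutes {1..n}}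
      = H_monos {1..n}" (is "?L = _")
  proof (rule set_eqI, rule iffI)
    fix x assume "x \<in> ?L"
    then obtain \<sigma> h where s: "\<sigma> permutes {1..n}"
      "x = prod_list (map (\<lambda>j. H_var scaleH \<Gamma> (\<sigma> j) (h j)) [1..<Suc n])" by auto
    let ?l = "map (\<lambda>j. (\<sigma> j, h j)) [1..<Suc n]"
    have "x = H_mono ?l" using s(2) by (simp add: H_mono_def o_def del: upt_Suc)
    moreover have "distinct (map fst ?l)"
      using permutes_inj_on[OF s(1)] by (simp add: o_def distinct_map del: upt_Suc)
    moreover have "set (map fst ?l) = {1..n}"
      using permutes_image[OF s(1)] by (auto simp: o_def atLeastLessThanSuc_atLeastAtMost simp del: upt_Suc)
    ultimately show "x \<in> H_monos {1..n}"
      using assms unfolding H_monos_def by (intro CollectI exI[of _ ?l]) (auto simp del: upt_Suc)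
  next
    fix x assume "x \<in> H_monos {1..n}"
    then obtain l where l: "x = H_mono l" "distinct (map fst l)" "set (map fst l) = {1..n}"
      by (auto simp: H_monos_def)
    have len: "length l = n" using distinct_card[OF l(2)] l(3) by simp
    define \<sigma> where "\<sigma> j = (if j \<in> {1..n} then fst (l ! (j - 1)) else j)" for j
    have "\<sigma> permutes {1..n}"
    proof (rule bij_imp_permutes)
      have "inj_on \<sigma> {1..n}"
      proof (rule inj_onI)
        fix i j assume ij: "i \<in> {1..n}" "j \<in> {1..n}" "\<sigma> i = \<sigma> j"
        then have "map fst l ! (i - 1) = map fst l ! (j - 1)" by (auto simp: \<sigma>_def len)
        then have "i - 1 = j - 1" using ij len by (subst (asm) nth_eq_iff_index_eq[OF l(2)]) auto
        then show "i = j" using ij by auto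
      qed
      moreover have "\<sigma> ` {1..n} \<subseteq> {1..n}"
      proof
        fix i assume "i \<in> \<sigma> ` {1..n}"
        then obtain j where j: "j \<in> {1..n}" "i = fst (l ! (j - 1))" by (auto simp: \<sigma>_def)
        then have "l ! (j - 1) \<in> set l" using len by (intro nth_mem) auto
        then show "i \<in> {1..n}" using j(2) l(3) by auto
      qed
      ultimately show "bij_betw \<sigma> {1..n} {1..n}"
        by (simp add: bij_betw_def endo_inj_surj)
    qed (auto simp: \<sigma>_def)
    moreover have "x = prod_list (map (\<lambda>j. H_var scaleH \<Gamma> (\<sigma> j) (snd (l ! (j - 1)))) [1..<Suc n])"
    proof -
      have "map (\<lambda>(i, h). H_var scaleH \<Gamma> i h) l =
          map (\<lambda>j. H_var scaleH \<Gamma> (\<sigma> j) (snd (l ! (j - 1)))) [1..<Suc n]"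
        by (rule nth_equalityI) (auto simp: len \<sigma>_def case_prod_beta simp del: upt_Suc)
      then show ?thesis by (simp add: l(1) H_mono_def)
    qed
    ultimately show "x \<in> ?L"
      unfolding mem_Collect_eq by (intro exI[of _ \<sigma>] exI[of _ "\<lambda>j. snd (l ! (j - 1))"] conjI)
  qed
  then show ?thesis by (simp only: multilinear_H_polys_def)
qed

lemma ev_Pfun:
  assumes "n \<ge> 1" "p \<in> multilinear_H_polys scaleH \<Gamma> n"
  shows "Pfun {1..n} (\<lambda>\<psi>. ev \<psi> p)"
proof -
  interpret l: Vector_Spaces.linear H_poly_scale scaleA "ev \<psi>" for \<psi> by (rule ev_linear)
  have "H_poly.subspace {p. Pfun {1..n} (\<lambda>\<psi>. ev \<psi> p)}"
    by (auto simp: H_poly.subspace_def l.zero l.add l.scale intro: Pfun.intros)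
  moreover have "H_monos {1..n} \<subseteq> {p. Pfun {1..n} (\<lambda>\<psi>. ev \<psi> p)}"
  proof
    fix x assume "x \<in> H_monos {1..n}"
    then obtain l where l: "x = H_mono l" "l \<noteq> []" "distinct (map fst l)" "set (map fst l) = {1..n}"
      by (auto simp: H_monos_def)
    then have "Pfun (set (map fst l)) (\<lambda>\<psi>. ev \<psi> (H_mono l))"
      by (intro ev_H_mono_Pfun) (auto simp del: set_map)
    then show "x \<in> {p. Pfun {1..n} (\<lambda>\<psi>. ev \<psi> p)}" using l by simp
  qed
  ultimately have "H_poly.span (H_monos {1..n}) \<subseteq> {p. Pfun {1..n} (\<lambda>\<psi>. ev \<psi> p)}"
    by (intro H_poly.span_minimal)
  then show ?thesis using assms multilinear_H_polys_eq[OF assms(1)] by auto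
qed

lemma multilinear_free:
  assumes "n \<ge> 1" "p \<in> multilinear_H_polys scaleH \<Gamma> n"
  shows "p \<in> free_H_algebra \<Gamma>"
proof -
  have "H_poly.span (H_monos {1..n}) \<subseteq> free_H_algebra \<Gamma>"
    using H_mono_free unfolding H_monos_def
    by (intro H_poly.span_minimal free_H_algebra_subspace) fastforce
  then show ?thesis using assms multilinear_H_polys_eq[OF assms(1)] by auto
qed

text \<open>By multilinearity the identities of degree \<open>n\<close> are cut out by the
  coordinates of the values at tuples of basis elements, and tuples at which every function vanishes
  contribute nothing: this is the upper bound. For the lower bound, evaluation at
  \<open>\<psi> k\<close> isolates the coefficient of \<open>F k\<close> in a combination that is an
  identity.\<close>

lemma codim_bounds:
  assumes n: "n \<ge> 1" and E: "A.independent E" "A.span E = UNIV" "finite E"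
  shows "H_codim scaleH scaleA act \<Gamma> n \<le>
      card {t \<in> {1..n} \<rightarrow>\<^sub>E E. \<exists>f. Pfun {1..n} f \<and> f t \<noteq> 0} * card E"
    and "\<And>K F \<psi>. \<lbrakk>finite K; \<And>k. k \<in> K \<Longrightarrow> Pfun {1..n} (F k);
        \<And>k. k \<in> K \<Longrightarrow> F k (\<psi> k) \<noteq> 0; \<And>k l. k \<in> K \<Longrightarrow> l \<in> K \<Longrightarrow> k \<noteq> l \<Longrightarrow> F k (\<psi> l) = 0\<rbrakk>
      \<Longrightarrow> card K \<le> H_codim scaleH scaleA act \<Gamma> n"
proof -
  let ?V = "multilinear_H_polys scaleH \<Gamma> n"
  let ?W = "?V \<inter> H_identities scaleA act \<Gamma>"
  define T where "T = {t \<in> {1..n} \<rightarrow>\<^sub>E E. \<exists>f. Pfun {1..n} f \<and> f t \<noteq> 0}"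
  define L where "L = (\<lambda>(t, e) p. A.representation E (ev t p) e)"
  have fT: "finite T"
    unfolding T_def by (rule finite_subset[of _ "{1..n} \<rightarrow>\<^sub>E E"]) (auto intro: finite_PiE E)
  have D: "finite (T \<times> E)" using fT E by auto
  interpret l: Vector_Spaces.linear H_poly_scale scaleA "ev \<psi>" for \<psi> by (rule ev_linear)
  have L: "Vector_Spaces.linear H_poly_scale (*) (L i)" for i
  proof (cases i)
    case (Pair t e)
    show ?thesis
      unfolding Pair L_def
      by unfold_locales
        (use E in \<open>simp_all add: l.add l.scale A.representation_add A.representation_scale ring_distribs\<close>)
  qed
  have V: "H_poly.subspace ?V" by (simp add: multilinear_H_polys_def)
  have id: "p \<in> ?W \<longleftrightarrow> (\<forall>\<psi>. ev \<psi> p = 0)" if "p \<in> ?V" for p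
    using that multilinear_free[OF n] by (auto simp: H_identities_def)
  have W: "?W = {v \<in> ?V. \<forall>i\<in>T \<times> E. L i v = 0}"
  proof (rule set_eqI, rule iffI)
    fix p assume "p \<in> ?W"
    then show "p \<in> {v \<in> ?V. \<forall>i\<in>T \<times> E. L i v = 0}"
      using id by (auto simp: L_def A.representation_zero)
  next
    fix p assume p: "p \<in> {v \<in> ?V. \<forall>i\<in>T \<times> E. L i v = 0}"
    then have P: "Pfun {1..n} (\<lambda>\<psi>. ev \<psi> p)" using ev_Pfun[OF n] by auto
    have "ev t p = 0" if t: "t \<in> {1..n} \<rightarrow>\<^sub>E E" for t
    proof (rule ccontr)
      assume "ev t p \<noteq> 0"
      then have "t \<in> T" using t P by (auto simp: T_def)
      then have "A.representation E (ev t p) e = 0" if "e \<in> E" for e using p that by (auto simp: L_def)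
      moreover have "ev t p = (\<Sum>e\<in>E. scaleA (A.representation E (ev t p) e) e)"
        using A.sum_representation_eq[OF E(1), of "ev t p" E] E by simp
      ultimately show False using \<open>ev t p \<noteq> 0\<close> by simp
    qed
    then have "ev \<psi> p = 0" for \<psi> using Pfun_zero_on_basis[OF E(2) P] by simp
    then show "p \<in> ?W" using id p by auto
  qed
  note bounds = H_poly.quotient_dim_bounds[OF D L V W]
  show "H_codim scaleH scaleA act \<Gamma> n \<le> card T * card E"
    using bounds(1) by (simp only: H_codim_def card_cartesian_product)
  fix K F \<psi>
  assume K: "finite K" "\<And>k. k \<in> K \<Longrightarrow> Pfun {1..n} (F k)"
    "\<And>k. k \<in> K \<Longrightarrow> F k (\<psi> k) \<noteq> 0" "\<And>k l. k \<in> K \<Longrightarrow> l \<in> K \<Longrightarrow> k \<noteq> l \<Longrightarrow> F k (\<psi> l) = 0"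
  have "\<forall>k\<in>K. \<exists>p. p \<in> ?V \<and> (\<forall>\<psi>. ev \<psi> p = F k \<psi>)"
  proof
    fix k assume "k \<in> K"
    then show "\<exists>p. p \<in> ?V \<and> (\<forall>\<psi>. ev \<psi> p = F k \<psi>)"
      using Pfun_realized[OF K(2)] unfolding multilinear_H_polys_eq[OF n] by auto
  qed
  from bchoice[OF this] obtain p where p: "\<forall>k\<in>K. p k \<in> ?V \<and> (\<forall>\<psi>. ev \<psi> (p k) = F k \<psi>)" ..
  have indep: "\<forall>k\<in>K. u k = 0" if u: "(\<Sum>k\<in>K. H_poly_scale (u k) (p k)) \<in> ?W" for u
  proof
    fix k assume k: "k \<in> K"
    have "0 = ev (\<psi> k) (\<Sum>j\<in>K. H_poly_scale (u j) (p j))"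
      using IntD2[OF u] by (simp add: H_identities_def)
    also have "\<dots> = (\<Sum>j\<in>K. scaleA (u j) (F j (\<psi> k)))"
      using p by (simp add: l.sum l.scale)
    also have "\<dots> = (\<Sum>j\<in>K. if j = k then scaleA (u k) (F k (\<psi> k)) else 0)"
      using K(4) k by (intro sum.cong) auto
    also have "\<dots> = scaleA (u k) (F k (\<psi> k))" using k K(1) by simp
    finally show "u k = 0" using K(3)[OF k] by simp
  qed
  have pV: "p k \<in> ?V" if "k \<in> K" for k using p that by blast
  have "card K \<le> quotient_dim H_poly_scale ?V ?W"
  proof (rule bounds(2)[where K = K and f = p])
    show "finite K" by (rule K(1))
    show "p k \<in> ?V" if "k \<in> K" for k using that by (rule pV)
    show "\<forall>k\<in>K. u k = 0" if "(\<Sum>k\<in>K. H_poly_scale (u k) (p k)) \<in> ?W" for u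
      using that by (rule indep)
  qed
  then show "card K \<le> H_codim scaleH scaleA act \<Gamma> n" by (simp only: H_codim_def)
qed

end

section \<open>The semisimple quotient and the upper bound\<close>

text \<open>Let letters from \<open>R\<close> have weight \<open>\<epsilon>\<close> and the others
  weight 1. Each counted word then weighs at least \<open>\<epsilon> ^ p\<close>, while the weights
  of all words add up to the power on the right.\<close>

lemma card_words_le:
  fixes \<epsilon> :: real
  assumes "finite X" "finite P" "finite R" "P \<inter> R = {}" "0 < \<epsilon>" "\<epsilon> \<le> 1"
  shows "real (card {t \<in> X \<rightarrow>\<^sub>E P \<union> R. card {x \<in> X. t x \<in> R} \<le> p}) * \<epsilon> ^ p
    \<le> (real (card P) + \<epsilon> * real (card R)) ^ card X" (is "real (card ?T) * _ \<le> _")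
proof -
  define w where "w e = (if e \<in> R then \<epsilon> else 1)" for e
  have fin: "finite (X \<rightarrow>\<^sub>E P \<union> R)" using assms by (intro finite_PiE) auto
  have "real (card ?T) * \<epsilon> ^ p = (\<Sum>t\<in>?T. \<epsilon> ^ p)" by simp
  also have "\<dots> \<le> (\<Sum>t\<in>?T. \<Prod>x\<in>X. w (t x))"
  proof (rule sum_mono)
    fix t assume t: "t \<in> ?T"
    have "(\<Prod>x\<in>X. w (t x)) = (\<Prod>x\<in>{x \<in> X. t x \<in> R}. \<epsilon>)"
      unfolding w_def using assms(1) by (rule prod.inter_filter[symmetric])
    also have "\<dots> = \<epsilon> ^ card {x \<in> X. t x \<in> R}" by simp
    finally show "\<epsilon> ^ p \<le> (\<Prod>x\<in>X. w (t x))"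
      using t assms by (auto intro!: power_decreasing)
  qed
  also have "\<dots> \<le> (\<Sum>t\<in>X \<rightarrow>\<^sub>E P \<union> R. \<Prod>x\<in>X. w (t x))"
    using assms by (intro sum_mono2 fin) (auto simp: w_def intro!: prod_nonneg)
  also have "\<dots> = (\<Prod>x\<in>X. \<Sum>e\<in>P \<union> R. w e)"
    using assms by (intro prod_sum_PiE[symmetric]) auto
  also have "(\<Sum>e\<in>P \<union> R. w e) = real (card P) + \<epsilon> * real (card R)"
  proof -
    have "(\<Sum>e\<in>P \<union> R. w e) = (\<Sum>e\<in>P. w e) + (\<Sum>e\<in>R. w e)"
      using assms by (intro sum.union_disjoint) auto
    also have "(\<Sum>e\<in>P. w e) = (\<Sum>e\<in>P. 1)"
      using assms by (intro sum.cong) (auto simp: w_def)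
    also have "(\<Sum>e\<in>R. w e) = (\<Sum>e\<in>R. \<epsilon>)" by (intro sum.cong) (auto simp: w_def)
    finally show ?thesis by (simp add: mult.commute)
  qed
  finally show ?thesis by simp
qed

text \<open>\<open>AA i\<close> is the preimage in \<open>A\<close> of the \<open>i\<close>-th
  H-simple summand of \<open>A / J\<close>; from here on the quotient itself no longer
  occurs.\<close>

locale H_decomposition = fd_H_algebra scaleH scaleA act Basis
  for scaleH :: "'f::field \<Rightarrow> 'h::{ring, monoid_mult} \<Rightarrow> 'h"
    and scaleA :: "'f \<Rightarrow> 'a::ring \<Rightarrow> 'a"
    and act :: "'h \<Rightarrow> 'a \<Rightarrow> 'a" and Basis :: "'a set" +
  fixes q :: nat and AA :: "nat \<Rightarrow> 'a set"
  assumes J_act: "x \<in> A.J \<Longrightarrow> act h x \<in> A.J"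
    and AA_subspace: "i < q \<Longrightarrow> A.subspace (AA i)"
    and AA_left: "i < q \<Longrightarrow> x \<in> AA i \<Longrightarrow> a * x \<in> AA i"
    and AA_right: "i < q \<Longrightarrow> x \<in> AA i \<Longrightarrow> x * a \<in> AA i"
    and AA_act: "i < q \<Longrightarrow> x \<in> AA i \<Longrightarrow> act h x \<in> AA i"
    and J_AA: "i < q \<Longrightarrow> A.J \<subseteq> AA i"
    and AA_cover: "\<exists>a. (\<forall>i<q. a i \<in> AA i) \<and> x - (\<Sum>i<q. a i) \<in> A.J"
    and AA_indep: "(\<And>i. i < q \<Longrightarrow> s i \<in> AA i) \<Longrightarrow> (\<Sum>i<q. s i) \<in> A.J \<Longrightarrow> i < q \<Longrightarrow> s i \<in> A.J"
    and AA_simple: "i < q \<Longrightarrow> A.subspace K \<Longrightarrow> A.J \<subseteq> K \<Longrightarrow> K \<subseteq> AA i \<Longrightarrow>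
      (\<And>a x. x \<in> K \<Longrightarrow> a * x \<in> K \<and> x * a \<in> K) \<Longrightarrow> (\<And>h x. x \<in> K \<Longrightarrow> act h x \<in> K) \<Longrightarrow>
      K = A.J \<or> K = AA i"
    and AA_nontriv: "i < q \<Longrightarrow> \<exists>x\<in>AA i. \<exists>y\<in>AA i. x * y \<notin> A.J"
begin

lemma AA_inter:
  assumes "i < q" "j < q" "i \<noteq> j" "x \<in> AA i" "x \<in> AA j"
  shows "x \<in> A.J"
proof -
  define a where "a k = (if k = i then x else 0) + (if k = j then - x else 0)" for k
  have "a k \<in> AA k" if "k < q" for k
    using assms that AA_subspace by (auto simp: a_def A.subspace_neg A.subspace_0)
  moreover have "(\<Sum>k<q. a k) \<in> A.J"
    using assms A.subspace_0[OF A.subspace_J] by (simp add: a_def sum.distrib)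
  ultimately have "a i \<in> A.J" using AA_indep assms(1) by blast
  then show ?thesis using assms by (simp add: a_def)
qed

definition H_ideal :: "'a set \<Rightarrow> bool" where
  "H_ideal I \<longleftrightarrow> A.subspace I \<and> (\<forall>x\<in>I. (\<forall>a. a * x \<in> I \<and> x * a \<in> I) \<and> (\<forall>h. act h x \<in> I))"

lemma H_ideal_J: "H_ideal A.J"
  using A.subspace_J A.J_left A.J_right J_act by (auto simp: H_ideal_def)

lemma H_ideal_AA: "i < q \<Longrightarrow> H_ideal (AA i)"
  using AA_subspace AA_left AA_right AA_act by (auto simp: H_ideal_def)

text \<open>\<open>act_product\<close> expresses the action on a product of two elements of
  \<open>I\<close> by such products again, in either order.\<close>

lemma H_ideal_square:
  assumes "H_ideal I"
  shows "H_ideal (A.span {x * y | x y. x \<in> I \<and> y \<in> I})" (is "H_ideal ?S")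
proof -
  let ?P = "{x * y | x y. x \<in> I \<and> y \<in> I}"
  have "a * z \<in> ?S" "z * a \<in> ?S" "act h z \<in> ?S" if z: "z \<in> ?S" for a z h
  proof -
    have "A.subspace {z. a * z \<in> ?S \<and> z * a \<in> ?S \<and> act h z \<in> ?S}"
      by (auto simp: A.subspace_def distrib_left distrib_right A.scale_mult_left A.scale_mult_right
          act_plus act_scaleA A.span_zero A.span_add A.span_scale)
    moreover have "?P \<subseteq> {z. a * z \<in> ?S \<and> z * a \<in> ?S \<and> act h z \<in> ?S}"
    proof
      fix z assume "z \<in> ?P"
      then obtain x y where xy: "z = x * y" "x \<in> I" "y \<in> I" by auto
      have "a * x \<in> I" "y * a \<in> I" using assms xy by (auto simp: H_ideal_def)
      then have "a * x * y \<in> ?P" "x * (y * a) \<in> ?P" using xy by blast+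
      then have "a * z \<in> ?S" "z * a \<in> ?S" using xy(1) by (auto simp: mult.assoc intro: A.span_base)
      moreover obtain k :: nat and h1 h2 h3 h4 where p: "\<forall>a b. act h (a * b) =
          (\<Sum>i = 1..k. act (h1 i) a * act (h2 i) b + act (h3 i) b * act (h4 i) a)"
        using act_product[of h] by blast
      have inI: "act g x \<in> I" "act g y \<in> I" for g using assms xy by (auto simp: H_ideal_def)
      have "act g x * act g' y \<in> ?P" "act g y * act g' x \<in> ?P" for g g' using inI by blast+
      then have "act g x * act g' y \<in> ?S" "act g y * act g' x \<in> ?S" for g g'
        by (simp_all add: A.span_base)
      then have "act h z \<in> ?S"
        unfolding xy(1) p[rule_format] by (intro A.span_sum A.span_add)
      ultimately show "z \<in> {z. a * z \<in> ?S \<and> z * a \<in> ?S \<and> act h z \<in> ?S}" by simp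
    qed
    ultimately have "?S \<subseteq> {z. a * z \<in> ?S \<and> z * a \<in> ?S \<and> act h z \<in> ?S}"
      by (intro A.span_minimal)
    then show "a * z \<in> ?S" "z * a \<in> ?S" "act h z \<in> ?S" using z by auto
  qed
  then show ?thesis by (simp add: H_ideal_def)
qed

text \<open>A smallest H-invariant ideal covering \<open>B\<^sub>i\<close> is idempotent because \<open>B\<^sub>i\<close> is.\<close>

lemma idempotent_ideal_exists:
  assumes i: "i < q"
  shows "\<exists>I. H_ideal I \<and> I \<subseteq> AA i \<and> (\<forall>x\<in>AA i. \<exists>y\<in>I. x - y \<in> A.J) \<and>
    I \<subseteq> A.span {x * y | x y. x \<in> I \<and> y \<in> I}"
proof -
  let ?P = "\<lambda>I. H_ideal I \<and> I \<subseteq> AA i \<and> (\<forall>x\<in>AA i. \<exists>y\<in>I. x - y \<in> A.J)"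
  have "?P (AA i)" using H_ideal_AA[OF i] A.subspace_0[OF A.subspace_J] by force
  then obtain I where I: "?P I" and min: "\<And>I'. ?P I' \<Longrightarrow> A.dim I \<le> A.dim I'"
    using ex_has_least_nat[of ?P "AA i" A.dim] by blast
  have sI: "A.subspace I" using I by (simp add: H_ideal_def)
  define S where "S = A.span {x * y | x y. x \<in> I \<and> y \<in> I}"
  have HS: "H_ideal S" unfolding S_def using I by (intro H_ideal_square) auto
  have SI: "S \<subseteq> I" unfolding S_def using I sI by (intro A.span_minimal) (auto simp: H_ideal_def)
  \<comment> \<open>\<open>K\<close> is the preimage of the square of \<open>AA i / J\<close>. It
    exceeds \<open>J\<close> by \<open>AA_nontriv\<close>, so simplicity makes it all of
    \<open>AA i\<close>; consequently the square \<open>S\<close> of \<open>I\<close> still covers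
    \<open>AA i\<close> modulo \<open>J\<close>.\<close>
  define K where "K = {s + j | s j. s \<in> A.span {x * y | x y. x \<in> AA i \<and> y \<in> AA i} \<and> j \<in> A.J}"
  have HK: "H_ideal K"
    using A.subspace_sums[OF A.subspace_span A.subspace_J] H_ideal_square[OF H_ideal_AA[OF i]] H_ideal_J
    unfolding H_ideal_def K_def by (auto simp: distrib_left distrib_right act_plus) blast+
  have JK: "A.J \<subseteq> K" unfolding K_def using A.span_zero by force
  have "A.span {x * y | x y. x \<in> AA i \<and> y \<in> AA i} \<subseteq> AA i"
    using AA_subspace[OF i] AA_left[OF i] by (intro A.span_minimal) auto
  then have KA: "K \<subseteq> AA i"
    unfolding K_def using J_AA[OF i] A.subspace_add[OF AA_subspace[OF i]] by blast
  obtain x y where xy: "x \<in> AA i" "y \<in> AA i" "x * y \<notin> A.J" using AA_nontriv[OF i] by auto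
  then have "x * y \<in> A.span {x * y | x y. x \<in> AA i \<and> y \<in> AA i}" by (intro A.span_base) auto
  then have "x * y \<in> K"
    unfolding K_def using A.subspace_0[OF A.subspace_J]
    by (intro CollectI exI[of _ "x * y"] exI[of _ 0]) simp
  then have "K \<noteq> A.J" using xy by auto
  then have KAA: "K = AA i"
    using AA_simple[OF i, of K] HK JK KA by (auto simp: H_ideal_def)
  have "\<exists>y\<in>S. x - y \<in> A.J" if x: "x \<in> AA i" for x
  proof -
    have "A.subspace {x. \<exists>y\<in>S. x - y \<in> A.J}"
    proof (rule A.subspaceI)
      show "0 \<in> {x. \<exists>y\<in>S. x - y \<in> A.J}"
        using HS A.subspace_0[OF A.subspace_J] by (auto simp: H_ideal_def intro!: bexI[of _ 0] A.subspace_0)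
    next
      fix u v assume "u \<in> {x. \<exists>y\<in>S. x - y \<in> A.J}" "v \<in> {x. \<exists>y\<in>S. x - y \<in> A.J}"
      then obtain y z where "y \<in> S" "z \<in> S" "u - y \<in> A.J" "v - z \<in> A.J" by auto
      moreover have "(u + v) - (y + z) = (u - y) + (v - z)" by simp
      ultimately show "u + v \<in> {x. \<exists>y\<in>S. x - y \<in> A.J}"
        using HS A.subspace_add[OF A.subspace_J]
        by (metis (mono_tags, lifting) A.subspace_add H_ideal_def mem_Collect_eq)
    next
      fix c u assume "u \<in> {x. \<exists>y\<in>S. x - y \<in> A.J}"
      then obtain y where "y \<in> S" "u - y \<in> A.J" by auto
      then have "scaleA c y \<in> S" "scaleA c u - scaleA c y \<in> A.J"
        using HS A.subspace_scale[OF A.subspace_J, of "u - y" c]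
        by (auto simp: H_ideal_def A.subspace_scale A.scale_right_diff_distrib)
      then show "scaleA c u \<in> {x. \<exists>y\<in>S. x - y \<in> A.J}" by auto
    qed
    moreover have "{x * y | x y. x \<in> AA i \<and> y \<in> AA i} \<subseteq> {x. \<exists>y\<in>S. x - y \<in> A.J}"
    proof
      fix z assume "z \<in> {x * y | x y. x \<in> AA i \<and> y \<in> AA i}"
      then obtain x y where xy: "z = x * y" "x \<in> AA i" "y \<in> AA i" by auto
      obtain u v where uv: "u \<in> I" "x - u \<in> A.J" "v \<in> I" "y - v \<in> A.J" using I xy by blast
      have "z - u * v = (x - u) * y + u * (y - v)" by (simp add: xy(1) algebra_simps)
      also have "\<dots> \<in> A.J" using uv A.J_left A.J_right A.subspace_add[OF A.subspace_J] by blast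
      finally show "z \<in> {x. \<exists>y\<in>S. x - y \<in> A.J}"
        unfolding S_def using uv by (auto intro!: bexI[of _ "u * v"] A.span_base)
    qed
    ultimately have sub: "A.span {x * y | x y. x \<in> AA i \<and> y \<in> AA i} \<subseteq> {x. \<exists>y\<in>S. x - y \<in> A.J}"
      by (intro A.span_minimal)
    have "x \<in> K" using x KAA by simp
    then obtain s j where sj: "x = s + j" "s \<in> A.span {x * y | x y. x \<in> AA i \<and> y \<in> AA i}" "j \<in> A.J"
      unfolding K_def mem_Collect_eq by (elim exE conjE)
    then obtain y where y: "y \<in> S" "s - y \<in> A.J" using sub by auto
    have "x - y = (s - y) + j" using sj by simp
    then have "x - y \<in> A.J" using y(2) sj(3) A.subspace_add[OF A.subspace_J] by metis
    then show ?thesis using y(1) by auto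
  qed
  then have "?P S" using HS SI I by auto
  then have "S = I" using min[of S] HS SI sI by (intro A.subspace_dim_equal) (auto simp: H_ideal_def)
  then show ?thesis using I unfolding S_def by (intro exI[of _ I]) auto
qed

definition II :: "nat \<Rightarrow> 'a set" where
  "II i = (SOME I. H_ideal I \<and> I \<subseteq> AA i \<and> (\<forall>x\<in>AA i. \<exists>y\<in>I. x - y \<in> A.J) \<and>
    I \<subseteq> A.span {x * y | x y. x \<in> I \<and> y \<in> I})"

lemma II_props:
  assumes "i < q"
  shows "H_ideal (II i)" "II i \<subseteq> AA i" "x \<in> AA i \<Longrightarrow> \<exists>y\<in>II i. x - y \<in> A.J"
    "II i \<subseteq> A.span {x * y | x y. x \<in> II i \<and> y \<in> II i}"
  using someI_ex[OF idempotent_ideal_exists[OF assms]] unfolding II_def by blast+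

text \<open>The index \<open>q\<close> stands for the radical.\<close>

definition Q :: "nat \<Rightarrow> 'a set" where
  "Q k = (if k < q then II k else A.J)"

lemma H_ideal_Q: "H_ideal (Q k)"
  using II_props H_ideal_J by (simp add: Q_def)

definition nonzero_type :: "nat list \<Rightarrow> bool" where
  "nonzero_type l \<longleftrightarrow> (\<exists>zs. list_all2 (\<lambda>k z. z \<in> Q k) l zs \<and> lprod zs \<noteq> 0)"

definition admissible :: "nat set \<Rightarrow> bool" where
  "admissible S \<longleftrightarrow> S \<subseteq> {..<q} \<and> (S = {} \<or> (\<exists>l. set l \<subseteq> {..q} \<and> S \<subseteq> set l \<and> nonzero_type l))"

lemma nonzero_type_radical_bound:
  obtains p where "\<And>l. set l \<subseteq> {..q} \<Longrightarrow> nonzero_type l \<Longrightarrow> length (filter (\<lambda>k. k = q) l) < p"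
proof -
  obtain p where p: "\<And>zs. p \<le> length (filter (\<lambda>z. z \<in> A.J) zs) \<Longrightarrow> lprod zs = 0"
    using A.products_vanish by blast
  have le: "length (filter (\<lambda>k. k = q) l) \<le> length (filter (\<lambda>z. z \<in> A.J) zs)"
    if "list_all2 (\<lambda>k z. z \<in> Q k) l zs" for l zs
    using that by (induction rule: list_all2_induct) (auto simp: Q_def)
  have "length (filter (\<lambda>k. k = q) l) < p" if l: "nonzero_type l" for l
  proof -
    obtain zs where zs: "list_all2 (\<lambda>k z. z \<in> Q k) l zs" "lprod zs \<noteq> 0"
      using l unfolding nonzero_type_def by auto
    show ?thesis using le[OF zs(1)] p[of zs] zs(2) by (meson le_less_trans not_le)
  qed
  then show ?thesis using that by blast
qed

text \<open>Expanding \<open>f t\<close> yields products of factors \<open>act h (t x)\<close>, one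
  for each variable, in varying orders. The H-ideal \<open>Q (lb x)\<close> keeps the factor of
  \<open>x\<close>, and at least one of the products is nonzero.\<close>

lemma Pfun_nonzero_type:
  assumes "Pfun X f" "\<And>x. x \<in> X \<Longrightarrow> t x \<in> Q (lb x)" "f t \<noteq> 0"
  shows "\<exists>xs. distinct xs \<and> set xs = X \<and> nonzero_type (map lb xs)"
proof -
  let ?N = "\<lambda>X. {lprod zs | zs xs. distinct xs \<and> set xs = X \<and> list_all2 (\<lambda>x z. z \<in> Q (lb x)) xs zs}"
  have "f t \<in> A.span (?N X)"
    using assms(1,2)
  proof (induction rule: Pfun.induct)
    case (zero X)
    then show ?case by (simp add: A.span_zero)
  next
    case (var x h)
    have "lprod [act h (t x)] \<in> ?N {x}"
      using H_ideal_Q[of "lb x"] var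
      by (intro CollectI exI[of _ "[act h (t x)]"] exI[of _ "[x]"]) (auto simp: H_ideal_def)
    then show ?case by (simp add: A.span_base)
  next
    case (mult X f Y g)
    have "u * v \<in> A.span (?N (X \<union> Y))" if u: "u \<in> ?N X" and v: "v \<in> ?N Y" for u v
    proof -
      obtain zs xs where 1: "u = lprod zs" "distinct xs" "set xs = X" "list_all2 (\<lambda>x z. z \<in> Q (lb x)) xs zs"
        using u by blast
      obtain ws ys where 2: "v = lprod ws" "distinct ys" "set ys = Y" "list_all2 (\<lambda>x z. z \<in> Q (lb x)) ys ws"
        using v by blast
      show ?thesis
      proof (cases "zs = [] \<or> ws = []")
        case True
        then show ?thesis using 1(1) 2(1) by (auto simp: A.span_zero)
      next
        case False
        have "u * v = lprod (zs @ ws)" using False 1(1) 2(1) by (simp add: lprod_append)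
        moreover have "distinct (xs @ ys)" "set (xs @ ys) = X \<union> Y"
          "list_all2 (\<lambda>x z. z \<in> Q (lb x)) (xs @ ys) (zs @ ws)"
          using 1 2 mult.hyps(3) by (auto intro: list_all2_appendI)
        ultimately have "u * v \<in> ?N (X \<union> Y)" by blast
        then show ?thesis by (rule A.span_base)
      qed
    qed
    then show ?case
      using mult by (intro A.span_products[of "f t" "?N X" "g t" "?N Y"]) auto
  next
    case (add X f g)
    then show ?case by (simp add: A.span_add)
  next
    case (scale X f c)
    then show ?case by (simp add: A.span_scale)
  qed
  then have "\<not> ?N X \<subseteq> {0}" using assms(3) A.span_mono[of "?N X" "{0}"] by auto
  then obtain zs xs where z: "distinct xs" "set xs = X" "list_all2 (\<lambda>x z. z \<in> Q (lb x)) xs zs" "lprod zs \<noteq> 0"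
    by blast
  then have "list_all2 (\<lambda>k z. z \<in> Q k) (map lb xs) zs" by (simp add: list_all2_map1)
  then show ?thesis using z unfolding nonzero_type_def by blast
qed

section \<open>Adapted bases and the count of nonzero tuples\<close>

definition adapted_basis :: "(nat \<Rightarrow> 'a set) \<Rightarrow> bool" where
  "adapted_basis EE \<longleftrightarrow> A.independent (\<Union>k\<le>q. EE k) \<and> A.span (\<Union>k\<le>q. EE k) = UNIV \<and>
     (\<forall>k\<le>q. EE k \<subseteq> Q k) \<and> (\<forall>j\<le>q. \<forall>k\<le>q. j \<noteq> k \<longrightarrow> EE j \<inter> EE k = {}) \<and>
     A.J \<subseteq> A.span (EE q) \<and> (\<forall>i<q. AA i \<subseteq> A.span (EE i \<union> EE q))"

text \<open>A basis of \<open>J\<close> is extended by vectors from each \<open>II i\<close>. Taking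
  them from \<open>II i\<close> and not just from \<open>AA i\<close> makes the labels of basis
  elements fit \<open>nonzero_type\<close>; they still cover \<open>AA i\<close> modulo
  \<open>J\<close>.\<close>

lemma adapted_basis_exists: "\<exists>EE. adapted_basis EE"
proof -
  obtain EJ where EJ: "EJ \<subseteq> A.J" "A.independent EJ" "A.J \<subseteq> A.span EJ"
    using A.maximal_independent_subset by blast
  have fEJ: "finite EJ" using EJ A.finiteI_independent by auto
  have "\<exists>F. F \<subseteq> II i \<and> F \<inter> EJ = {} \<and> A.independent (F \<union> EJ) \<and> AA i \<subseteq> A.span (F \<union> EJ)" if i: "i < q" for i
  proof -
    obtain B where B: "EJ \<subseteq> B" "B \<subseteq> EJ \<union> II i" "A.independent B" "EJ \<union> II i \<subseteq> A.span B"
      using A.maximal_independent_subset_extend[of EJ "EJ \<union> II i"] EJ by auto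
    have "AA i \<subseteq> A.span B"
    proof
      fix x assume "x \<in> AA i"
      then obtain y where y: "y \<in> II i" "x - y \<in> A.J" using II_props(3)[OF i] by blast
      have "x - y \<in> A.span B" using y(2) EJ(3) A.span_mono[OF B(1)] by auto
      moreover have "y \<in> A.span B" using y B by auto
      ultimately have "(x - y) + y \<in> A.span B" by (rule A.span_add)
      then show "x \<in> A.span B" by simp
    qed
    moreover have "(B - EJ) \<union> EJ = B" using B(1) by auto
    ultimately show ?thesis using B by (intro exI[of _ "B - EJ"]) auto
  qed
  then have "\<forall>i\<in>{..<q}. \<exists>F. F \<subseteq> II i \<and> F \<inter> EJ = {} \<and> A.independent (F \<union> EJ) \<and> AA i \<subseteq> A.span (F \<union> EJ)"
    by blast
  from bchoice[OF this] obtain F where F: "\<forall>i\<in>{..<q}. F i \<subseteq> II i \<and> F i \<inter> EJ = {} \<and>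
      A.independent (F i \<union> EJ) \<and> AA i \<subseteq> A.span (F i \<union> EJ)" ..
  define EE where "EE k = (if k < q then F k else EJ)" for k
  have fF: "finite (F i)" if "i < q" for i
    using F that A.finiteI_independent by (metis finite_Un lessThan_iff)
  have FA: "F i \<subseteq> AA i" if "i < q" for i using F that II_props(2) by blast
  have U: "(\<Union>k\<le>q. EE k) = (\<Union>i<q. F i) \<union> EJ"
  proof -
    have "{..q} = insert q {..<q}" by auto
    then show ?thesis by (auto simp: EE_def)
  qed
  have disjF: "F i \<inter> F j = {}" if "i < q" "j < q" "i \<noteq> j" for i j
  proof (rule ccontr)
    assume "F i \<inter> F j \<noteq> {}"
    then obtain x where x: "x \<in> F i" "x \<in> F j" by auto
    then have "x \<in> A.span EJ" using AA_inter[OF that] FA that EJ by blast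
    moreover have "A.independent (insert x EJ)"
      by (rule A.independent_mono[of "F i \<union> EJ"]) (use F x that in auto)
    moreover have "x \<notin> EJ" using F x that by auto
    ultimately show False using A.independent_insert by auto
  qed
  have ind: "A.independent ((\<Union>i<q. F i) \<union> EJ)"
  proof (rule A.independent_if_scalars_zero)
    show "finite ((\<Union>i<q. F i) \<union> EJ)" using fF fEJ by auto
    fix u x assume sum0: "(\<Sum>x\<in>(\<Union>i<q. F i) \<union> EJ. scaleA (u x) x) = 0" and x: "x \<in> (\<Union>i<q. F i) \<union> EJ"
    define a where "a i = (\<Sum>x\<in>F i. scaleA (u x) x)" for i
    define b where "b = (\<Sum>x\<in>EJ. scaleA (u x) x)"
    have "(\<Sum>x\<in>(\<Union>i<q. F i) \<union> EJ. scaleA (u x) x) = (\<Sum>x\<in>(\<Union>i<q. F i). scaleA (u x) x) + b"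
      unfolding b_def using fF fEJ F by (intro sum.union_disjoint) auto
    also have "(\<Sum>x\<in>(\<Union>i<q. F i). scaleA (u x) x) = (\<Sum>i<q. a i)"
      unfolding a_def using fF disjF by (intro sum.UNION_disjoint) auto
    finally have s: "(\<Sum>i<q. a i) + b = 0" using sum0 by simp
    have bJ: "b \<in> A.J" unfolding b_def
      using EJ by (intro A.subspace_sum[OF A.subspace_J] A.subspace_scale[OF A.subspace_J]) auto
    have "(\<Sum>i<q. a i) = - b" using s by (simp add: eq_neg_iff_add_eq_0)
    then have sJ: "(\<Sum>i<q. a i) \<in> A.J" using bJ A.subspace_neg[OF A.subspace_J] by simp
    have aA: "a i \<in> AA i" if "i < q" for i
      unfolding a_def using FA[OF that] AA_subspace[OF that]
      by (intro A.subspace_sum A.subspace_scale) auto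
    have zero: "u x = 0" if i: "i < q" and xi: "x \<in> F i" for i x
    proof -
      \<comment> \<open>The part \<open>a i\<close> of the relation lies in \<open>J\<close> and can
        be rewritten over \<open>EJ\<close>, which gives a relation inside the independent set
        \<open>F i \<union> EJ\<close>.\<close>
      have "- a i \<in> A.J" using AA_indep[OF aA sJ i] A.subspace_neg[OF A.subspace_J] by blast
      then have "- a i \<in> A.span EJ" using EJ by auto
      then obtain v where v: "- a i = (\<Sum>x\<in>EJ. scaleA (v x) x)" using A.span_finite[OF fEJ] by auto
      have "(\<Sum>x\<in>F i \<union> EJ. scaleA (if x \<in> EJ then v x else u x) x) =
          (\<Sum>x\<in>F i. scaleA (if x \<in> EJ then v x else u x) x) + (\<Sum>x\<in>EJ. scaleA (if x \<in> EJ then v x else u x) x)"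
        using fF[OF i] fEJ F i by (intro sum.union_disjoint) auto
      also have "(\<Sum>x\<in>F i. scaleA (if x \<in> EJ then v x else u x) x) = a i"
        unfolding a_def using F i by (intro sum.cong) auto
      also have "(\<Sum>x\<in>EJ. scaleA (if x \<in> EJ then v x else u x) x) = - a i"
        unfolding v by (intro sum.cong) auto
      finally have "(\<Sum>x\<in>F i \<union> EJ. scaleA (if x \<in> EJ then v x else u x) x) = 0" by simp
      then have "(if x \<in> EJ then v x else u x) = 0"
        using A.independentD[of "F i \<union> EJ" "F i \<union> EJ" "\<lambda>x. if x \<in> EJ then v x else u x" x] F i xi fF[OF i] fEJ
        by auto
      then show ?thesis using F i xi by (auto split: if_splits)
    qed
    then have "a i = 0" if "i < q" for i unfolding a_def using that by (intro sum.neutral) auto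
    then have "b = 0" using s by simp
    then have "u x = 0" if "x \<in> EJ" for x
      using A.independentD[OF EJ(2) fEJ, of u x] that by (auto simp: b_def)
    then show "u x = 0" using x zero by auto
  qed
  have span: "A.span ((\<Union>i<q. F i) \<union> EJ) = UNIV" (is "A.span ?U = _")
  proof -
    have "x \<in> A.span ?U" for x
    proof -
      obtain a where a: "\<forall>i<q. a i \<in> AA i" "x - (\<Sum>i<q. a i) \<in> A.J" using AA_cover by blast
      have "a i \<in> A.span ?U" if "i < q" for i
      proof -
        have "a i \<in> A.span (F i \<union> EJ)" using a F that by auto
        moreover have "F i \<union> EJ \<subseteq> ?U" using that by auto
        ultimately show ?thesis using A.span_mono by blast
      qed
      moreover have "x - (\<Sum>i<q. a i) \<in> A.span ?U"
        using a EJ A.span_mono[of EJ ?U] by auto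
      ultimately have "(x - (\<Sum>i<q. a i)) + (\<Sum>i<q. a i) \<in> A.span ?U"
        by (intro A.span_add A.span_sum) auto
      then show ?thesis by simp
    qed
    then show ?thesis by auto
  qed
  have "adapted_basis EE"
    unfolding adapted_basis_def U
  proof (intro conjI ind span allI impI)
    show "EE k \<subseteq> Q k" for k using F EJ by (auto simp: EE_def Q_def)
    show "EE j \<inter> EE k = {}" if "j \<le> q" "k \<le> q" "j \<noteq> k" for j k
      using that disjF F by (auto simp: EE_def)
    show "A.J \<subseteq> A.span (EE q)" using EJ by (simp add: EE_def)
    show "AA i \<subseteq> A.span (EE i \<union> EE q)" if "i < q" for i using F that by (simp add: EE_def)
  qed
  then show ?thesis by blast
qed

text \<open>The factor \<open>2 ^ q\<close> counts the possible sets of simple labels. Since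
  \<open>p\<close> is obtained before \<open>n\<close> and \<open>\<epsilon>\<close>, the quotient
  \<open>2 ^ q / \<epsilon> ^ p\<close> is a constant when \<open>n\<close> tends to
  infinity.\<close>

lemma nonzero_tuples_le:
  assumes EE: "adapted_basis EE"
    and d: "\<And>S. admissible S \<Longrightarrow> card (\<Union>i\<in>S. EE i) \<le> d"
  obtains p where "\<And>n (\<epsilon>::real). n \<ge> 1 \<Longrightarrow> 0 < \<epsilon> \<Longrightarrow> \<epsilon> \<le> 1 \<Longrightarrow>
    real (card {t \<in> {1..n} \<rightarrow>\<^sub>E (\<Union>k\<le>q. EE k). \<exists>f. Pfun {1..n} f \<and> f t \<noteq> 0})
      \<le> 2 ^ q * (real d + \<epsilon> * real (card (EE q))) ^ n / \<epsilon> ^ p"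
proof -
  obtain p where p: "\<And>l. set l \<subseteq> {..q} \<Longrightarrow> nonzero_type l \<Longrightarrow> length (filter (\<lambda>k. k = q) l) < p"
    using nonzero_type_radical_bound by blast
  have fE: "finite (\<Union>k\<le>q. EE k)" using EE A.finiteI_independent by (auto simp: adapted_basis_def)
  have EQ: "EE k \<subseteq> Q k" if "k \<le> q" for k using EE that by (auto simp: adapted_basis_def)
  have disj: "EE j \<inter> EE k = {}" if "j \<le> q" "k \<le> q" "j \<noteq> k" for j k
    using EE that unfolding adapted_basis_def by blast
  have "\<forall>e\<in>(\<Union>k\<le>q. EE k). \<exists>k. k \<le> q \<and> e \<in> EE k" by auto
  from bchoice[OF this] obtain lab where lab0: "\<forall>e\<in>(\<Union>k\<le>q. EE k). lab e \<le> q \<and> e \<in> EE (lab e)" ..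
  then have lab: "lab e \<le> q" "e \<in> EE (lab e)" if "e \<in> (\<Union>k\<le>q. EE k)" for e using that by auto
  have lab_eq: "lab e = k" if "e \<in> EE k" "k \<le> q" for e k
    using lab[of e] disj[of "lab e" k] that by blast
  show ?thesis
  proof (rule that)
    fix n :: nat and \<epsilon> :: real
    assume n: "n \<ge> 1" and \<epsilon>: "0 < \<epsilon>" "\<epsilon> \<le> 1"
    define T where "T = {t \<in> {1..n} \<rightarrow>\<^sub>E (\<Union>k\<le>q. EE k). \<exists>f. Pfun {1..n} f \<and> f t \<noteq> 0}"
    define W where "W S = {t \<in> {1..n} \<rightarrow>\<^sub>E (\<Union>i\<in>S. EE i) \<union> EE q. card {x \<in> {1..n}. t x \<in> EE q} \<le> p}" for S
    have sub: "T \<subseteq> (\<Union>S\<in>{S. admissible S}. W S)"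
    proof
      fix t assume "t \<in> T"
      then obtain f where f: "Pfun {1..n} f" "f t \<noteq> 0" and t: "t \<in> {1..n} \<rightarrow>\<^sub>E (\<Union>k\<le>q. EE k)"
        by (auto simp: T_def)
      have tE: "t x \<in> (\<Union>k\<le>q. EE k)" if "x \<in> {1..n}" for x using t that by auto
      define lb where "lb x = lab (t x)" for x
      have lb: "lb x \<le> q" "t x \<in> EE (lb x)" if "x \<in> {1..n}" for x
        using lab[OF tE[OF that]] by (simp_all add: lb_def)
      obtain xs where xs: "distinct xs" "set xs = {1..n}" "nonzero_type (map lb xs)"
        using Pfun_nonzero_type[OF f(1) _ f(2), of lb] EQ lb by blast
      define S where "S = lb ` {1..n} \<inter> {..<q}"
      have l: "set (map lb xs) \<subseteq> {..q}" using xs lb by auto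
      then have "admissible S"
      proof -
        have "S \<subseteq> set (map lb xs)" using xs(2) by (auto simp: S_def)
        then show ?thesis
          using l xs(3) unfolding admissible_def by (intro conjI disjI2 exI[of _ "map lb xs"]) (auto simp: S_def)
      qed
      moreover have "t \<in> W S"
      proof -
        have "t x \<in> (\<Union>i\<in>S. EE i) \<union> EE q" if "x \<in> {1..n}" for x
          using lb[OF that] that by (cases "lb x = q") (auto simp: S_def)
        moreover have "card {x \<in> {1..n}. t x \<in> EE q} \<le> p"
        proof -
          have "{x \<in> {1..n}. t x \<in> EE q} \<subseteq> set (filter (\<lambda>x. lb x = q) xs)"
            using xs(2) lab_eq by (auto simp: lb_def)
          then have "card {x \<in> {1..n}. t x \<in> EE q} \<le> card (set (filter (\<lambda>x. lb x = q) xs))"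
            by (intro card_mono) auto
          also have "\<dots> \<le> length (filter (\<lambda>x. lb x = q) xs)" by (rule card_length)
          also have "\<dots> = length (filter (\<lambda>k. k = q) (map lb xs))"
            by (simp add: filter_map o_def)
          also have "\<dots> < p" using p[OF l xs(3)] .
          finally show ?thesis by simp
        qed
        ultimately show ?thesis using t by (auto simp: W_def PiE_iff)
      qed
      ultimately show "t \<in> (\<Union>S\<in>{S. admissible S}. W S)" by auto
    qed
    have adm: "{S. admissible S} \<subseteq> Pow {..<q}" by (auto simp: admissible_def)
    have fadm: "finite {S. admissible S}" using adm finite_subset by blast
    have fS: "finite (\<Union>i\<in>S. EE i)" "finite (EE q)" if "admissible S" for S
      using that fE finite_subset[of "\<Union>i\<in>S. EE i" "\<Union>k\<le>q. EE k"] by (force simp: admissible_def)+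
    have W: "real (card (W S)) \<le> (real d + \<epsilon> * real (card (EE q))) ^ n / \<epsilon> ^ p" if S: "admissible S" for S
    proof -
      have "(\<Union>i\<in>S. EE i) \<inter> EE q = {}"
      proof -
        have "EE i \<inter> EE q = {}" if "i \<in> S" for i
          using S that by (intro disj) (auto simp: admissible_def)
        then show ?thesis by blast
      qed
      then have "real (card (W S)) * \<epsilon> ^ p \<le>
          (real (card (\<Union>i\<in>S. EE i)) + \<epsilon> * real (card (EE q))) ^ card {1..n}"
        unfolding W_def using fS[OF S] \<epsilon> by (intro card_words_le) auto
      also have "\<dots> \<le> (real d + \<epsilon> * real (card (EE q))) ^ n"
        using d[OF S] \<epsilon> by (auto intro!: power_mono)
      finally show ?thesis using \<epsilon> by (simp add: field_simps)
    qed
    have fW: "finite (W S)" if "admissible S" for S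
      unfolding W_def by (rule finite_subset[of _ "{1..n} \<rightarrow>\<^sub>E (\<Union>i\<in>S. EE i) \<union> EE q"])
        (use fS[OF that] in \<open>auto intro!: finite_PiE\<close>)
    have "card T \<le> card (\<Union>S\<in>{S. admissible S}. W S)"
      using sub fadm fW by (intro card_mono) auto
    also have "\<dots> \<le> (\<Sum>S\<in>{S. admissible S}. card (W S))" by (rule card_UN_le[OF fadm])
    finally have "real (card T) \<le> (\<Sum>S\<in>{S. admissible S}. real (card (W S)))"
      by (metis of_nat_le_iff of_nat_sum)
    also have "\<dots> \<le> (\<Sum>S\<in>{S. admissible S}. (real d + \<epsilon> * real (card (EE q))) ^ n / \<epsilon> ^ p)"
      using W by (intro sum_mono) auto
    also have "\<dots> = real (card {S. admissible S}) * ((real d + \<epsilon> * real (card (EE q))) ^ n / \<epsilon> ^ p)"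
      by simp
    also have "\<dots> \<le> 2 ^ q * ((real d + \<epsilon> * real (card (EE q))) ^ n / \<epsilon> ^ p)"
    proof (rule mult_right_mono)
      have "card {S. admissible S} \<le> 2 ^ q" using card_mono[OF _ adm] by (simp add: card_Pow)
      then show "real (card {S. admissible S}) \<le> 2 ^ q" by (metis of_nat_le_iff of_nat_numeral of_nat_power)
    qed (use \<epsilon> in auto)
    finally show "real (card {t \<in> {1..n} \<rightarrow>\<^sub>E (\<Union>k\<le>q. EE k). \<exists>f. Pfun {1..n} f \<and> f t \<noteq> 0})
      \<le> 2 ^ q * (real d + \<epsilon> * real (card (EE q))) ^ n / \<epsilon> ^ p"
      by (simp add: T_def)
  qed
qed

end

section \<open>Determinants and multilinear expansion\<close>

text \<open>The determinant by the Leibniz formula, for matrices given as functions of row and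
  column, because the size \<open>d\<close> is a value and not a type.\<close>

definition ddet :: "nat \<Rightarrow> (nat \<Rightarrow> nat \<Rightarrow> 'f::comm_ring_1) \<Rightarrow> 'f" where
  "ddet d X = (\<Sum>\<sigma> | \<sigma> permutes {..<d}. of_int (sign \<sigma>) * (\<Prod>k<d. X k (\<sigma> k)))"

lemma ddet_cong: "(\<And>k l. k < d \<Longrightarrow> l < d \<Longrightarrow> X k l = Y k l) \<Longrightarrow> ddet d X = ddet d Y"
  unfolding ddet_def by (intro sum.cong arg_cong2[of _ _ _ _ "(*)"] prod.cong refl)
    (auto simp: permutes_in_image[of _ "{..<d}", simplified])

lemma ddet_permuted_rows:
  assumes f: "f permutes {..<d}"
  shows "ddet d (\<lambda>k. X (f k)) = of_int (sign f) * ddet d X"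
proof -
  have "ddet d (\<lambda>k. X (f k)) =
      (\<Sum>\<sigma> | \<sigma> permutes {..<d}. of_int (sign (\<sigma> \<circ> f)) * (\<Prod>k<d. X (f k) ((\<sigma> \<circ> f) k)))"
    unfolding ddet_def by (rule sum_permutations_compose_right[OF f])
  also have "\<dots> = (\<Sum>\<sigma> | \<sigma> permutes {..<d}. of_int (sign f) * (of_int (sign \<sigma>) * (\<Prod>k<d. X k (\<sigma> k))))"
  proof (rule sum.cong[OF refl])
    fix \<sigma> assume "\<sigma> \<in> {\<sigma>. \<sigma> permutes {..<d}}"
    then have "sign (\<sigma> \<circ> f) = sign \<sigma> * sign f"
      using f by (intro sign_compose) (auto intro: permutes_imp_permutation[of "{..<d}"])
    moreover have "(\<Prod>k<d. X (f k) ((\<sigma> \<circ> f) k)) = (\<Prod>k<d. X k (\<sigma> k))"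
      using prod.permute[OF f, of "\<lambda>k. X k (\<sigma> k)"] by (simp add: o_def)
    ultimately show "of_int (sign (\<sigma> \<circ> f)) * (\<Prod>k<d. X (f k) ((\<sigma> \<circ> f) k)) =
        of_int (sign f) * (of_int (sign \<sigma>) * (\<Prod>k<d. X k (\<sigma> k)))" by simp
  qed
  finally show ?thesis by (simp add: ddet_def sum_distrib_left)
qed

lemma ddet_equal_rows:
  fixes X :: "nat \<Rightarrow> nat \<Rightarrow> 'f::field_char_0"
  assumes "a < d" "b < d" "a \<noteq> b" "\<And>l. l < d \<Longrightarrow> X a l = X b l"
  shows "ddet d X = 0"
proof -
  have t: "transpose a b permutes {..<d}" using assms by (intro permutes_swap_id) auto
  have "ddet d X = ddet d (\<lambda>k. X (transpose a b k))"
    using assms by (intro ddet_cong) (auto simp: transpose_def)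
  also have "\<dots> = - ddet d X"
    using ddet_permuted_rows[OF t, of X] assms(3) by (simp add: sign_swap_id)
  finally show ?thesis by simp
qed

lemma ddet_equal_columns:
  fixes X :: "nat \<Rightarrow> nat \<Rightarrow> 'f::field_char_0"
  assumes "a < d" "b < d" "a \<noteq> b" "\<And>k. k < d \<Longrightarrow> X k a = X k b"
  shows "ddet d X = 0"
proof -
  let ?t = "transpose a b"
  have t: "?t permutes {..<d}" using assms by (intro permutes_swap_id) auto
  have "ddet d X = (\<Sum>\<sigma> | \<sigma> permutes {..<d}. of_int (sign (?t \<circ> \<sigma>)) * (\<Prod>k<d. X k ((?t \<circ> \<sigma>) k)))"
    unfolding ddet_def by (rule setum_permutations_compose_left[OF t])
  also have "\<dots> = (\<Sum>\<sigma> | \<sigma> permutes {..<d}. - (of_int (sign \<sigma>) * (\<Prod>k<d. X k (\<sigma> k))))"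
  proof (rule sum.cong[OF refl])
    fix \<sigma> assume s: "\<sigma> \<in> {\<sigma>. \<sigma> permutes {..<d}}"
    then have "sign (?t \<circ> \<sigma>) = sign ?t * sign \<sigma>"
      using t by (intro sign_compose) (auto intro: permutes_imp_permutation[of "{..<d}"])
    then have "sign (?t \<circ> \<sigma>) = - sign \<sigma>" using assms(3) by (simp add: sign_swap_id)
    moreover have "(\<Prod>k<d. X k ((?t \<circ> \<sigma>) k)) = (\<Prod>k<d. X k (\<sigma> k))"
      using assms(4) by (intro prod.cong) (auto simp: transpose_def)
    ultimately show "of_int (sign (?t \<circ> \<sigma>)) * (\<Prod>k<d. X k ((?t \<circ> \<sigma>) k)) =
        - (of_int (sign \<sigma>) * (\<Prod>k<d. X k (\<sigma> k)))" by simp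
  qed
  finally have "ddet d X = - ddet d X" by (simp add: ddet_def sum_negf)
  then show ?thesis by simp
qed

text \<open>The factor is a sign or 0. It is the same for all \<open>X\<close>, so that in a
  multilinear expansion over all maps \<open>f\<close> one common determinant can be taken out,
  leaving a fixed vector.\<close>

lemma ddet_rows_factor:
  assumes f: "f ` {..<d} \<subseteq> {..<d}"
  obtains c where "\<And>X :: nat \<Rightarrow> nat \<Rightarrow> 'f::field_char_0. ddet d (\<lambda>k. X (f k)) = c * ddet d X"
proof (cases "inj_on f {..<d}")
  case True
  define g where "g k = (if k < d then f k else k)" for k
  have "bij_betw f {..<d} {..<d}" using True f by (simp add: bij_betw_def endo_inj_surj)
  then have "bij_betw g {..<d} {..<d}" by (rule bij_betw_cong[THEN iffD1, rotated]) (simp add: g_def)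
  then have g: "g permutes {..<d}" by (rule bij_imp_permutes) (simp add: g_def)
  have "ddet d (\<lambda>k. X (f k)) = of_int (sign g) * ddet d X" for X :: "nat \<Rightarrow> nat \<Rightarrow> 'f"
    using ddet_permuted_rows[OF g, of X] ddet_cong[of d "\<lambda>k. X (g k)" "\<lambda>k. X (f k)"]
    by (simp add: g_def)
  then show ?thesis using that by blast
next
  case False
  then obtain a b where "a < d" "b < d" "a \<noteq> b" "f a = f b" by (auto simp: inj_on_def)
  then have "ddet d (\<lambda>k. X (f k)) = 0 * ddet d X" for X :: "nat \<Rightarrow> nat \<Rightarrow> 'f"
    using ddet_equal_rows[of a d b "\<lambda>k. X (f k)"] by simp
  then show ?thesis using that by blast
qed

lemma ddet_identity: "ddet d (\<lambda>k l. if k = l then 1 else 0) = (1 :: 'f::comm_ring_1)"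
proof -
  have "(\<Prod>k<d. if k = \<sigma> k then 1 else 0 :: 'f) = 0" if "\<sigma> permutes {..<d}" "\<sigma> \<noteq> id" for \<sigma>
  proof -
    obtain k where "\<sigma> k \<noteq> k" using \<open>\<sigma> \<noteq> id\<close> by (auto simp: fun_eq_iff)
    moreover then have "k < d" using that(1) by (metis lessThan_iff permutes_not_in)
    ultimately show ?thesis by (intro prod_zero) (auto intro!: bexI[of _ k])
  qed
  then have "ddet d (\<lambda>k l. if k = l then 1 else 0 :: 'f) =
      (\<Sum>\<sigma>\<in>{id}. of_int (sign \<sigma>) * (\<Prod>k<d. if k = \<sigma> k then 1 else 0))"
    unfolding ddet_def
    by (intro sum.mono_neutral_right finite_permutations) (auto simp: permutes_id)
  then show ?thesis by simp
qed

text \<open>This is the derivative of the determinant in the direction of the matrix product of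
  \<open>\<Phi>\<close> and \<open>X\<close>. Collected by rows instead of columns, the coefficient
  of \<open>\<Phi> j a\<close> is the determinant in which row \<open>j\<close> is replaced by row
  \<open>a\<close>, and it vanishes unless \<open>a = j\<close>.\<close>

lemma ddet_trace:
  fixes X :: "nat \<Rightarrow> nat \<Rightarrow> 'f::field_char_0"
  shows "(\<Sum>l<d. ddet d (\<lambda>k l'. if l' = l then \<Sum>a<d. \<Phi> k a * X a l' else X k l')) = (\<Sum>k<d. \<Phi> k k) * ddet d X"
proof -
  define Y where "Y k l = (\<Sum>a<d. \<Phi> k a * X a l)" for k l
  have "(\<Sum>l<d. \<Prod>k<d. if \<sigma> k = l then Y k (\<sigma> k) else X k (\<sigma> k)) =
      (\<Sum>j<d. \<Sum>a<d. \<Phi> j a * (\<Prod>k<d. X (if k = j then a else k) (\<sigma> k)))"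
    if s: "\<sigma> permutes {..<d}" for \<sigma>
  proof -
    \<comment> \<open>For a fixed permutation, the replaced column is indexed by the row
      \<open>j\<close> in which the permutation meets it.\<close>
    have "(\<Sum>l<d. \<Prod>k<d. if \<sigma> k = l then Y k (\<sigma> k) else X k (\<sigma> k)) =
        (\<Sum>j<d. \<Prod>k<d. if \<sigma> k = \<sigma> j then Y k (\<sigma> k) else X k (\<sigma> k))"
      using sum.permute[OF s, of "\<lambda>l. \<Prod>k<d. if \<sigma> k = l then Y k (\<sigma> k) else X k (\<sigma> k)"] by (simp add: o_def)
    also have "\<dots> = (\<Sum>j<d. \<Sum>a<d. \<Phi> j a * (\<Prod>k<d. X (if k = j then a else k) (\<sigma> k)))"
    proof (rule sum.cong[OF refl])
      fix j assume j: "j \<in> {..<d}"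
      have inj: "\<sigma> k = \<sigma> j \<longleftrightarrow> k = j" for k using permutes_inj[OF s] by (auto simp: inj_def)
      have split: "(\<Prod>k<d. h k) = h j * (\<Prod>k\<in>{..<d} - {j}. h k)" for h :: "nat \<Rightarrow> 'f"
        using j by (intro prod.remove) auto
      have "(\<Prod>k<d. if \<sigma> k = \<sigma> j then Y k (\<sigma> k) else X k (\<sigma> k)) =
          Y j (\<sigma> j) * (\<Prod>k\<in>{..<d} - {j}. X k (\<sigma> k))"
        by (subst split) (simp add: inj)
      also have "\<dots> = (\<Sum>a<d. \<Phi> j a * (X a (\<sigma> j) * (\<Prod>k\<in>{..<d} - {j}. X k (\<sigma> k))))"
        by (simp add: Y_def sum_distrib_right mult.assoc)
      also have "\<dots> = (\<Sum>a<d. \<Phi> j a * (\<Prod>k<d. X (if k = j then a else k) (\<sigma> k)))"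
        by (subst split) simp
      finally show "(\<Prod>k<d. if \<sigma> k = \<sigma> j then Y k (\<sigma> k) else X k (\<sigma> k)) =
          (\<Sum>a<d. \<Phi> j a * (\<Prod>k<d. X (if k = j then a else k) (\<sigma> k)))" .
    qed
    finally show ?thesis .
  qed
  note expand = this
  have "(\<Sum>l<d. ddet d (\<lambda>k l'. if l' = l then Y k l' else X k l')) =
      (\<Sum>\<sigma> | \<sigma> permutes {..<d}. of_int (sign \<sigma>) * (\<Sum>l<d. \<Prod>k<d. if \<sigma> k = l then Y k (\<sigma> k) else X k (\<sigma> k)))"
    unfolding ddet_def by (subst sum.swap) (simp add: sum_distrib_left)
  also have "\<dots> = (\<Sum>\<sigma> | \<sigma> permutes {..<d}. \<Sum>j<d. \<Sum>a<d.
      \<Phi> j a * (of_int (sign \<sigma>) * (\<Prod>k<d. X (if k = j then a else k) (\<sigma> k))))"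
    by (rule sum.cong) (simp_all add: expand sum_distrib_left mult.left_commute)
  also have "\<dots> = (\<Sum>j<d. \<Sum>a<d. \<Phi> j a * ddet d (\<lambda>k. X (if k = j then a else k)))"
    by (subst sum.swap, rule sum.cong[OF refl], subst sum.swap) (simp add: ddet_def sum_distrib_left)
  also have "\<dots> = (\<Sum>j<d. \<Sum>a<d. if a = j then \<Phi> j j * ddet d X else 0)"
  proof (intro sum.cong refl)
    fix j a assume ja: "j \<in> {..<d}" "a \<in> {..<d}"
    show "\<Phi> j a * ddet d (\<lambda>k. X (if k = j then a else k)) = (if a = j then \<Phi> j j * ddet d X else 0)"
    proof (cases "a = j")
      case True
      then have "(\<lambda>k. X (if k = j then a else k)) = X" by auto
      then show ?thesis using True by simp
    next
      case False
      then show ?thesis using ja ddet_equal_rows[of j d a "\<lambda>k. X (if k = j then a else k)"] by auto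
    qed
  qed
  also have "\<dots> = (\<Sum>k<d. \<Phi> k k) * ddet d X" by (simp add: sum_distrib_right)
  finally show ?thesis unfolding Y_def .
qed

lemma sum_PiE_Suc:
  fixes g :: "(nat \<Rightarrow> 'i) \<Rightarrow> 'w::comm_monoid_add"
  shows "(\<Sum>f\<in>{..<Suc n} \<rightarrow>\<^sub>E M. g f) = (\<Sum>a\<in>M. \<Sum>f\<in>{..<n} \<rightarrow>\<^sub>E M. g (f(n := a)))"
proof -
  have n: "{..<Suc n} \<rightarrow>\<^sub>E M = (\<lambda>(a, f). f(n := a)) ` (M \<times> ({..<n} \<rightarrow>\<^sub>E M))"
    using PiE_insert_eq[of n "{..<n}" "\<lambda>_. M"] by (simp add: lessThan_Suc)
  have "inj_on (\<lambda>(a, f). f(n := a)) (M \<times> ({..<n} \<rightarrow>\<^sub>E M))"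
    by (rule inj_combinator) simp
  then have "(\<Sum>f\<in>{..<Suc n} \<rightarrow>\<^sub>E M. g f) = (\<Sum>(a, f)\<in>M \<times> ({..<n} \<rightarrow>\<^sub>E M). g (f(n := a)))"
    unfolding n by (subst sum.reindex) (simp_all add: case_prod_unfold o_def)
  then show ?thesis by (simp only: sum.cartesian_product)
qed

text \<open>The remainders \<open>r k\<close> are annihilated in their own places. In the
  application they lie in \<open>J\<close>, and the arguments are expanded in a basis of a quotient
  only.\<close>

lemma multilinear_expand:
  fixes sv :: "'f::field \<Rightarrow> 'v::ab_group_add \<Rightarrow> 'v" and sw :: "'f \<Rightarrow> 'w::ab_group_add \<Rightarrow> 'w"
    and G :: "(nat \<Rightarrow> 'v) \<Rightarrow> 'w"
  assumes sw: "vector_space sw"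
    and lin: "\<And>k x. k < n \<Longrightarrow> Vector_Spaces.linear sv sw (\<lambda>u. G (x(k := u)))"
    and x: "\<And>k. k < n \<Longrightarrow> x k = (\<Sum>a<m. sv (C a k) (b a)) + r k"
    and r: "\<And>k y. k < n \<Longrightarrow> G (y(k := r k)) = 0"
  shows "G x = (\<Sum>f\<in>{..<n} \<rightarrow>\<^sub>E {..<m}. sw (\<Prod>k<n. C (f k) k) (G (\<lambda>k. if k < n then b (f k) else x k)))"
  using lin x r
proof (induction n arbitrary: x)
  case 0
  interpret vector_space sw by (rule sw)
  show ?case by simp
next
  case (Suc n)
  interpret l: Vector_Spaces.linear sv sw "\<lambda>u. G (y(n := u))" for y
    by (rule Suc.prems(1)[OF lessI])
  have "G x = G (x(n := (\<Sum>a<m. sv (C a n) (b a)) + r n))"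
    using Suc.prems(2)[of n] by (metis fun_upd_triv lessI)
  also have "\<dots> = (\<Sum>a<m. sw (C a n) (G (x(n := b a))))"
    by (simp only: l.add l.sum l.scale Suc.prems(3)[OF lessI] add_0_right)
  also have "\<dots> = (\<Sum>a<m. \<Sum>f\<in>{..<n} \<rightarrow>\<^sub>E {..<m}.
      sw (C a n * (\<Prod>k<n. C (f k) k)) (G (\<lambda>k. if k < n then b (f k) else (x(n := b a)) k)))"
  proof (rule sum.cong[OF refl])
    fix a assume "a \<in> {..<m}"
    have "G (x(n := b a)) = (\<Sum>f\<in>{..<n} \<rightarrow>\<^sub>E {..<m}.
        sw (\<Prod>k<n. C (f k) k) (G (\<lambda>k. if k < n then b (f k) else (x(n := b a)) k)))"
      using Suc.prems by (intro Suc.IH) auto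
    then show "sw (C a n) (G (x(n := b a))) = (\<Sum>f\<in>{..<n} \<rightarrow>\<^sub>E {..<m}.
      sw (C a n * (\<Prod>k<n. C (f k) k)) (G (\<lambda>k. if k < n then b (f k) else (x(n := b a)) k)))"
      by (simp add: l.vs2.scale_sum_right)
  qed
  also have "\<dots> = (\<Sum>a<m. \<Sum>f\<in>{..<n} \<rightarrow>\<^sub>E {..<m}.
      sw (\<Prod>k<Suc n. C ((f(n := a)) k) k) (G (\<lambda>k. if k < Suc n then b ((f(n := a)) k) else x k)))"
  proof (intro sum.cong refl arg_cong2[of _ _ _ _ sw] arg_cong[of _ _ G])
    fix a f
    show "C a n * (\<Prod>k<n. C (f k) k) = (\<Prod>k<Suc n. C ((f(n := a)) k) k)"
      by (simp add: mult.commute)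
    show "(\<lambda>k. if k < n then b (f k) else (x(n := b a)) k) = (\<lambda>k. if k < Suc n then b ((f(n := a)) k) else x k)"
      by (auto simp: less_Suc_eq)
  qed
  finally show ?case by (simp only: sum_PiE_Suc)
qed

text \<open>Refines a tuple entry by entry while \<open>\<Phi>\<close> stays nonzero. It serves to
  split elements of an ideal into long products, and later sums of operators into monomials.\<close>

lemma successive_replacement:
  fixes n :: nat
  assumes step: "\<And>k T. k < n \<Longrightarrow> R k (T k) \<Longrightarrow> \<Phi> T \<noteq> (0 :: 'w::zero) \<Longrightarrow> \<exists>t. P k t \<and> \<Phi> (T(k := t)) \<noteq> 0"
    and T: "\<And>k. k < n \<Longrightarrow> R k (T k)" "\<Phi> T \<noteq> 0"
  shows "\<exists>T'. (\<forall>k<n. P k (T' k)) \<and> (\<forall>k\<ge>n. T' k = T k) \<and> \<Phi> T' \<noteq> 0"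
proof -
  have "\<exists>T'. (\<forall>k<m. P k (T' k)) \<and> (\<forall>k\<ge>m. T' k = T k) \<and> \<Phi> T' \<noteq> 0" if "m \<le> n" for m
    using that
  proof (induction m)
    case 0
    then show ?case using T by auto
  next
    case (Suc m)
    then obtain T' where T': "\<forall>k<m. P k (T' k)" "\<forall>k\<ge>m. T' k = T k" "\<Phi> T' \<noteq> 0" by auto
    then obtain t where "P m t" "\<Phi> (T'(m := t)) \<noteq> 0"
      using step[of m T'] T(1)[of m] Suc.prems by auto
    moreover from this have "\<forall>k<Suc m. P k ((T'(m := t)) k)" using T' by (simp add: less_Suc_eq)
    moreover have "\<forall>k\<ge>Suc m. (T'(m := t)) k = T k" using T' by simp
    ultimately show ?case by blast
  qed
  then show ?thesis by blast
qed

section \<open>Multiplication operators and density\<close>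

lemma lprod_merge: "lprod (xs @ a # b # ys) = lprod (xs @ (a * b) # ys)"
proof (induction xs)
  case Nil
  then show ?case by (cases ys) (auto simp: mult.assoc)
next
  case (Cons x xs)
  then show ?case by (simp add: lprod_Cons)
qed

context generalized_action
begin

lemma linear_lprod: "Vector_Spaces.linear scaleA scaleA (\<lambda>u. lprod (xs @ u # ys))"
proof (induction xs)
  case Nil
  then show ?case
    by (cases "ys = []") (auto simp: linearA_iff lprod_Cons distrib_right A.scale_mult_left)
next
  case (Cons x xs)
  then show ?case
    by (auto simp: linearA_iff lprod_Cons distrib_left A.scale_mult_right)
qed

text \<open>Monomials in the multiplications and the action; \<open>Mop\<close> below is their
  linear span, the algebra that acts irreducibly on each \<open>AA i / J\<close>. The monomials are
  kept apart because only for them does \<open>CP\<close> provide a description with separate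
  constants.\<close>

inductive Mon :: "('a \<Rightarrow> 'a) \<Rightarrow> bool" where
  ident: "Mon (\<lambda>x. x)"
| act: "Mon T \<Longrightarrow> Mon (\<lambda>x. act h (T x))"
| left: "Mon T \<Longrightarrow> Mon (\<lambda>x. a * T x)"
| right: "Mon T \<Longrightarrow> Mon (\<lambda>x. T x * a)"

inductive Mop :: "('a \<Rightarrow> 'a) \<Rightarrow> bool" where
  mon: "Mon T \<Longrightarrow> Mop T"
| add: "Mop S \<Longrightarrow> Mop T \<Longrightarrow> Mop (\<lambda>x. S x + T x)"
| scale: "Mop T \<Longrightarrow> Mop (\<lambda>x. scaleA c (T x))"

lemma Mon_linear: "Mon T \<Longrightarrow> Vector_Spaces.linear scaleA scaleA T"
  by (induction rule: Mon.induct)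
    (auto simp: linearA_iff act_plus act_scaleA distrib_left distrib_right A.scale_mult_left A.scale_mult_right)

lemma Mop_linear: "Mop T \<Longrightarrow> Vector_Spaces.linear scaleA scaleA T"
proof (induction rule: Mop.induct)
  case (mon T)
  then show ?case by (rule Mon_linear)
next
  case (add S T)
  then show ?case by (auto simp: linearA_iff A.scale_right_distrib)
next
  case (scale T c)
  then show ?case by (auto simp: linearA_iff A.scale_right_distrib mult.commute)
qed

lemma Mon_comp: "Mon S \<Longrightarrow> Mon T \<Longrightarrow> Mon (\<lambda>x. S (T x))"
  by (induction rule: Mon.induct) (auto intro: Mon.intros)

lemma Mop_comp:
  assumes "Mop S" "Mop T"
  shows "Mop (\<lambda>x. S (T x))"
proof -
  have 1: "Mop (\<lambda>x. S (T x))" if "Mop S" "Mon T" for S T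
    using that by (induction rule: Mop.induct) (auto intro: Mop.intros Mon_comp)
  have lin: "S (x + y) = S x + S y" "S (scaleA c x) = scaleA c (S x)" for x y c
    using Mop_linear[OF assms(1)] by (auto simp: linearA_iff)
  show ?thesis
    using assms(2,1)
  proof (induction rule: Mop.induct)
    case (mon T)
    show ?case by (rule 1[OF assms(1) mon(1)])
  next
    case (add T T')
    then show ?case by (simp add: lin Mop.add)
  next
    case (scale T c)
    then show ?case by (simp add: lin Mop.scale)
  qed
qed

lemma Mop_extract:
  assumes "Mop T" "\<And>S T. \<Phi> (\<lambda>x. S x + T x) = \<Phi> S + \<Phi> T" "\<And>c T. \<Phi> (\<lambda>x. scaleA c (T x)) = scaleA c (\<Phi> T)"
    "\<Phi> T \<noteq> 0"
  shows "\<exists>T'. Mon T' \<and> \<Phi> T' \<noteq> 0"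
  using assms(1,4)
proof (induction rule: Mop.induct)
  case (add S T)
  then have "\<Phi> S \<noteq> 0 \<or> \<Phi> T \<noteq> 0" using assms(2) by auto
  then show ?case using add by auto
next
  case (scale T c)
  then show ?case using assms(3) by auto
qed auto

text \<open>\<open>CP N X f\<close>: a function with \<open>N\<close> constant factors. The constants become additional
  variables in \<open>CP_Pfun\<close>; sums are excluded, since all summands would have to share their
  constants.\<close>

inductive CP :: "nat \<Rightarrow> 'v set \<Rightarrow> (('v \<Rightarrow> 'a) \<Rightarrow> 'a) \<Rightarrow> bool" where
  var: "CP 0 {x} (\<lambda>\<psi>. \<psi> x)"
| const: "CP (Suc 0) {} (\<lambda>\<psi>. a)"
| act: "CP N X f \<Longrightarrow> CP N X (\<lambda>\<psi>. act h (f \<psi>))"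
| mult: "CP N X f \<Longrightarrow> CP M Y g \<Longrightarrow> X \<inter> Y = {} \<Longrightarrow> CP (N + M) (X \<union> Y) (\<lambda>\<psi>. f \<psi> * g \<psi>)"

lemma CP_Pfun:
  fixes X :: "'v set"
  shows "CP N X f \<Longrightarrow> \<exists>\<kappa> \<theta>. Pfun (Inl ` X \<union> Inr ` {..<N}) \<theta> \<and> (\<forall>\<psi>. f \<psi> = \<theta> (case_sum \<psi> \<kappa>))"
proof (induction rule: CP.induct)
  case (var x)
  show ?case
    using Pfun_var[of "Inl x"] by (intro exI[of _ "\<lambda>_. 0"] exI[of _ "\<lambda>\<psi>. \<psi> (Inl x)"]) simp
next
  case (const a)
  show ?case
    using Pfun_var[of "Inr 0"]
    by (intro exI[of _ "\<lambda>_. a"] exI[of _ "\<lambda>\<psi>. \<psi> (Inr 0)"]) (simp add: lessThan_Suc)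
next
  case (act N X f h)
  then obtain \<kappa> \<theta> where "Pfun (Inl ` X \<union> Inr ` {..<N}) \<theta>" "\<forall>\<psi>. f \<psi> = \<theta> (case_sum \<psi> \<kappa>)" by auto
  then show ?case by (intro exI[of _ \<kappa>] exI[of _ "\<lambda>\<psi>. act h (\<theta> \<psi>)"]) (auto intro: Pfun_act)
next
  case (mult N X f M Y g)
  obtain \<kappa>1 \<theta>1 where 1: "Pfun (Inl ` X \<union> Inr ` {..<N}) \<theta>1" "\<forall>\<psi>. f \<psi> = \<theta>1 (case_sum \<psi> \<kappa>1)"
    using mult.IH(1) by auto
  obtain \<kappa>2 \<theta>2 where 2: "Pfun (Inl ` Y \<union> Inr ` {..<M}) \<theta>2" "\<forall>\<psi>. g \<psi> = \<theta>2 (case_sum \<psi> \<kappa>2)"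
    using mult.IH(2) by auto
  \<comment> \<open>The constants of the second factor are renumbered behind the \<open>N\<close>
    constants of the first.\<close>
  define \<rho> :: "'v + nat \<Rightarrow> 'v + nat" where "\<rho> = map_sum id (\<lambda>n. n + N)"
  define \<kappa> where "\<kappa> n = (if n < N then \<kappa>1 n else \<kappa>2 (n - N))" for n
  define \<theta>3 where "\<theta>3 \<psi> = \<theta>2 (\<lambda>v. \<psi> (\<rho> v))" for \<psi>
  have "inj \<rho>" unfolding \<rho>_def by (intro sum.inj_map) auto
  then have "Pfun (\<rho> ` (Inl ` Y \<union> Inr ` {..<M})) \<theta>3"
    unfolding \<theta>3_def by (intro Pfun_rename[OF 2(1)]) (auto intro: inj_on_subset)
  moreover have "\<rho> ` (Inl ` Y \<union> Inr ` {..<M}) = Inl ` Y \<union> Inr ` {N..<N + M}"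
  proof -
    have "(\<lambda>n. n + N) ` {..<M} = {N..<N + M}"
      by (simp add: lessThan_atLeast0 image_add_atLeastLessThan' add.commute)
    then show ?thesis by (simp add: \<rho>_def image_Un image_image) (metis image_image)
  qed
  ultimately have 3: "Pfun (Inl ` Y \<union> Inr ` {N..<N + M}) \<theta>3" by simp
  have "Pfun ((Inl ` X \<union> Inr ` {..<N}) \<union> (Inl ` Y \<union> Inr ` {N..<N + M})) (\<lambda>\<psi>. \<theta>1 \<psi> * \<theta>3 \<psi>)"
    using mult.hyps(3) by (intro Pfun.mult 1(1) 3) auto
  moreover have "(Inl ` X \<union> Inr ` {..<N}) \<union> (Inl ` Y \<union> Inr ` {N..<N + M}) =
      Inl ` (X \<union> Y) \<union> Inr ` {..<N + M}" by (auto simp: image_iff)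
  moreover have "f \<psi> = \<theta>1 (case_sum \<psi> \<kappa>)" for \<psi>
    unfolding 1(2)[rule_format] by (rule Pfun_cong[OF 1(1)]) (auto simp: \<kappa>_def)
  moreover have "g \<psi> = \<theta>3 (case_sum \<psi> \<kappa>)" for \<psi>
    unfolding 2(2)[rule_format] \<theta>3_def by (rule Pfun_cong[OF 2(1)]) (auto simp: \<kappa>_def \<rho>_def)
  ultimately show ?case by (intro exI[of _ \<kappa>] exI[of _ "\<lambda>\<psi>. \<theta>1 \<psi> * \<theta>3 \<psi>"]) simp
qed

lemma CP_linear:
  assumes "CP N X f" "x \<in> X"
  shows "Vector_Spaces.linear scaleA scaleA (\<lambda>u. f (\<psi>(x := u)))"
proof -
  obtain \<kappa> \<theta> where 1: "Pfun (Inl ` X \<union> Inr ` {..<N}) \<theta>" "\<forall>\<psi>. f \<psi> = \<theta> (case_sum \<psi> \<kappa>)"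
    using CP_Pfun[OF assms(1)] by auto
  have "case_sum (\<psi>(x := u)) \<kappa> = (case_sum \<psi> \<kappa>)(Inl x := u)" for u
    by (rule ext) (auto split: sum.split)
  then have "f (\<psi>(x := u)) = \<theta> ((case_sum \<psi> \<kappa>)(Inl x := u))" for u using 1(2) by simp
  then show ?thesis using Pfun_update_linear[OF 1(1), of "Inl x" "case_sum \<psi> \<kappa>"] assms(2) by simp
qed

lemma CP_cong:
  assumes "CP N X f" "\<And>x. x \<in> X \<Longrightarrow> \<psi> x = \<psi>' x"
  shows "f \<psi> = f \<psi>'"
proof -
  obtain \<kappa> \<theta> where 1: "Pfun (Inl ` X \<union> Inr ` {..<N}) \<theta>" "\<forall>\<psi>. f \<psi> = \<theta> (case_sum \<psi> \<kappa>)"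
    using CP_Pfun[OF assms(1)] by auto
  have "\<theta> (case_sum \<psi> \<kappa>) = \<theta> (case_sum \<psi>' \<kappa>)"
    by (rule Pfun_cong[OF 1(1)]) (use assms(2) in auto)
  then show ?thesis using 1(2) by simp
qed

lemma CP_Mon: "Mon T \<Longrightarrow> \<exists>N. CP N {x} (\<lambda>\<psi>. T (\<psi> x))"
proof (induction rule: Mon.induct)
  case ident
  show ?case by (rule exI[of _ 0]) (rule CP.var)
next
  case (act T h)
  then obtain N where "CP N {x} (\<lambda>\<psi>. T (\<psi> x))" by auto
  then show ?case by (intro exI[of _ N]) (rule CP.act)
next
  case (left T a)
  then obtain N where "CP N {x} (\<lambda>\<psi>. T (\<psi> x))" by auto
  then have "CP (Suc 0 + N) ({} \<union> {x}) (\<lambda>\<psi>. a * T (\<psi> x))" by (intro CP.mult CP.const) auto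
  then show ?case by auto
next
  case (right T a)
  then obtain N where "CP N {x} (\<lambda>\<psi>. T (\<psi> x))" by auto
  then have "CP (N + Suc 0) ({x} \<union> {}) (\<lambda>\<psi>. T (\<psi> x) * a)" by (intro CP.mult CP.const) auto
  then show ?case by auto
qed

lemma CP_lprod:
  assumes "xs \<noteq> []" "distinct xs" "\<And>x. x \<in> set xs \<Longrightarrow> \<exists>N. CP N (X x) (g x)"
    "\<And>x y. x \<in> set xs \<Longrightarrow> y \<in> set xs \<Longrightarrow> x \<noteq> y \<Longrightarrow> X x \<inter> X y = {}"
  shows "\<exists>N. CP N (\<Union>x\<in>set xs. X x) (\<lambda>\<psi>. lprod (map (\<lambda>x. g x \<psi>) xs))"
  using assms
proof (induction xs)
  case (Cons x xs)
  obtain N where N: "CP N (X x) (g x)" using Cons.prems(3)[of x] by auto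
  show ?case
  proof (cases "xs = []")
    case True
    then show ?thesis using N by auto
  next
    case False
    then obtain M where M: "CP M (\<Union>x\<in>set xs. X x) (\<lambda>\<psi>. lprod (map (\<lambda>x. g x \<psi>) xs))"
      using Cons.IH Cons.prems by auto
    have "X x \<inter> (\<Union>x\<in>set xs. X x) = {}"
      using Cons.prems(2,4) by fastforce
    then have "CP (N + M) (X x \<union> (\<Union>x\<in>set xs. X x)) (\<lambda>\<psi>. g x \<psi> * lprod (map (\<lambda>x. g x \<psi>) xs))"
      by (rule CP.mult[OF N M])
    then show ?thesis using False by (auto simp: lprod_Cons)
  qed
qed simp

end

context H_decomposition
begin

lemma H_ideal_Mon: "Mon T \<Longrightarrow> H_ideal I \<Longrightarrow> x \<in> I \<Longrightarrow> T x \<in> I"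
  by (induction rule: Mon.induct) (auto simp: H_ideal_def)

lemma H_ideal_Mop: "Mop T \<Longrightarrow> H_ideal I \<Longrightarrow> x \<in> I \<Longrightarrow> T x \<in> I"
proof (induction rule: Mop.induct)
  case (mon T)
  then show ?case by (rule H_ideal_Mon)
qed (auto simp: H_ideal_def A.subspace_add A.subspace_scale)

text \<open>The elements reachable from \<open>x\<close> modulo \<open>J\<close> form an H-invariant
  ideal between \<open>J\<close> and \<open>AA i\<close>. It contains \<open>x\<close> through the
  identity monomial, which makes up for the missing unit, so simplicity leaves only
  \<open>AA i\<close>.\<close>

lemma Mop_transitive:
  assumes i: "i < q" and x: "x \<in> AA i" "x \<notin> A.J" and y: "y \<in> AA i"
  shows "\<exists>T. Mop T \<and> T x - y \<in> A.J"
proof -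
  define K where "K = {z. \<exists>T. Mop T \<and> T x - z \<in> A.J}"
  have sJ: "A.subspace A.J" by (rule A.subspace_J)
  have KI: "z \<in> K" if "Mop T" "T x - z \<in> A.J" for T z using that by (auto simp: K_def)
  have zero: "Mop (\<lambda>x. 0)" using Mop.scale[OF Mop.mon[OF Mon.ident], of 0] by simp
  have "A.subspace K"
  proof (rule A.subspaceI)
    show "0 \<in> K" using KI[OF zero] A.subspace_0[OF sJ] by simp
  next
    fix u v assume "u \<in> K" "v \<in> K"
    then obtain S T where ST: "Mop S" "S x - u \<in> A.J" "Mop T" "T x - v \<in> A.J" by (auto simp: K_def)
    have "(S x + T x) - (u + v) = (S x - u) + (T x - v)" by simp
    then show "u + v \<in> K" using ST A.subspace_add[OF sJ] by (intro KI[OF Mop.add[OF ST(1,3)]]) metis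
  next
    fix c u assume "u \<in> K"
    then obtain S where S: "Mop S" "S x - u \<in> A.J" by (auto simp: K_def)
    then show "scaleA c u \<in> K"
      using A.subspace_scale[OF sJ S(2), of c]
      by (intro KI[OF Mop.scale[OF S(1), of c]]) (simp add: A.scale_right_diff_distrib)
  qed
  moreover have "A.J \<subseteq> K" using KI[OF zero] A.subspace_neg[OF sJ] by auto
  moreover have "K \<subseteq> AA i"
  proof
    fix z assume "z \<in> K"
    then obtain T where T: "Mop T" "T x - z \<in> A.J" by (auto simp: K_def)
    have "T x \<in> AA i" using H_ideal_Mop[OF T(1) H_ideal_AA[OF i] x(1)] .
    moreover have "T x - z \<in> AA i" using T(2) J_AA[OF i] by auto
    ultimately have "T x - (T x - z) \<in> AA i" by (rule A.subspace_diff[OF AA_subspace[OF i]])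
    then show "z \<in> AA i" by (simp add: algebra_simps)
  qed
  moreover have "a * z \<in> K \<and> z * a \<in> K" if z: "z \<in> K" for a z
  proof -
    obtain T where T: "Mop T" "T x - z \<in> A.J" using z by (auto simp: K_def)
    have "Mop (\<lambda>x. a * T x)" "Mop (\<lambda>x. T x * a)"
      using Mop_comp[OF Mop.mon[OF Mon.left[OF Mon.ident]] T(1)]
        Mop_comp[OF Mop.mon[OF Mon.right[OF Mon.ident]] T(1)] by auto
    then show ?thesis
      using KI[of "\<lambda>x. a * T x" "a * z"] KI[of "\<lambda>x. T x * a" "z * a"] A.J_left[OF T(2), of a] A.J_right[OF T(2), of a]
      by (auto simp: right_diff_distrib left_diff_distrib)
  qed
  moreover have "act h z \<in> K" if z: "z \<in> K" for h z
  proof -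
    obtain T where T: "Mop T" "T x - z \<in> A.J" using z by (auto simp: K_def)
    have "Mop (\<lambda>x. act h (T x))"
      using Mop_comp[OF Mop.mon[OF Mon.act[OF Mon.ident]] T(1)] by auto
    moreover have "act h (T x) - act h z \<in> A.J"
      using J_act[OF T(2), of h] act_plus[of h "T x - z" z] by (simp add: algebra_simps)
    ultimately show ?thesis by (rule KI)
  qed
  ultimately have "K = A.J \<or> K = AA i" by (intro AA_simple[OF i]) auto
  moreover have "x \<in> K" using KI[OF Mop.mon[OF Mon.ident]] A.subspace_0[OF sJ] by simp
  ultimately have "K = AA i" using x by auto
  then have "y \<in> K" using y by simp
  then show ?thesis by (auto simp: K_def)
qed

end

locale H_decomposition_ac = H_decomposition scaleH scaleA act Basis q AA
  for scaleH :: "'f::{alg_closed_field, field_char_0} \<Rightarrow> 'h::{ring, monoid_mult} \<Rightarrow> 'h"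
    and scaleA :: "'f \<Rightarrow> 'a::ring \<Rightarrow> 'a"
    and act :: "'h \<Rightarrow> 'a \<Rightarrow> 'a" and Basis :: "'a set"
    and q :: nat and AA :: "nat \<Rightarrow> 'a set" +
  fixes EE :: "nat \<Rightarrow> 'a set"
  assumes adapted: "adapted_basis EE"
begin

definition E where "E = (\<Union>k\<le>q. EE k)"

definition coord :: "'a \<Rightarrow> 'a \<Rightarrow> 'f" where
  "coord e x = A.representation E x e"

lemma E_basis: "A.independent E" "A.span E = UNIV" "finite E"
  using adapted A.finiteI_independent by (auto simp: adapted_basis_def E_def)

lemma EE_E: "k \<le> q \<Longrightarrow> EE k \<subseteq> E"
  by (auto simp: E_def)

lemma EE_disjoint: "j \<le> q \<Longrightarrow> k \<le> q \<Longrightarrow> j \<noteq> k \<Longrightarrow> EE j \<inter> EE k = {}"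
  using adapted unfolding adapted_basis_def by blast

lemma EE_Q: "k \<le> q \<Longrightarrow> EE k \<subseteq> Q k"
  using adapted by (auto simp: adapted_basis_def)

lemma finite_EE: "k \<le> q \<Longrightarrow> finite (EE k)"
  using finite_subset[OF EE_E E_basis(3)] .

lemma coord_linear: "Vector_Spaces.linear scaleA (*) (coord e)"
  unfolding coord_def
  by unfold_locales
    (use E_basis in \<open>simp_all add: A.representation_add A.representation_scale ring_distribs\<close>)

lemma coord_basis: "e \<in> E \<Longrightarrow> coord e' e = (if e' = e then 1 else 0)"
  using E_basis by (auto simp: coord_def A.representation_basis)

lemma coord_sum: "(\<Sum>e\<in>E. scaleA (coord e x) e) = x"
  unfolding coord_def using A.sum_representation_eq[OF E_basis(1), of x E] E_basis by simp

lemma coord_eq_0: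
  assumes "x \<in> A.span B" "B \<subseteq> E" "e \<notin> B"
  shows "coord e x = 0"
proof -
  have "A.representation E x = A.representation B x"
    using assms E_basis by (intro A.representation_extend) auto
  then show ?thesis using A.representation_ne_zero[of B x e] assms(3) by (auto simp: coord_def)
qed

lemma coord_J: "x \<in> A.J \<Longrightarrow> e \<notin> EE q \<Longrightarrow> coord e x = 0"
  using adapted by (intro coord_eq_0[of x "EE q"] EE_E) (auto simp: adapted_basis_def)

lemma coord_AA: "i < q \<Longrightarrow> x \<in> AA i \<Longrightarrow> e \<notin> EE i \<Longrightarrow> e \<notin> EE q \<Longrightarrow> coord e x = 0"
  using adapted EE_E[of i] EE_E[of q] by (intro coord_eq_0[of x "EE i \<union> EE q"]) (auto simp: adapted_basis_def)

lemma EE_AA: "i < q \<Longrightarrow> EE i \<subseteq> AA i"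
  using EE_Q[of i] II_props(2)[of i] by (auto simp: Q_def)

lemma EE_J: "EE q \<subseteq> A.J"
  using EE_Q[of q] by (auto simp: Q_def)

text \<open>The span of \<open>EE i\<close> serves as a model of the vector space
  \<open>AA i / J\<close>; on \<open>AA i\<close> the map \<open>proj i\<close> is reduction modulo
  \<open>J\<close>.\<close>

definition proj :: "nat \<Rightarrow> 'a \<Rightarrow> 'a" where
  "proj i x = (\<Sum>e\<in>EE i. scaleA (coord e x) e)"

lemma proj_linear: "Vector_Spaces.linear scaleA scaleA (proj i)"
proof -
  interpret c: Vector_Spaces.linear scaleA "(*)" "coord e" for e by (rule coord_linear)
  show ?thesis
    unfolding linearA_iff proj_def
    by (simp add: c.add c.scale A.scale_left_distrib sum.distrib A.scale_sum_right)
qed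

lemma proj_span: "proj i x \<in> A.span (EE i)"
  unfolding proj_def by (intro A.span_sum A.span_scale A.span_base)

lemma AA_minus_proj:
  assumes i: "i < q" and x: "x \<in> AA i"
  shows "x - proj i x \<in> A.J"
proof -
  have "x = (\<Sum>e\<in>E. scaleA (coord e x) e)" by (simp add: coord_sum)
  also have "\<dots> = (\<Sum>e\<in>EE i \<union> EE q. scaleA (coord e x) e)"
    using E_basis(3) EE_E[of i] EE_E[of q] i coord_AA[OF i x]
    by (intro sum.mono_neutral_right) auto
  also have "\<dots> = proj i x + (\<Sum>e\<in>EE q. scaleA (coord e x) e)"
    unfolding proj_def using i finite_EE EE_disjoint[of i q] by (intro sum.union_disjoint) auto
  finally have "x - proj i x = (\<Sum>e\<in>EE q. scaleA (coord e x) e)" by (metis add_diff_cancel_left')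
  then show ?thesis
    using EE_J A.subspace_sum[OF A.subspace_J] A.subspace_scale[OF A.subspace_J] by (metis (no_types, lifting) subsetD)
qed

lemma span_EE_AA: "i < q \<Longrightarrow> A.span (EE i) \<subseteq> AA i"
  using EE_AA AA_subspace by (intro A.span_minimal)

lemma span_EE_J:
  assumes i: "i < q" and x: "x \<in> A.span (EE i)" "x \<in> A.J"
  shows "x = 0"
proof -
  have "coord e x = 0" if "e \<in> E" for e
  proof (cases "e \<in> EE i")
    case True
    then show ?thesis using coord_J[OF x(2)] EE_disjoint[of i q] i by auto
  next
    case False
    then show ?thesis using coord_eq_0[OF x(1)] EE_E[of i] i by auto
  qed
  then show ?thesis using coord_sum[of x] by simp
qed

lemma EE_nonempty:
  assumes i: "i < q"
  shows "EE i \<noteq> {}"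
proof
  assume "EE i = {}"
  then have "x \<in> A.J" if "x \<in> AA i" for x using AA_minus_proj[OF i that] by (simp add: proj_def)
  then show False using AA_nontriv[OF i] A.J_left by blast
qed

lemma coord_proj: "i < q \<Longrightarrow> e \<in> EE i \<Longrightarrow> coord e (proj i x) = coord e x"
proof -
  assume i: "i < q" and e: "e \<in> EE i"
  interpret c: Vector_Spaces.linear scaleA "(*)" "coord e" by (rule coord_linear)
  have "coord e (proj i x) = (\<Sum>e'\<in>EE i. coord e' x * coord e e')"
    by (simp add: proj_def c.sum c.scale)
  also have "\<dots> = (\<Sum>e'\<in>EE i. if e = e' then coord e' x else 0)"
    using EE_E[of i] i by (intro sum.cong) (auto simp: coord_basis)
  also have "\<dots> = coord e x" using e finite_EE[of i] i by simp
  finally show ?thesis .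
qed

text \<open>Compressed by \<open>proj i\<close>, the operators in \<open>Mop\<close> act on the span
  of \<open>EE i\<close>. They are transitive there by \<open>Mop_transitive\<close>, and closed
  under composition because \<open>proj i\<close> changes elements of \<open>AA i\<close> only by
  elements of \<open>J\<close>, which all operators preserve. The minimal rank argument then
  applies.\<close>

lemma rank_one_operator:
  assumes i: "i < q"
  obtains T y \<phi> where "Mop T" "y \<in> AA i" "y \<notin> A.J" "Vector_Spaces.linear scaleA (*) \<phi>"
    "\<And>x. x \<in> AA i \<Longrightarrow> T x - scaleA (\<phi> x) y \<in> A.J" "\<And>x. x \<in> A.J \<Longrightarrow> \<phi> x = 0"
    "\<exists>x\<in>AA i. \<phi> x \<noteq> 0"
proof -
  define V where "V = A.span (EE i)"
  define \<A> where "\<A> = {(\<lambda>x. proj i (T x)) | T. Mop T}"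
  interpret \<pi>: Vector_Spaces.linear scaleA scaleA "proj i" by (rule proj_linear)
  have proj_J: "proj i x = 0" if "x \<in> A.J" for x
  proof -
    have "coord e x = 0" if "e \<in> EE i" for e
      using coord_J[OF \<open>x \<in> A.J\<close>] EE_disjoint[of i q] i that by auto
    then show ?thesis by (simp add: proj_def)
  qed
  have proj_V: "proj i x = x" if "x \<in> V" for x
  proof -
    have "x - proj i x \<in> A.span (EE i)" using that proj_span by (auto simp: V_def intro: A.span_diff)
    moreover have "x - proj i x \<in> A.J" using AA_minus_proj[OF i] span_EE_AA[OF i] that by (auto simp: V_def)
    ultimately show ?thesis using span_EE_J[OF i] by fastforce
  qed
  have VA: "V \<subseteq> AA i" using span_EE_AA[OF i] by (simp add: V_def)
  have MA: "T x \<in> AA i" if "Mop T" "x \<in> AA i" for T x using H_ideal_Mop H_ideal_AA[OF i] that by blast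
  obtain v where v: "v \<in> EE i" using EE_nonempty[OF i] by auto
  have v0: "v \<noteq> 0" using v EE_E[of i] i E_basis(1) A.dependent_zero[of E] by auto
  have vV: "v \<in> V" using v by (simp add: V_def A.span_base)
  have "\<exists>T\<in>\<A>. \<exists>y\<in>V. y \<noteq> 0 \<and> T ` V = A.span {y}"
  proof (rule transitive_operators_rank_one[OF A.finite_dimensional_vector_space_axioms _ vV v0])
    show "A.subspace V" by (simp add: V_def)
    show "Vector_Spaces.linear scaleA scaleA T" if T: "T \<in> \<A>" for T
    proof -
      obtain T' where T': "T = (\<lambda>x. proj i (T' x))" "Mop T'" using T by (auto simp: \<A>_def)
      interpret T': Vector_Spaces.linear scaleA scaleA T' by (rule Mop_linear) (fact T'(2))
      show ?thesis unfolding T'(1) linearA_iff by (simp add: T'.add T'.scale \<pi>.add \<pi>.scale)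
    qed
    show "T x \<in> V" if "T \<in> \<A>" "x \<in> V" for T x using that proj_span by (auto simp: \<A>_def V_def)
    show "(\<lambda>x. S x + T x) \<in> \<A>" if ST: "S \<in> \<A>" "T \<in> \<A>" for S T
    proof -
      obtain S' T' where "S = (\<lambda>x. proj i (S' x))" "T = (\<lambda>x. proj i (T' x))" "Mop S'" "Mop T'"
        using ST by (auto simp: \<A>_def)
      then show ?thesis unfolding \<A>_def
        by (intro CollectI exI[of _ "\<lambda>x. S' x + T' x"]) (simp add: \<pi>.add Mop.add)
    qed
    show "(\<lambda>x. scaleA c (T x)) \<in> \<A>" if T: "T \<in> \<A>" for c T
    proof -
      obtain T' where "T = (\<lambda>x. proj i (T' x))" "Mop T'" using T by (auto simp: \<A>_def)
      then show ?thesis unfolding \<A>_def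
        by (intro CollectI exI[of _ "\<lambda>x. scaleA c (T' x)"]) (simp add: \<pi>.scale Mop.scale)
    qed
    show "\<exists>R\<in>\<A>. \<forall>x\<in>V. R x = S (T x)" if ST: "S \<in> \<A>" "T \<in> \<A>" for S T
    proof -
      obtain S' T' where S': "S = (\<lambda>x. proj i (S' x))" "T = (\<lambda>x. proj i (T' x))" "Mop S'" "Mop T'"
        using ST by (auto simp: \<A>_def)
      interpret S': Vector_Spaces.linear scaleA scaleA S' by (rule Mop_linear) (fact S'(3))
      have "proj i (S' (T' x)) = S (T x)" if "x \<in> V" for x
      proof -
        have "T' x - proj i (T' x) \<in> A.J" using that VA MA[OF S'(4)] AA_minus_proj[OF i] by blast
        then have "S' (T' x) - S' (proj i (T' x)) \<in> A.J"
          using H_ideal_Mop[OF S'(3) H_ideal_J] S'.diff by metis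
        then have "proj i (S' (T' x)) - proj i (S' (proj i (T' x))) = 0"
          using proj_J \<pi>.diff by metis
        then show ?thesis by (simp add: S'(1,2))
      qed
      moreover have "(\<lambda>x. proj i (S' (T' x))) \<in> \<A>" using Mop_comp[OF S'(3,4)] by (auto simp: \<A>_def)
      ultimately show ?thesis by (intro bexI[of _ "\<lambda>x. proj i (S' (T' x))"]) auto
    qed
    show "\<exists>T\<in>\<A>. T x = y" if xy: "x \<in> V" "x \<noteq> 0" "y \<in> V" for x y
    proof -
      have "x \<notin> A.J" using span_EE_J[OF i] xy by (auto simp: V_def)
      then obtain T where T: "Mop T" "T x - y \<in> A.J" using Mop_transitive[OF i] xy VA by blast
      then have "proj i (T x) = y" using proj_J[OF T(2)] \<pi>.diff[of "T x" y] proj_V[OF xy(3)] by simp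
      then show ?thesis using T(1) by (intro bexI[of _ "\<lambda>x. proj i (T x)"]) (auto simp: \<A>_def)
    qed
  qed
  then obtain T y where T: "Mop T" and y: "y \<in> V" "y \<noteq> 0" and im: "(\<lambda>x. proj i (T x)) ` V = A.span {y}"
    by (auto simp: \<A>_def)
  have "y \<notin> A.J" using span_EE_J[OF i] y by (auto simp: V_def)
  have "\<exists>e\<in>EE i. coord e y \<noteq> 0"
  proof (rule ccontr)
    assume "\<not> ?thesis"
    then have "proj i y = 0" by (simp add: proj_def)
    then show False using proj_V y by simp
  qed
  then obtain e where e: "e \<in> EE i" "coord e y \<noteq> 0" by auto
  interpret T: Vector_Spaces.linear scaleA scaleA T by (rule Mop_linear) (fact T)
  interpret c: Vector_Spaces.linear scaleA "(*)" "coord e" by (rule coord_linear)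
  \<comment> \<open>A coordinate \<open>e\<close> that is nonzero at \<open>y\<close> reads off the
    multiple of \<open>y\<close>. As \<open>e\<close> belongs to \<open>EE i\<close>, this
    functional vanishes on \<open>J\<close>.\<close>
  define \<phi> where "\<phi> x = coord e (T x) / coord e y" for x
  have lin: "Vector_Spaces.linear scaleA (*) \<phi>"
    by unfold_locales (simp_all add: \<phi>_def T.add T.scale c.add c.scale add_divide_distrib)
  interpret \<phi>: Vector_Spaces.linear scaleA "(*)" \<phi> by (rule lin)
  have \<phi>J: "\<phi> x = 0" if "x \<in> A.J" for x
    using coord_J[OF H_ideal_Mop[OF T H_ideal_J that], of e] EE_disjoint[of i q] i e by (auto simp: \<phi>_def)
  have \<phi>V: "proj i (T x) = scaleA (\<phi> x) y" if "x \<in> V" for x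
  proof -
    have "proj i (T x) \<in> A.span {y}" using im that by blast
    then obtain c where c: "proj i (T x) = scaleA c y" by (auto simp: A.span_singleton)
    then have "coord e (T x) = c * coord e y" using coord_proj[OF i e(1)] c.scale by metis
    then show ?thesis using c e by (simp add: \<phi>_def)
  qed
  have "T x - scaleA (\<phi> x) y \<in> A.J" if x: "x \<in> AA i" for x
  proof -
    let ?v = "proj i x"
    have v: "?v \<in> V" "x - ?v \<in> A.J" using proj_span AA_minus_proj[OF i x] by (auto simp: V_def)
    have 1: "T x - T ?v \<in> A.J" using H_ideal_Mop[OF T H_ideal_J v(2)] by (simp add: T.diff)
    have 2: "T ?v - scaleA (\<phi> ?v) y \<in> A.J"
      using AA_minus_proj[OF i MA[OF T]] VA v(1) \<phi>V[OF v(1)] by (metis subsetD)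
    have f: "\<phi> x = \<phi> ?v" using \<phi>J[OF v(2)] by (simp add: \<phi>.diff)
    show ?thesis using A.subspace_add[OF A.subspace_J 1 2] unfolding f by simp
  qed
  note approx = this
  have nz: "\<exists>x\<in>AA i. \<phi> x \<noteq> 0"
  proof -
    have "y \<in> (\<lambda>x. proj i (T x)) ` V" unfolding im by (simp add: A.span_base)
    then obtain x where x: "x \<in> V" "proj i (T x) = y" by auto
    then have "scaleA (\<phi> x) y \<noteq> 0" using \<phi>V y by simp
    then show ?thesis using x(1) VA by auto
  qed
  have "y \<in> AA i" using y VA by auto
  then show ?thesis by (rule that[OF T _ \<open>y \<notin> A.J\<close> lin approx \<phi>J nz])
qed

text \<open>Burnside's theorem for the elementary maps: a product of three operators with the rank
  one operator in the middle. \<open>D\<close> turns the functional \<open>\<phi>\<close> into the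
  one dual to \<open>e\<close>, and \<open>C\<close> carries \<open>y\<close> to \<open>c\<close>.
  Dual functionals exist because, by transitivity, the compositions of \<open>\<phi>\<close> with
  operators separate points.\<close>

lemma density:
  assumes i: "i < q" and e: "e \<in> EE i" and c: "c \<in> AA i"
  shows "\<exists>T. Mop T \<and> (\<forall>e'\<in>EE i. T e' - (if e' = e then c else 0) \<in> A.J)"
proof -
  obtain T y \<phi> where T: "Mop T" "y \<in> AA i" "y \<notin> A.J" and lin: "Vector_Spaces.linear scaleA (*) \<phi>"
    and r1: "\<And>x. x \<in> AA i \<Longrightarrow> T x - scaleA (\<phi> x) y \<in> A.J" and \<phi>J: "\<And>x. x \<in> A.J \<Longrightarrow> \<phi> x = 0"
    and nz: "\<exists>x\<in>AA i. \<phi> x \<noteq> 0"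
    using rank_one_operator[OF i] by blast
  interpret \<phi>: Vector_Spaces.linear scaleA "(*)" \<phi> by (rule lin)
  define \<Phi> where "\<Phi> = {(\<lambda>x. \<phi> (D x)) | D. Mop D}"
  have "\<forall>b\<in>EE i. \<exists>\<psi>\<in>\<Phi>. \<forall>b'\<in>EE i. \<psi> b' = (if b' = b then 1 else 0)"
  proof (rule A.dual_functionals_exist)
    show "finite (EE i)" using finite_EE[of i] i by simp
    show "A.independent (EE i)" using A.independent_mono[OF E_basis(1) EE_E[of i]] i by simp
    show "Vector_Spaces.linear scaleA (*) \<psi>" if P: "\<psi> \<in> \<Phi>" for \<psi>
    proof -
      obtain D where D: "Mop D" "\<psi> = (\<lambda>x. \<phi> (D x))" using P by (auto simp: \<Phi>_def)
      interpret D: Vector_Spaces.linear scaleA scaleA D by (rule Mop_linear) (fact D(1))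
      show ?thesis unfolding D(2) by unfold_locales (simp_all add: D.add D.scale \<phi>.add \<phi>.scale)
    qed
    show "(\<lambda>x. \<psi> x + \<psi>' x) \<in> \<Phi>" if P: "\<psi> \<in> \<Phi>" "\<psi>' \<in> \<Phi>" for \<psi> \<psi>'
    proof -
      obtain D D' where "\<psi> = (\<lambda>x. \<phi> (D x))" "Mop D" "\<psi>' = (\<lambda>x. \<phi> (D' x))" "Mop D'"
        using P by (auto simp: \<Phi>_def)
      then show ?thesis unfolding \<Phi>_def
        by (intro CollectI exI[of _ "\<lambda>x. D x + D' x"]) (simp add: \<phi>.add Mop.add)
    qed
    show "(\<lambda>x. k * \<psi> x) \<in> \<Phi>" if P: "\<psi> \<in> \<Phi>" for k \<psi>
    proof -
      obtain D where "\<psi> = (\<lambda>x. \<phi> (D x))" "Mop D" using P by (auto simp: \<Phi>_def)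
      then show ?thesis unfolding \<Phi>_def
        by (intro CollectI exI[of _ "\<lambda>x. scaleA k (D x)"]) (simp add: \<phi>.scale Mop.scale)
    qed
    show "\<exists>\<psi>\<in>\<Phi>. \<psi> x \<noteq> 0" if x: "x \<in> A.span (EE i)" "x \<noteq> 0" for x
    proof -
      obtain z where z: "z \<in> AA i" "\<phi> z \<noteq> 0" using nz by auto
      have "x \<in> AA i" "x \<notin> A.J" using span_EE_AA[OF i] span_EE_J[OF i] x by auto
      then obtain D where D: "Mop D" "D x - z \<in> A.J" using Mop_transitive[OF i] z by blast
      then have "\<phi> (D x) = \<phi> z" using \<phi>J[OF D(2)] by (simp add: \<phi>.diff)
      then show ?thesis using z D by (intro bexI[of _ "\<lambda>x. \<phi> (D x)"]) (auto simp: \<Phi>_def)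
    qed
  qed
  from bspec[OF this e] obtain \<psi>
    where \<psi>: "\<psi> \<in> \<Phi>" "\<forall>b'\<in>EE i. \<psi> b' = (if b' = e then 1 else 0)" ..
  then obtain D where D: "Mop D" "\<psi> = (\<lambda>x. \<phi> (D x))" by (auto simp: \<Phi>_def)
  obtain C where C: "Mop C" "C y - c \<in> A.J" using Mop_transitive[OF i T(2,3) c] by auto
  interpret C: Vector_Spaces.linear scaleA scaleA C by (rule Mop_linear) (fact C(1))
  have "C (T (D e')) - (if e' = e then c else 0) \<in> A.J" if e': "e' \<in> EE i" for e'
  proof -
    have "D e' \<in> AA i" using H_ideal_Mop[OF D(1) H_ideal_AA[OF i]] EE_AA[OF i] e' by blast
    then have "T (D e') - scaleA (if e' = e then 1 else 0) y \<in> A.J"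
      using r1[of "D e'"] \<psi>(2) e' unfolding D(2) by simp
    then have 1: "C (T (D e')) - scaleA (if e' = e then 1 else 0) (C y) \<in> A.J"
      using H_ideal_Mop[OF C(1) H_ideal_J] C.diff C.scale by metis
    show ?thesis
    proof (cases "e' = e")
      case True
      have "C (T (D e')) - c = (C (T (D e')) - C y) + (C y - c)" by simp
      then show ?thesis using True 1 C(2) A.subspace_add[OF A.subspace_J] by fastforce
    next
      case False
      then show ?thesis using 1 by simp
    qed
  qed
  moreover have "Mop (\<lambda>x. C (T (D x)))" by (rule Mop_comp[OF C(1) Mop_comp[OF T(1) D(1)]])
  ultimately show ?thesis by (intro exI[of _ "\<lambda>x. C (T (D x))"]) auto
qed

end

section \<open>An alternating function with constants\<close>

lemma map_upt_split:
  assumes "k < n"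
  shows "map g [0..<n] = map g [0..<k] @ g k # map g [Suc k..<n]"
proof -
  have "[0..<n] = [0..<k] @ [k..<n]" using upt_add_eq_append[of 0 k "n - k"] assms by simp
  also have "[k..<n] = k # [Suc k..<n]" using assms by (rule upt_conv_Cons)
  finally show ?thesis by simp
qed

context H_decomposition
begin

text \<open>Idempotence makes room: one factor of a nonzero product can be expanded into as many
  factors from \<open>II i\<close> as there are constants and variables to be placed.\<close>

lemma II_powers:
  assumes i: "i < q"
  shows "II i \<subseteq> A.span {lprod ws | ws. length ws = Suc n \<and> set ws \<subseteq> II i}"
proof (induction n)
  case 0
  show ?case
  proof
    fix z assume "z \<in> II i"
    then have "z \<in> {lprod ws | ws. length ws = Suc 0 \<and> set ws \<subseteq> II i}"
      by (intro CollectI exI[of _ "[z]"]) simp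
    then show "z \<in> A.span {lprod ws | ws. length ws = Suc 0 \<and> set ws \<subseteq> II i}" by (rule A.span_base)
  qed
next
  case (Suc n)
  let ?W = "\<lambda>n. {lprod ws | ws. length ws = n \<and> set ws \<subseteq> II i}"
  have "x * y \<in> A.span (?W (Suc (Suc n)))" if x: "x \<in> II i" and y: "y \<in> II i" for x y
  proof (rule A.span_products[of x "{x}" y "?W (Suc n)"])
    show "x \<in> A.span {x}" by (simp add: A.span_base)
    show "y \<in> A.span (?W (Suc n))" using y Suc by auto
    fix u v assume u: "u \<in> {x}" and "v \<in> ?W (Suc n)"
    then obtain ws where ws: "v = lprod ws" "length ws = Suc n" "set ws \<subseteq> II i" by auto
    then have "u * v = lprod (x # ws)" using u by (subst lprod_Cons) auto
    then have "u * v \<in> ?W (Suc (Suc n))" using ws x by (intro CollectI exI[of _ "x # ws"]) auto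
    then show "u * v \<in> A.span (?W (Suc (Suc n)))" by (rule A.span_base)
  qed simp
  then have "A.span {x * y | x y. x \<in> II i \<and> y \<in> II i} \<subseteq> A.span (?W (Suc (Suc n)))"
    by (intro A.span_minimal) auto
  then show ?case using II_props(4)[OF i] by simp
qed

end

lemma (in generalized_action) CP_const_mult2:
  assumes "CP N X g"
  shows "\<exists>M. CP M X (\<lambda>\<psi>. a * (a' * g \<psi>))"
proof -
  have "CP (Suc 0 + (Suc 0 + N)) ({} \<union> ({} \<union> X)) (\<lambda>\<psi>. a * (a' * g \<psi>))"
    by (rule CP.mult[OF CP.const CP.mult[OF CP.const assms]]) auto
  then show ?thesis by auto
qed

lemma map_of_zip_fun:
  assumes "distinct xs" "length cs = length xs"
  shows "map (\<lambda>x. the (map_of (zip xs cs) x)) xs = cs"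
  by (rule nth_equalityI) (use assms in \<open>simp_all add: map_of_zip_nth[OF assms(2)[symmetric] assms(1)]\<close>)

text \<open>\<open>b\<close> enumerates the basis elements with labels in \<open>S\<close>, so
  \<open>d\<close> is the dimension of the part of \<open>A / J\<close> that belongs to
  \<open>S\<close>; \<open>bl k\<close> is the label of \<open>b k\<close>.\<close>

locale H_frame = H_decomposition_ac scaleH scaleA act Basis q AA EE
  for scaleH :: "'f::{alg_closed_field, field_char_0} \<Rightarrow> 'h::{ring, monoid_mult} \<Rightarrow> 'h"
    and scaleA :: "'f \<Rightarrow> 'a::ring \<Rightarrow> 'a"
    and act :: "'h \<Rightarrow> 'a \<Rightarrow> 'a" and Basis :: "'a set"
    and q :: nat and AA EE :: "nat \<Rightarrow> 'a set" +
  fixes S :: "nat set" and d :: nat and b :: "nat \<Rightarrow> 'a" and bl :: "nat \<Rightarrow> nat"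
  assumes S_admissible: "admissible S" and S_nonempty: "S \<noteq> {}"
    and b_bij: "bij_betw b {..<d} (\<Union>i\<in>S. EE i)"
    and bl_S: "k < d \<Longrightarrow> bl k \<in> S" and b_EE: "k < d \<Longrightarrow> b k \<in> EE (bl k)"
begin

lemma S_sub: "i \<in> S \<Longrightarrow> i < q"
  using S_admissible by (auto simp: admissible_def)

lemma bl_q: "k < d \<Longrightarrow> bl k < q"
  using S_sub bl_S by blast

lemma b_AA: "k < d \<Longrightarrow> b k \<in> AA (bl k)"
  using b_EE EE_AA bl_q by blast

lemma b_E: "k < d \<Longrightarrow> b k \<in> E"
  using b_EE EE_E[of "bl k"] bl_q[of k] by auto

lemma b_inj: "k < d \<Longrightarrow> l < d \<Longrightarrow> b k = b l \<longleftrightarrow> k = l"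
  using b_bij by (auto simp: bij_betw_def inj_on_def)

lemma coord_b: "k < d \<Longrightarrow> l < d \<Longrightarrow> coord (b k) (b l) = (if k = l then 1 else 0)"
  using b_E b_inj by (auto simp: coord_basis)

lemma b_not_EEq: "k < d \<Longrightarrow> b k \<notin> EE q"
  using b_EE[of k] EE_disjoint[of "bl k" q] bl_q[of k] by auto

lemma coord_b_J: "k < d \<Longrightarrow> x \<in> A.J \<Longrightarrow> coord (b k) x = 0"
  using coord_J b_not_EEq by blast

text \<open>The preimage in \<open>A\<close> of the sum of the simple summands with index in
  \<open>S\<close>, expressed by coordinates.\<close>

definition AS :: "'a set" where
  "AS = {x. x - (\<Sum>k<d. scaleA (coord (b k) x) (b k)) \<in> A.J}"

lemma AS_subspace: "A.subspace AS"
proof -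
  interpret c: Vector_Spaces.linear scaleA "(*)" "coord e" for e by (rule coord_linear)
  interpret l: Vector_Spaces.linear scaleA scaleA "\<lambda>x. x - (\<Sum>k<d. scaleA (coord (b k) x) (b k))"
    unfolding linearA_iff
    by (simp add: c.add c.scale A.scale_left_distrib sum.distrib A.scale_right_diff_distrib A.scale_sum_right)
  show ?thesis unfolding AS_def by (rule l.subspace_linear_preimage[OF A.subspace_J])
qed

lemma J_AS: "A.J \<subseteq> AS"
  by (auto simp: AS_def coord_b_J)

lemma b_AS: "k < d \<Longrightarrow> b k \<in> AS"
proof -
  assume k: "k < d"
  have "(\<Sum>l<d. scaleA (coord (b l) (b k)) (b l)) = (\<Sum>l<d. if l = k then b k else 0)"
    using k by (intro sum.cong) (auto simp: coord_b)
  then show ?thesis using k A.subspace_0[OF A.subspace_J] by (simp add: AS_def)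
qed

lemma AA_AS:
  assumes i: "i \<in> S"
  shows "AA i \<subseteq> AS"
proof
  fix x assume x: "x \<in> AA i"
  have "EE i \<subseteq> AS"
  proof
    fix e assume "e \<in> EE i"
    then obtain k where "k < d" "e = b k" using b_bij i unfolding bij_betw_def by blast
    then show "e \<in> AS" using b_AS by simp
  qed
  then have "A.span (EE i) \<subseteq> AS" using AS_subspace by (intro A.span_minimal)
  then have "proj i x \<in> AS" using proj_span by auto
  moreover have "x - proj i x \<in> AS" using AA_minus_proj[OF S_sub[OF i] x] J_AS by auto
  ultimately have "(x - proj i x) + proj i x \<in> AS" by (intro A.subspace_add[OF AS_subspace]) auto
  then show "x \<in> AS" by simp
qed

lemma AS_left: "x \<in> AS \<Longrightarrow> a * x \<in> AS"
proof -
  assume x: "x \<in> AS"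
  have "a * b k \<in> AS" if "k < d" for k
    using AA_AS[OF bl_S[OF that]] AA_left[OF bl_q[OF that] b_AA[OF that]] by auto
  then have "(\<Sum>k<d. scaleA (coord (b k) x) (a * b k)) \<in> AS"
    by (intro A.subspace_sum[OF AS_subspace] A.subspace_scale[OF AS_subspace]) auto
  moreover have "a * (x - (\<Sum>k<d. scaleA (coord (b k) x) (b k))) \<in> AS"
    using x J_AS A.J_left by (auto simp: AS_def)
  ultimately have "a * (x - (\<Sum>k<d. scaleA (coord (b k) x) (b k))) + (\<Sum>k<d. scaleA (coord (b k) x) (a * b k)) \<in> AS"
    by (intro A.subspace_add[OF AS_subspace])
  then show ?thesis by (simp add: right_diff_distrib sum_distrib_left A.scale_mult_right)
qed

text \<open>The type \<open>l\<close> of a nonzero product is chosen with the maximal number of radical factors.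
  Expanding one factor from each \<open>II i\<close> with \<open>i \<in> S\<close> into a long product leaves room for the
  variables; a bad value of a variable would create one more radical factor.\<close>

lemma skeleton_exists:
  obtains \<Theta> :: "(nat \<Rightarrow> 'a) \<Rightarrow> 'a" and c where
    "\<And>T. (\<And>k. k < d \<Longrightarrow> Mon (T k)) \<Longrightarrow> \<exists>N. CP N {..<d} (\<lambda>\<psi>. \<Theta> (\<lambda>k. T k (\<psi> k)))"
    "\<And>y k. k < d \<Longrightarrow> y k \<in> A.J \<Longrightarrow> \<Theta> y = 0"
    "\<And>y k i. k < d \<Longrightarrow> i < q \<Longrightarrow> i \<noteq> bl k \<Longrightarrow> y k \<in> AA i \<Longrightarrow> \<Theta> y = 0"
    "\<And>k. k < d \<Longrightarrow> c k \<in> AA (bl k)" "\<Theta> c \<noteq> 0"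
proof -
  define cq where "cq l = length (filter (\<lambda>k. k = q) l)" for l
  let ?P = "\<lambda>l. set l \<subseteq> {..q} \<and> S \<subseteq> set l \<and> nonzero_type l"
  obtain l0 where l0: "?P l0" using S_admissible S_nonempty by (auto simp: admissible_def)
  obtain p where p: "\<And>l. set l \<subseteq> {..q} \<Longrightarrow> nonzero_type l \<Longrightarrow> cq l < p"
    using nonzero_type_radical_bound unfolding cq_def by blast
  obtain l where l: "?P l" and max: "\<And>l'. ?P l' \<Longrightarrow> cq l' \<le> cq l"
    using ex_has_greatest_nat[of ?P l0 cq p] l0 p by blast
  obtain zs where zs: "list_all2 (\<lambda>k z. z \<in> Q k) l zs" "lprod zs \<noteq> 0"
    using l by (auto simp: nonzero_type_def)
  define len where "len = length l"
  have lzs: "length zs = len" using zs(1) by (simp add: list_all2_lengthD len_def)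
  have zsQ: "zs ! k \<in> Q (l ! k)" if "k < len" for k
    using list_all2_nthD[OF zs(1)] that by (simp add: len_def)
  \<comment> \<open>For each label in \<open>S\<close> one occurrence in \<open>l\<close>, the
    first, is singled out to receive the variables with that label.\<close>
  define pos where "pos i = (LEAST k. k < len \<and> l ! k = i)" for i
  define active where "active k \<longleftrightarrow> k < len \<and> l ! k \<in> S \<and> pos (l ! k) = k" for k
  have pos: "pos i < len" "l ! pos i = i" "active (pos i)" if i: "i \<in> S" for i
  proof -
    have "\<exists>k. k < len \<and> l ! k = i" using l i by (auto simp: in_set_conv_nth len_def subset_iff)
    then have "pos i < len \<and> l ! pos i = i" unfolding pos_def by (rule LeastI_ex)
    then show "pos i < len" "l ! pos i = i" "active (pos i)" using i by (auto simp: active_def)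
  qed
  define idx where "idx i = filter (\<lambda>j. bl j = i) [0..<d]" for i
  have idx_set: "set (idx i) = {j. j < d \<and> bl j = i}" for i by (auto simp: idx_def)
  have idx_ne: "idx i \<noteq> []" if i: "i \<in> S" for i
  proof -
    obtain e where e: "e \<in> EE i" using EE_nonempty[OF S_sub[OF i]] by auto
    then obtain k where k: "k < d" "e = b k" using b_bij i unfolding bij_betw_def by blast
    have "bl k = i"
      using EE_disjoint[of "bl k" i] b_EE[OF k(1)] bl_q[OF k(1)] S_sub[OF i] e k(2) by (metis disjoint_iff less_imp_le)
    then have "k \<in> set (idx i)" using k by (simp add: idx_set)
    then show ?thesis by auto
  qed
  define \<Phi> where "\<Phi> T = lprod (map (\<lambda>k. lprod (T k)) [0..<len])" for T :: "nat \<Rightarrow> 'a list"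
  define R where "R k t \<longleftrightarrow> (\<exists>z\<in>Q (l ! k). t = [z])" for k and t :: "'a list"
  \<comment> \<open>An active factor becomes two constants followed by one place per variable.
    Because of the second constant, a bad value of a variable makes the tail of the factor radical;
    the first constant keeps the label in the type, so that \<open>S\<close> is still covered after
    the tail has turned radical.\<close>
  define P where "P k t \<longleftrightarrow> (if active k then length t = Suc (Suc (length (idx (l ! k)))) \<and> set t \<subseteq> II (l ! k)
      else R k t)" for k and t :: "'a list"
  have "map (\<lambda>k. lprod [zs ! k]) [0..<len] = zs"
    using map_nth[of zs] lzs by simp
  then have init: "\<Phi> (\<lambda>k. [zs ! k]) \<noteq> 0" using zs(2) by (simp add: \<Phi>_def)
  have "\<exists>T. (\<forall>k<len. P k (T k)) \<and> (\<forall>k\<ge>len. T k = [zs ! k]) \<and> \<Phi> T \<noteq> 0"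
  proof (rule successive_replacement[where R = R and \<Phi> = \<Phi> and T = "\<lambda>k. [zs ! k]", OF _ _ init])
    show "R k [zs ! k]" if "k < len" for k using zsQ[OF that] by (simp add: R_def)
    fix k T assume k: "k < len" and Rk: "R k (T k)" and nz: "\<Phi> T \<noteq> 0"
    show "\<exists>t. P k t \<and> \<Phi> (T(k := t)) \<noteq> 0"
    proof (cases "active k")
      case False
      then show ?thesis using Rk nz by (intro exI[of _ "T k"]) (simp add: P_def)
    next
      case True
      then have i: "l ! k \<in> S" by (simp add: active_def)
      obtain z where z: "z \<in> II (l ! k)" "T k = [z]" using Rk S_sub[OF i] by (auto simp: R_def Q_def)
      define f where "f u = lprod (map (\<lambda>k. lprod (T k)) [0..<k] @ u # map (\<lambda>k. lprod (T k)) [Suc k..<len])" for u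
      interpret f: Vector_Spaces.linear scaleA scaleA f unfolding f_def by (rule linear_lprod)
      have f: "\<Phi> (T(k := t)) = f (lprod t)" for t
        unfolding \<Phi>_def f_def map_upt_split[OF k] by (intro arg_cong[of _ _ lprod]) auto
      have "f z \<noteq> 0" using nz f[of "T k", unfolded fun_upd_triv] z(2) by simp
      then obtain ws where "length ws = Suc (Suc (length (idx (l ! k))))" "set ws \<subseteq> II (l ! k)" "f (lprod ws) \<noteq> 0"
        using II_powers[OF S_sub[OF i], of "Suc (length (idx (l ! k)))"] z(1)
          f.eq_0_on_span[of "{lprod ws | ws. length ws = Suc (Suc (length (idx (l ! k)))) \<and> set ws \<subseteq> II (l ! k)}" z]
        by auto
      then show ?thesis using True f by (intro exI[of _ ws]) (simp add: P_def)
    qed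
  qed
  then obtain T where T: "\<And>k. k < len \<Longrightarrow> P k (T k)" and nz: "\<Phi> T \<noteq> 0" by blast
  define z1 where "z1 k = T k ! 0" for k
  define z2 where "z2 k = T k ! 1" for k
  define cs where "cs k = drop 2 (T k)" for k
  have Tk: "T k = z1 k # z2 k # cs k" "length (cs k) = length (idx (l ! k))" "z1 k \<in> II (l ! k)"
    "z2 k \<in> II (l ! k)" "set (cs k) \<subseteq> II (l ! k)" if k: "active k" for k
  proof -
    have k': "k < len" using k by (simp add: active_def)
    then have P: "length (T k) = Suc (Suc (length (idx (l ! k))))" "set (T k) \<subseteq> II (l ! k)"
      using T[OF k'] k by (auto simp: P_def)
    then obtain u v ws where uv: "T k = u # v # ws" by (auto simp: length_Suc_conv)
    then show "T k = z1 k # z2 k # cs k" "length (cs k) = length (idx (l ! k))" "z1 k \<in> II (l ! k)"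
      "z2 k \<in> II (l ! k)" "set (cs k) \<subseteq> II (l ! k)"
      using P by (auto simp: z1_def z2_def cs_def)
  qed
  define item where "item y k = (if active k then z1 k * (z2 k * lprod (map y (idx (l ! k)))) else lprod (T k))"
    for y :: "nat \<Rightarrow> 'a" and k
  define \<Theta> where "\<Theta> y = lprod (map (item y) [0..<len])" for y
  \<comment> \<open>The value of variable \<open>j\<close> is the element that occupied its place in
    the expanded nonzero product, so that \<open>\<Theta> c\<close> is this product.\<close>
  define c where "c j = the (map_of (zip (idx (bl j)) (cs (pos (bl j)))) j)" for j
  have map_c: "map c (idx i) = cs (pos i)" if i: "i \<in> S" for i
  proof -
    have "map c (idx i) = map (\<lambda>j. the (map_of (zip (idx i) (cs (pos i))) j)) (idx i)"
      by (rule map_cong[OF refl]) (simp add: c_def idx_set)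
    also have "\<dots> = cs (pos i)"
      using Tk(2)[OF pos(3)[OF i]] pos(2)[OF i] by (intro map_of_zip_fun) (auto simp: idx_def)
    finally show ?thesis .
  qed
  have "c k \<in> AA (bl k)" if k: "k < d" for k
  proof -
    have "k \<in> set (idx (bl k))" using k by (simp add: idx_set)
    then have "c k \<in> set (map c (idx (bl k)))" by simp
    then have "c k \<in> set (cs (pos (bl k)))" unfolding map_c[OF bl_S[OF k]] .
    then show ?thesis
      using Tk(5)[OF pos(3)[OF bl_S[OF k]]] pos(2)[OF bl_S[OF k]] II_props(2)[OF bl_q[OF k]] by auto
  qed
  moreover have "\<Theta> c \<noteq> 0"
  proof -
    have "item c k = lprod (T k)" for k
    proof (cases "active k")
      case True
      then have i: "l ! k \<in> S" "pos (l ! k) = k" by (auto simp: active_def)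
      then have m: "map c (idx (l ! k)) = cs k" using map_c[OF i(1)] by simp
      then have "cs k \<noteq> []" using idx_ne[OF i(1)] by auto
      then show ?thesis using True by (simp add: item_def m Tk(1) lprod_Cons)
    next
      case False
      then show ?thesis by (simp add: item_def)
    qed
    then have "item c = (\<lambda>k. lprod (T k))" by auto
    then have "\<Theta> c = \<Phi> T" by (simp add: \<Theta>_def \<Phi>_def)
    then show ?thesis using nz by simp
  qed
  moreover have "\<exists>N. CP N {..<d} (\<lambda>\<psi>. \<Theta> (\<lambda>k. T' k (\<psi> k)))" if T': "\<And>k. k < d \<Longrightarrow> Mon (T' k)" for T'
  proof -
    define X where "X k = (if active k then set (idx (l ! k)) else {})" for k
    have item: "\<exists>N. CP N (X k) (\<lambda>\<psi>. item (\<lambda>j. T' j (\<psi> j)) k)" for k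
    proof (cases "active k")
      case True
      then have i: "l ! k \<in> S" by (simp add: active_def)
      have "\<exists>N. CP N (\<Union>j\<in>set (idx (l ! k)). {j}) (\<lambda>\<psi>. lprod (map (\<lambda>j. T' j (\<psi> j)) (idx (l ! k))))"
      proof (rule CP_lprod[OF idx_ne[OF i]])
        show "\<exists>N. CP N {j} (\<lambda>\<psi>. T' j (\<psi> j))" if "j \<in> set (idx (l ! k))" for j
          using that by (intro CP_Mon T') (simp add: idx_set)
      qed (auto simp: idx_def)
      then obtain N where "CP N (set (idx (l ! k))) (\<lambda>\<psi>. lprod (map (\<lambda>j. T' j (\<psi> j)) (idx (l ! k))))" by auto
      from CP_const_mult2[OF this, of "z1 k" "z2 k"] show ?thesis using True by (simp add: item_def X_def)
    next
      case False
      then show ?thesis using CP.const by (auto simp: item_def X_def)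
    qed
    have "l \<noteq> []" using l S_nonempty by auto
    then have "[0..<len] \<noteq> []" by (simp add: len_def)
    then have "\<exists>N. CP N (\<Union>k\<in>set [0..<len]. X k) (\<lambda>\<psi>. lprod (map (\<lambda>k. item (\<lambda>j. T' j (\<psi> j)) k) [0..<len]))"
    proof (rule CP_lprod)
      show "X j \<inter> X k = {}" if "j \<noteq> k" for j k
        using that by (auto simp: X_def idx_set active_def)
    qed (use item in auto)
    moreover have "(\<Union>k\<in>set [0..<len]. X k) = {..<d}"
    proof
      show "(\<Union>k\<in>set [0..<len]. X k) \<subseteq> {..<d}" by (auto simp: X_def idx_set split: if_splits)
      show "{..<d} \<subseteq> (\<Union>k\<in>set [0..<len]. X k)"
      proof
        fix j assume j: "j \<in> {..<d}"
        then have "j \<in> X (pos (bl j))" using pos[OF bl_S[of j]] by (simp add: X_def idx_set)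
        then show "j \<in> (\<Union>k\<in>set [0..<len]. X k)" using pos(1)[OF bl_S[of j]] j by auto
      qed
    qed
    ultimately show ?thesis by (simp add: \<Theta>_def)
  qed
  \<comment> \<open>Both kinds of bad values are treated at once: \<open>I\<close> will be
    \<open>J\<close>, or \<open>AA i\<close> with a label \<open>i\<close> other than
    \<open>bl j\<close>.\<close>
  moreover have vanish: "\<Theta> y = 0"
    if j: "j < d" and y: "y j \<in> I" and I: "H_ideal I" "I \<inter> AA (bl j) \<subseteq> A.J" for y j I
  proof -
    define k where "k = pos (bl j)"
    have k: "k < len" "l ! k = bl j" "active k" using pos[OF bl_S[OF j]] by (auto simp: k_def)
    have "j \<in> set (idx (l ! k))" using k j by (simp add: idx_set)
    moreover have "\<And>xs. y j \<in> set xs \<Longrightarrow> lprod xs \<in> I"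
    proof -
      fix xs show "y j \<in> set xs \<Longrightarrow> lprod xs \<in> I"
      proof (induction xs)
        case (Cons x xs)
        then show ?case using y I(1) by (cases "xs = []") (auto simp: lprod_Cons H_ideal_def)
      qed simp
    qed
    ultimately have "lprod (map y (idx (l ! k))) \<in> I" by simp
    then have "z2 k * lprod (map y (idx (l ! k))) \<in> I \<inter> AA (bl j)"
      using I(1) Tk(4)[OF k(3)] k(2) II_props(2)[OF bl_q[OF j]] AA_right[OF bl_q[OF j]]
      by (auto simp: H_ideal_def)
    then have jJ: "z2 k * lprod (map y (idx (l ! k))) \<in> A.J" using I(2) by auto
    let ?m = "item y"
    have itemQ: "?m k' \<in> Q (l ! k')" if k': "k' < len" for k'
    proof (cases "active k'")
      case True
      then have i: "l ! k' < q" using S_sub by (auto simp: active_def)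
      then show ?thesis using True Tk(3)[OF True] II_props(1)[OF i] by (auto simp: item_def Q_def H_ideal_def)
    next
      case False
      then have "R k' (T k')" using T[OF k'] by (simp add: P_def)
      then show ?thesis using False by (auto simp: item_def R_def)
    qed
    \<comment> \<open>Cutting the active factor behind \<open>z1 k\<close> inserts one more
      \<open>q\<close> into the type; by the maximality of \<open>l\<close> no product of this type
      is nonzero.\<close>
    let ?l' = "map ((!) l) [0..<k] @ [bl j, q] @ map ((!) l) [Suc k..<len]"
    let ?z' = "map ?m [0..<k] @ [z1 k, z2 k * lprod (map y (idx (l ! k)))] @ map ?m [Suc k..<len]"
    have lsplit: "l = map ((!) l) [0..<k] @ bl j # map ((!) l) [Suc k..<len]"
      using map_upt_split[OF k(1), of "(!) l"] map_nth[of l] k(2) by (simp add: len_def)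
    have "list_all2 (\<lambda>k z. z \<in> Q k) ?l' ?z'"
    proof (intro list_all2_appendI)
      show "list_all2 (\<lambda>k z. z \<in> Q k) (map ((!) l) [0..<k]) (map ?m [0..<k])"
        using itemQ k(1) by (auto simp: list_all2_conv_all_nth)
      show "list_all2 (\<lambda>k z. z \<in> Q k) (map ((!) l) [Suc k..<len]) (map ?m [Suc k..<len])"
        using itemQ k(1) by (auto simp: list_all2_conv_all_nth)
      show "list_all2 (\<lambda>k z. z \<in> Q k) [bl j, q] [z1 k, z2 k * lprod (map y (idx (l ! k)))]"
        using jJ Tk(3)[OF k(3)] k(2) bl_q[OF j] by (simp add: Q_def)
    qed
    moreover have "\<not> nonzero_type ?l'"
    proof
      assume nz': "nonzero_type ?l'"
      have set': "set ?l' = insert q (set l)" by (subst (2) lsplit) auto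
      have "set ?l' \<subseteq> {..q}" "S \<subseteq> set ?l'" using l unfolding set' by auto
      then have "cq ?l' \<le> cq l" using nz' by (intro max conjI)
      moreover have "cq ?l' = Suc (cq l)"
      proof -
        have "cq l = cq (map ((!) l) [0..<k] @ bl j # map ((!) l) [Suc k..<len])"
          using lsplit by (rule arg_cong)
        then show ?thesis using bl_q[OF j] by (simp add: cq_def)
      qed
      ultimately show False by simp
    qed
    ultimately have "lprod ?z' = 0" by (auto simp: nonzero_type_def)
    then have "lprod (map ?m [0..<k] @ (z1 k * (z2 k * lprod (map y (idx (l ! k))))) # map ?m [Suc k..<len]) = 0"
      by (simp add: lprod_merge)
    then show ?thesis unfolding \<Theta>_def map_upt_split[OF k(1)] using k(3) by (simp add: item_def)
  qed
  moreover have "\<Theta> y = 0" if "k < d" "y k \<in> A.J" for y k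
    using vanish[of k y A.J] that H_ideal_J by auto
  moreover have "\<Theta> y = 0" if "k < d" "i < q" "i \<noteq> bl k" "y k \<in> AA i" for y k i
    using vanish[of k y "AA i"] that H_ideal_AA AA_inter[of i "bl k"] bl_q by blast
  ultimately show ?thesis by (intro that[of \<Theta> c]) blast+
qed

text \<open>Alternation over the arguments forces the determinant; the task is to keep the sum
  nonzero. Density provides operators for which only the identity permutation survives at
  \<open>b\<close>, and linearity in each operator then permits monomials. All signed terms share
  the constants of these monomials, so that the alternating sum is again a single function with the
  constants as extra variables.\<close>

lemma initial_function:
  obtains N \<kappa> F w where
    "Pfun ((\<lambda>k. (0, 0, k)) ` {..<d} \<union> (\<lambda>j. (1, 0, j)) ` {..<N}) F" "w \<noteq> 0"
    "\<And>\<psi> :: nat \<times> nat \<times> nat \<Rightarrow> 'a. (\<And>k. k < d \<Longrightarrow> \<psi> (0, 0, k) \<in> AS) \<Longrightarrow> (\<And>j. j < N \<Longrightarrow> \<psi> (1, 0, j) = \<kappa> j) \<Longrightarrow>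
      F \<psi> = scaleA (ddet d (\<lambda>k l. coord (b k) (\<psi> (0, 0, l)))) w"
proof -
  obtain \<Theta> and c where CP_\<Theta>: "\<And>T. (\<And>k. k < d \<Longrightarrow> Mon (T k)) \<Longrightarrow> \<exists>N. CP N {..<d} (\<lambda>\<psi>. \<Theta> (\<lambda>k. T k (\<psi> k)))"
    and \<Theta>J: "\<And>y k. k < d \<Longrightarrow> y k \<in> A.J \<Longrightarrow> \<Theta> y = 0"
    and \<Theta>A: "\<And>y k i. k < d \<Longrightarrow> i < q \<Longrightarrow> i \<noteq> bl k \<Longrightarrow> y k \<in> AA i \<Longrightarrow> \<Theta> y = 0"
    and c: "\<And>k. k < d \<Longrightarrow> c k \<in> AA (bl k)" and \<Theta>c: "\<Theta> c \<noteq> 0"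
    using skeleton_exists by blast
  obtain N0 where N0: "CP N0 {..<d} \<Theta>" using CP_\<Theta>[of "\<lambda>_ x. x"] Mon.ident by auto
  have \<Theta>_lin: "Vector_Spaces.linear scaleA scaleA (\<lambda>u. \<Theta> (y(k := u)))" if "k < d" for y k
    using CP_linear[OF N0] that by auto
  have \<Theta>_mod: "\<Theta> y = \<Theta> y'" if "\<And>k. k < d \<Longrightarrow> y k - y' k \<in> A.J" for y y'
  proof -
    have "\<Theta> (\<lambda>k. if k < n then y' k else y k) = \<Theta> y" if "n \<le> d" for n
      using that
    proof (induction n)
      case (Suc n)
      define v where "v = (\<lambda>k. if k < n then y' k else y k)"
      interpret l: Vector_Spaces.linear scaleA scaleA "\<lambda>u. \<Theta> (v(n := u))"
        using \<Theta>_lin Suc.prems by auto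
      have "\<Theta> (v(n := y n)) = \<Theta> (v(n := y' n)) + \<Theta> (v(n := y n - y' n))"
        using l.add[of "y' n" "y n - y' n"] by simp
      moreover have "\<Theta> (v(n := y n - y' n)) = 0"
        using \<Theta>J[of n "v(n := y n - y' n)"] Suc.prems \<open>\<And>k. k < d \<Longrightarrow> y k - y' k \<in> A.J\<close>[of n] by simp
      moreover have "v(n := y n) = v" by (auto simp: v_def)
      moreover have "v(n := y' n) = (\<lambda>k. if k < Suc n then y' k else y k)"
        by (auto simp: v_def less_Suc_eq)
      ultimately show ?case using Suc by (simp add: v_def)
    qed simp
    from this[of d] have "\<Theta> (\<lambda>k. if k < d then y' k else y k) = \<Theta> y" by simp
    moreover have "\<Theta> (\<lambda>k. if k < d then y' k else y k) = \<Theta> y'" by (rule CP_cong[OF N0]) auto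
    ultimately show ?thesis by simp
  qed
  define \<Phi> where "\<Phi> T = (\<Sum>\<sigma> | \<sigma> permutes {..<d}. scaleA (of_int (sign \<sigma>)) (\<Theta> (\<lambda>k. T k (b (\<sigma> k)))))" for T
  have "\<forall>k\<in>{..<d}. \<exists>T. Mop T \<and> (\<forall>e'\<in>EE (bl k). T e' - (if e' = b k then c k else 0) \<in> A.J)"
    using density[OF bl_q b_EE c] by auto
  from bchoice[OF this] obtain T0 where T0: "\<forall>k\<in>{..<d}. Mop (T0 k) \<and>
      (\<forall>e'\<in>EE (bl k). T0 k e' - (if e' = b k then c k else 0) \<in> A.J)" ..
  \<comment> \<open>At a moved index \<open>k\<close> the argument is either another basis element
    with the same label, which \<open>T0 k\<close> sends into \<open>J\<close>, or one with a
    different label, whose ideal \<open>T0 k\<close> preserves. \<open>\<Theta>\<close> vanishes in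
    both cases.\<close>
  have "\<Theta> (\<lambda>k. T0 k (b (\<sigma> k))) = 0" if s: "\<sigma> permutes {..<d}" "\<sigma> \<noteq> id" for \<sigma>
  proof -
    obtain k where ne: "\<sigma> k \<noteq> k" using s(2) by (auto simp: fun_eq_iff)
    then have k: "k < d" using permutes_not_in[OF s(1), of k] by auto
    then have sk: "\<sigma> k < d" using permutes_in_image[OF s(1), of k] by auto
    show ?thesis
    proof (cases "bl (\<sigma> k) = bl k")
      case True
      then have "b (\<sigma> k) \<in> EE (bl k)" using b_EE[OF sk] by simp
      moreover have "b (\<sigma> k) \<noteq> b k" using b_inj[OF sk k] ne by simp
      ultimately have "T0 k (b (\<sigma> k)) \<in> A.J" using T0 k by force
      then show ?thesis by (intro \<Theta>J[OF k])
    next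
      case False
      have "T0 k (b (\<sigma> k)) \<in> AA (bl (\<sigma> k))"
        using H_ideal_Mop[OF _ H_ideal_AA[OF bl_q[OF sk]] b_AA[OF sk]] T0 k by auto
      then show ?thesis by (intro \<Theta>A[OF k bl_q[OF sk] False])
    qed
  qed
  then have "\<Phi> T0 = (\<Sum>\<sigma>\<in>{id}. scaleA (of_int (sign \<sigma>)) (\<Theta> (\<lambda>k. T0 k (b (\<sigma> k)))))"
    unfolding \<Phi>_def by (intro sum.mono_neutral_right finite_permutations) (auto simp: permutes_id)
  also have "\<dots> = \<Theta> (\<lambda>k. T0 k (b k))" by simp
  also have "\<dots> = \<Theta> c"
  proof (rule \<Theta>_mod)
    fix k assume k: "k < d"
    have "\<forall>e'\<in>EE (bl k). T0 k e' - (if e' = b k then c k else 0) \<in> A.J" using T0 k by auto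
    from bspec[OF this b_EE[OF k]] show "T0 k (b k) - c k \<in> A.J" by simp
  qed
  finally have "\<Phi> T0 \<noteq> 0" using \<Theta>c by simp
  then have "\<exists>T. (\<forall>k<d. Mon (T k)) \<and> (\<forall>k\<ge>d. T k = T0 k) \<and> \<Phi> T \<noteq> 0"
  proof (rule successive_replacement[where R = "\<lambda>_. Mop" and P = "\<lambda>_. Mon" and \<Phi> = \<Phi> and T = T0, rotated 2])
    show "Mop (T0 k)" if "k < d" for k using T0 that by auto
    fix k T assume k: "k < d" and M: "Mop (T k)" and nz: "\<Phi> T \<noteq> 0"
    have upd: "(\<lambda>k'. (T(k := t)) k' (b (\<sigma> k'))) = (\<lambda>k'. T k' (b (\<sigma> k')))(k := t (b (\<sigma> k)))" for t \<sigma>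
      by auto
    have lin: "\<Theta> (y(k := u + v)) = \<Theta> (y(k := u)) + \<Theta> (y(k := v))"
      "\<Theta> (y(k := scaleA a u)) = scaleA a (\<Theta> (y(k := u)))" for y u v a
      using \<Theta>_lin[OF k, of y] unfolding linearA_iff by auto
    show "\<exists>t. Mon t \<and> \<Phi> (T(k := t)) \<noteq> 0"
    proof (rule Mop_extract[OF M])
      show "\<Phi> (T(k := (\<lambda>x. S x + T' x))) = \<Phi> (T(k := S)) + \<Phi> (T(k := T'))" for S T'
        unfolding \<Phi>_def upd lin by (simp add: A.scale_right_distrib sum.distrib)
      show "\<Phi> (T(k := (\<lambda>x. scaleA a (T' x)))) = scaleA a (\<Phi> (T(k := T')))" for a T'
        unfolding \<Phi>_def upd lin by (simp add: A.scale_sum_right mult.commute)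
      show "\<Phi> (T(k := T k)) \<noteq> 0" using nz by simp
    qed
  qed
  then obtain T where T: "\<And>k. k < d \<Longrightarrow> Mon (T k)" and nz: "\<Phi> T \<noteq> 0" by blast
  define G where "G \<psi> = \<Theta> (\<lambda>k. T k (\<psi> k))" for \<psi> :: "nat \<Rightarrow> 'a"
  obtain N where N: "CP N {..<d} G" using CP_\<Theta>[of T] T unfolding G_def[abs_def] by blast
  obtain \<kappa> \<theta> where \<theta>: "Pfun (Inl ` {..<d} \<union> Inr ` {..<N}) \<theta>" "\<forall>\<psi>. G \<psi> = \<theta> (case_sum \<psi> \<kappa>)"
    using CP_Pfun[OF N] by auto
  have "\<forall>f\<in>{..<d} \<rightarrow>\<^sub>E {..<d}. \<exists>k. \<forall>X :: nat \<Rightarrow> nat \<Rightarrow> 'f. ddet d (\<lambda>j. X (f j)) = k * ddet d X"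
  proof
    fix f :: "nat \<Rightarrow> nat" assume "f \<in> {..<d} \<rightarrow>\<^sub>E {..<d}"
    then have "f ` {..<d} \<subseteq> {..<d}" by auto
    then obtain k where "\<And>X :: nat \<Rightarrow> nat \<Rightarrow> 'f. ddet d (\<lambda>j. X (f j)) = k * ddet d X"
      by (rule ddet_rows_factor) blast
    then show "\<exists>k. \<forall>X :: nat \<Rightarrow> nat \<Rightarrow> 'f. ddet d (\<lambda>j. X (f j)) = k * ddet d X" by blast
  qed
  from bchoice[OF this] obtain cf where cf: "\<forall>f\<in>{..<d} \<rightarrow>\<^sub>E {..<d}. \<forall>X :: nat \<Rightarrow> nat \<Rightarrow> 'f.
      ddet d (\<lambda>j. X (f j)) = cf f * ddet d X" ..
  \<comment> \<open>This is what remains after the determinant has been taken out of every term of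
    the expansion; it is also the alternating sum evaluated at \<open>b\<close>, where the
    determinant is 1.\<close>
  define w where "w = (\<Sum>f\<in>{..<d} \<rightarrow>\<^sub>E {..<d}. scaleA (cf f) (G (\<lambda>k. b (f k))))"
  define K where "K x = (\<Sum>\<sigma> | \<sigma> permutes {..<d}. scaleA (of_int (sign \<sigma>)) (G (\<lambda>k. x (\<sigma> k))))" for x
  have K: "K x = scaleA (ddet d (\<lambda>k l. coord (b k) (x l))) w" if x: "\<And>k. k < d \<Longrightarrow> x k \<in> AS" for x
  proof -
    have exp: "G (\<lambda>k. x (\<sigma> k)) = (\<Sum>f\<in>{..<d} \<rightarrow>\<^sub>E {..<d}.
        scaleA (\<Prod>k<d. coord (b (f k)) (x (\<sigma> k))) (G (\<lambda>k. b (f k))))" if s: "\<sigma> permutes {..<d}" for \<sigma>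
    proof -
      define r where "r k = x (\<sigma> k) - (\<Sum>a<d. scaleA (coord (b a) (x (\<sigma> k))) (b a))" for k
      have sd: "\<sigma> k < d" if "k < d" for k using permutes_in_image[OF s, of k] that by auto
      have "G (\<lambda>k. x (\<sigma> k)) = (\<Sum>f\<in>{..<d} \<rightarrow>\<^sub>E {..<d}. scaleA (\<Prod>k<d. coord (b (f k)) (x (\<sigma> k)))
          (G (\<lambda>k. if k < d then b (f k) else x (\<sigma> k))))"
      proof (rule multilinear_expand[where sv = scaleA and r = r])
        show "vector_space scaleA" by (rule A.vector_space_axioms)
        show "Vector_Spaces.linear scaleA scaleA (\<lambda>u. G (y(k := u)))" if "k < d" for k y
          by (rule CP_linear[OF N]) (use that in simp)
        show "x (\<sigma> k) = (\<Sum>a<d. scaleA (coord (b a) (x (\<sigma> k))) (b a)) + r k" if "k < d" for k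
          by (simp add: r_def)
        show "G (y(k := r k)) = 0" if k: "k < d" for k y
        proof -
          have "r k \<in> A.J" using x[OF sd[OF k]] by (simp add: r_def AS_def)
          then have "T k ((y(k := r k)) k) \<in> A.J" using H_ideal_Mon[OF T[OF k] H_ideal_J] by simp
          then show ?thesis unfolding G_def by (rule \<Theta>J[OF k])
        qed
      qed
      moreover have "G (\<lambda>k. if k < d then b (f k) else x (\<sigma> k)) = G (\<lambda>k. b (f k))" for f
        by (rule CP_cong[OF N]) auto
      ultimately show ?thesis by simp
    qed
    have "K x = (\<Sum>\<sigma> | \<sigma> permutes {..<d}. \<Sum>f\<in>{..<d} \<rightarrow>\<^sub>E {..<d}.
        scaleA (of_int (sign \<sigma>) * (\<Prod>k<d. coord (b (f k)) (x (\<sigma> k)))) (G (\<lambda>k. b (f k))))"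
      unfolding K_def by (rule sum.cong) (simp_all add: exp A.scale_sum_right)
    also have "\<dots> = (\<Sum>f\<in>{..<d} \<rightarrow>\<^sub>E {..<d}. \<Sum>\<sigma> | \<sigma> permutes {..<d}.
        scaleA (of_int (sign \<sigma>) * (\<Prod>k<d. coord (b (f k)) (x (\<sigma> k)))) (G (\<lambda>k. b (f k))))"
      by (rule sum.swap)
    also have "\<dots> = (\<Sum>f\<in>{..<d} \<rightarrow>\<^sub>E {..<d}.
        scaleA (ddet d (\<lambda>k l. coord (b (f k)) (x l))) (G (\<lambda>k. b (f k))))"
      by (simp add: ddet_def A.scale_sum_left)
    also have "\<dots> = (\<Sum>f\<in>{..<d} \<rightarrow>\<^sub>E {..<d}.
        scaleA (ddet d (\<lambda>k l. coord (b k) (x l))) (scaleA (cf f) (G (\<lambda>k. b (f k)))))"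
    proof (rule sum.cong[OF refl])
      fix f assume f: "f \<in> {..<d} \<rightarrow>\<^sub>E {..<d}"
      have "ddet d (\<lambda>k l. coord (b (f k)) (x l)) = cf f * ddet d (\<lambda>k l. coord (b k) (x l))"
        using bspec[OF cf f] by (rule spec)
      then show "scaleA (ddet d (\<lambda>k l. coord (b (f k)) (x l))) (G (\<lambda>k. b (f k))) =
          scaleA (ddet d (\<lambda>k l. coord (b k) (x l))) (scaleA (cf f) (G (\<lambda>k. b (f k))))"
        by (simp add: mult.commute)
    qed
    finally show ?thesis by (simp add: w_def A.scale_sum_right)
  qed
  have "w \<noteq> 0"
  proof
    assume "w = 0"
    then have "K b = 0" using K[of b] b_AS by simp
    then show False using nz by (simp add: K_def \<Phi>_def G_def)
  qed
  \<comment> \<open>The first component of a variable is a tag: 0 for the alternating arguments, 1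
    for the constants. Further tags remain free for the variables added later.\<close>
  define ren where "ren \<sigma> = case_sum (\<lambda>k. (0 :: nat, 0 :: nat, \<sigma> k)) (\<lambda>j. (1, 0, j))" for \<sigma> :: "nat \<Rightarrow> nat"
  define F where "F \<psi> = (\<Sum>\<sigma> | \<sigma> permutes {..<d}. scaleA (of_int (sign \<sigma>)) (\<theta> (\<lambda>v. \<psi> (ren \<sigma> v))))"
    for \<psi> :: "nat \<times> nat \<times> nat \<Rightarrow> 'a"
  let ?X = "(\<lambda>k. (0, 0, k)) ` {..<d} \<union> (\<lambda>j. (1, 0, j)) ` {..<N}"
  have "Pfun ?X (\<lambda>\<psi>. scaleA (of_int (sign \<sigma>)) (\<theta> (\<lambda>v. \<psi> (ren \<sigma> v))))" if s: "\<sigma> permutes {..<d}" for \<sigma>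
  proof -
    have "inj_on (ren \<sigma>) (Inl ` {..<d} \<union> Inr ` {..<N})"
      using permutes_inj[OF s] by (auto simp: inj_on_def ren_def inj_def)
    moreover have "ren \<sigma> ` (Inl ` {..<d} \<union> Inr ` {..<N}) = (\<lambda>k. (0, 0, k)) ` (\<sigma> ` {..<d}) \<union> (\<lambda>j. (1, 0, j)) ` {..<N}"
      by (simp add: image_Un image_image ren_def)
    ultimately show ?thesis
      using Pfun_rename[OF \<theta>(1), of "ren \<sigma>"] permutes_image[OF s] by (simp add: Pfun.scale)
  qed
  then have PF: "Pfun ?X F" unfolding F_def[abs_def] by (intro Pfun_sum) auto
  have "F \<psi> = scaleA (ddet d (\<lambda>k l. coord (b k) (\<psi> (0, 0, l)))) w"
    if x: "\<And>k. k < d \<Longrightarrow> \<psi> (0, 0, k) \<in> AS" and cst: "\<And>j. j < N \<Longrightarrow> \<psi> (1, 0, j) = \<kappa> j" for \<psi>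
  proof -
    have "\<theta> (\<lambda>v. \<psi> (ren \<sigma> v)) = G (\<lambda>k. \<psi> (0, 0, \<sigma> k))" for \<sigma>
      unfolding \<theta>(2)[rule_format] by (rule Pfun_cong[OF \<theta>(1)]) (auto simp: ren_def cst[unfolded One_nat_def])
    then have "F \<psi> = K (\<lambda>l. \<psi> (0, 0, l))" by (simp add: F_def K_def)
    then show ?thesis using K[of "\<lambda>l. \<psi> (0, 0, l)"] x by simp
  qed
  then show ?thesis by (rule that[OF PF \<open>w \<noteq> 0\<close>])
qed

end

section \<open>The trace form\<close>

context H_frame
begin

lemma AS_right: "x \<in> AS \<Longrightarrow> x * a \<in> AS"
proof -
  assume x: "x \<in> AS"
  have "b k * a \<in> AS" if "k < d" for k
    using AA_AS[OF bl_S[OF that]] AA_right[OF bl_q[OF that] b_AA[OF that]] by auto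
  then have "(\<Sum>k<d. scaleA (coord (b k) x) (b k * a)) \<in> AS"
    by (intro A.subspace_sum[OF AS_subspace] A.subspace_scale[OF AS_subspace]) auto
  moreover have "(x - (\<Sum>k<d. scaleA (coord (b k) x) (b k))) * a \<in> AS"
    using x J_AS A.J_right by (auto simp: AS_def)
  ultimately have "(x - (\<Sum>k<d. scaleA (coord (b k) x) (b k))) * a + (\<Sum>k<d. scaleA (coord (b k) x) (b k * a)) \<in> AS"
    by (intro A.subspace_add[OF AS_subspace])
  then show ?thesis by (simp add: left_diff_distrib sum_distrib_right A.scale_mult_left)
qed

text \<open>The trace of left multiplication by \<open>u\<close> on \<open>AS / J\<close>, in the
  basis represented by \<open>b\<close>.\<close>

definition tr :: "'a \<Rightarrow> 'f" where
  "tr u = (\<Sum>k<d. coord (b k) (u * b k))"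

lemma tr_linear: "Vector_Spaces.linear scaleA (*) tr"
proof -
  interpret c: Vector_Spaces.linear scaleA "(*)" "coord e" for e by (rule coord_linear)
  show ?thesis
    by unfold_locales
      (simp_all add: tr_def distrib_right A.scale_mult_left c.add c.scale sum.distrib sum_distrib_left ring_distribs)
qed

lemma coord_mult:
  assumes "k < d" "x \<in> AS"
  shows "coord (b k) (u * x) = (\<Sum>a<d. coord (b k) (u * b a) * coord (b a) x)"
proof -
  interpret c: Vector_Spaces.linear scaleA "(*)" "coord e" for e by (rule coord_linear)
  let ?s = "\<Sum>a<d. scaleA (coord (b a) x) (b a)"
  have "coord (b k) (u * (x - ?s)) = 0"
    using assms by (intro coord_b_J A.J_left) (auto simp: AS_def)
  then have "coord (b k) (u * x) = coord (b k) (u * ?s)"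
    by (simp add: right_diff_distrib c.diff)
  also have "\<dots> = (\<Sum>a<d. coord (b k) (u * b a) * coord (b a) x)"
    by (simp add: sum_distrib_left A.scale_mult_right c.sum c.scale mult.commute)
  finally show ?thesis .
qed

lemma tr_commute: "tr (u * v) = tr (v * u)"
proof -
  have *: "tr (u * v) = (\<Sum>k<d. \<Sum>a<d. coord (b k) (u * b a) * coord (b a) (v * b k))" for u v
    unfolding tr_def mult.assoc using coord_mult AS_left b_AS by (intro sum.cong) auto
  show ?thesis
    unfolding *[of u v] *[of v u] by (subst sum.swap) (simp add: mult.commute)
qed

lemma ddet_coord_trace:
  assumes x: "\<And>k. k < d \<Longrightarrow> x k \<in> AS"
  shows "(\<Sum>l<d. ddet d (\<lambda>k l'. coord (b k) ((x(l := u * x l)) l'))) =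
    tr u * ddet d (\<lambda>k l. coord (b k) (x l))"
proof -
  have "(\<Sum>l<d. ddet d (\<lambda>k l'. coord (b k) ((x(l := u * x l)) l'))) =
      (\<Sum>l<d. ddet d (\<lambda>k l'. if l' = l then \<Sum>a<d. coord (b k) (u * b a) * coord (b a) (x l') else coord (b k) (x l')))"
    using x by (intro sum.cong refl ddet_cong) (auto simp: coord_mult)
  also have "\<dots> = tr u * ddet d (\<lambda>k l. coord (b k) (x l))"
    unfolding tr_def by (rule ddet_trace)
  finally show ?thesis .
qed

text \<open>Left multiplication by \<open>e\<close>, compressed to the span of \<open>b\<close>, is
  an operator \<open>p\<close> on all of \<open>A\<close> with trace \<open>tr e\<close>. The
  compression changes elements of \<open>AS\<close> only modulo \<open>J\<close>, so
  \<open>p\<close> is idempotent and hence 0; applied to \<open>e\<close> itself this says that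
  \<open>e = e * e\<close> is radical.\<close>

lemma idempotent_tr_zero:
  assumes e: "e * e = e" "e \<in> AS" "tr e = 0"
  shows "e \<in> A.J"
proof -
  interpret c: Vector_Spaces.linear scaleA "(*)" "coord a" for a by (rule coord_linear)
  define \<pi> where "\<pi> x = (\<Sum>k<d. scaleA (coord (b k) x) (b k))" for x
  interpret \<pi>: Vector_Spaces.linear scaleA scaleA \<pi>
    unfolding linearA_iff \<pi>_def
    by (simp add: c.add c.scale A.scale_left_distrib sum.distrib A.scale_sum_right)
  have \<pi>J: "\<pi> x = 0" if "x \<in> A.J" for x using that by (simp add: \<pi>_def coord_b_J)
  have \<pi>_mod: "x - \<pi> x \<in> A.J" if "x \<in> AS" for x using that by (simp add: AS_def \<pi>_def)
  have \<pi>_AS: "\<pi> x \<in> AS" for x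
    unfolding \<pi>_def using b_AS
    by (intro A.subspace_sum[OF AS_subspace] A.subspace_scale[OF AS_subspace]) auto
  define p where "p x = \<pi> (e * \<pi> x)" for x
  have p: "Vector_Spaces.linear scaleA scaleA p"
    unfolding linearA_iff p_def by (simp add: \<pi>.add \<pi>.scale distrib_left A.scale_mult_right)
  have e\<pi>: "\<pi> (e * \<pi> y) = \<pi> (e * y)" if "y \<in> AS" for y
  proof -
    have "\<pi> (e * (y - \<pi> y)) = 0" by (intro \<pi>J A.J_left \<pi>_mod that)
    then show ?thesis by (simp add: right_diff_distrib \<pi>.diff)
  qed
  have idem: "p (p x) = p x" for x
  proof -
    let ?y = "e * \<pi> x"
    have y: "?y \<in> AS" by (intro AS_left \<pi>_AS)
    have "p (p x) = \<pi> (e * \<pi> (\<pi> ?y))" by (simp add: p_def)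
    also have "\<dots> = \<pi> (e * \<pi> ?y)" by (rule e\<pi>[OF \<pi>_AS])
    also have "\<dots> = \<pi> (e * ?y)" by (rule e\<pi>[OF y])
    also have "e * ?y = ?y" by (simp add: mult.assoc[symmetric] e(1))
    finally show ?thesis by (simp add: p_def)
  qed
  have pb: "coord (b k) (p (b k)) = coord (b k) (e * b k)" if k: "k < d" for k
  proof -
    have "\<pi> (b k) = (\<Sum>l<d. if l = k then b k else 0)"
      unfolding \<pi>_def using k by (intro sum.cong) (auto simp: coord_b)
    then have "\<pi> (b k) = b k" using k by simp
    then have "coord (b k) (p (b k)) = (\<Sum>l<d. coord (b l) (e * b k) * coord (b k) (b l))"
      by (simp add: p_def \<pi>_def c.sum c.scale)
    also have "\<dots> = (\<Sum>l<d. if l = k then coord (b k) (e * b k) else 0)"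
      using k by (intro sum.cong) (auto simp: coord_b)
    finally show ?thesis using k by simp
  qed
  have "(\<Sum>a\<in>E. A.representation E (p a) a) = (\<Sum>a\<in>E. coord a (p a))" by (simp add: coord_def)
  also have "\<dots> = (\<Sum>a\<in>b ` {..<d}. coord a (p a))"
  proof (rule sum.mono_neutral_right[OF E_basis(3)])
    show "b ` {..<d} \<subseteq> E" using b_E by auto
    show "\<forall>a\<in>E - b ` {..<d}. coord a (p a) = 0"
    proof
      fix a assume a: "a \<in> E - b ` {..<d}"
      have "p a \<in> A.span (b ` {..<d})"
        unfolding p_def \<pi>_def[of "e * _"] by (intro A.span_sum A.span_scale A.span_base) auto
      then show "coord a (p a) = 0" using a b_E by (intro coord_eq_0[of _ "b ` {..<d}"]) auto
    qed
  qed
  also have "\<dots> = (\<Sum>k<d. coord (b k) (p (b k)))"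
    using b_bij by (subst sum.reindex) (auto simp: bij_betw_def)
  also have "\<dots> = tr e" by (simp add: pb tr_def)
  finally have t0: "(\<Sum>a\<in>E. A.representation E (p a) a) = 0" using e by simp
  have "p x = 0" for x
    by (rule A.idempotent_trace_zero[OF E_basis(1,2) p idem t0]) simp
  then have "\<pi> (e * \<pi> e) = 0" by (simp add: p_def)
  then have "\<pi> e = 0" using e\<pi>[OF e(2)] e(1) by simp
  then show ?thesis using \<pi>_mod[OF e(2)] by simp
qed

text \<open>The radical \<open>R\<close> of the form on \<open>AS\<close> is a left ideal since the
  trace is cyclic. If it were not nil, it would contain a nonzero idempotent \<open>e\<close> with
  \<open>tr e = tr (e * e) = 0\<close>; such an \<open>e\<close> lies in \<open>J\<close>, where
  there is no nonzero idempotent. So \<open>R\<close> is nil and contained in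
  \<open>J\<close>.\<close>

lemma trace_form_nondegenerate:
  assumes u: "u \<in> AS" and z: "\<And>v. v \<in> AS \<Longrightarrow> tr (u * v) = 0"
  shows "u \<in> A.J"
proof -
  interpret tr: Vector_Spaces.linear scaleA "(*)" tr by (rule tr_linear)
  define R where "R = {u \<in> AS. \<forall>v\<in>AS. tr (u * v) = 0}"
  have R_left: "a * x \<in> R" if x: "x \<in> R" for a x
  proof -
    have "tr (a * x * v) = 0" if v: "v \<in> AS" for v
    proof -
      have "tr (a * x * v) = tr (x * (v * a))" using tr_commute[of a "x * v"] by (simp add: mult.assoc)
      then show ?thesis using x AS_right[OF v] by (simp add: R_def)
    qed
    then show ?thesis using x AS_left by (simp add: R_def)
  qed
  have "left_ideal scaleA R"
    unfolding left_ideal_def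
  proof (intro conjI allI ballI R_left)
    show "A.subspace R"
      using AS_subspace unfolding R_def A.subspace_def
      by (simp add: distrib_right A.scale_mult_left tr.add tr.scale tr.zero)
  qed
  moreover have "nilpotent_elem x" if x: "x \<in> R" for x
  proof (rule ccontr)
    assume "\<not> nilpotent_elem x"
    then obtain e c where e: "e * e = e" "e \<noteq> 0" "e = c * x"
      by (rule A.idempotent_of_non_nilpotent) blast
    then have eR: "e \<in> R" using R_left[OF x] by simp
    then have "tr (e * e) = 0" by (simp add: R_def)
    then have "e \<in> A.J" using eR e(1) by (intro idempotent_tr_zero) (auto simp: R_def)
    then show False using A.no_idempotent_in_J e by blast
  qed
  ultimately have "R \<subseteq> A.J" by (rule A.nil_left_ideal_subset_J)
  then show ?thesis using u z by (auto simp: R_def)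
qed

text \<open>By nondegeneracy the functionals \<open>tr (x * v)\<close> separate the points of the
  span of \<open>b\<close>, because this span meets \<open>J\<close> only in 0.\<close>

lemma dual_basis_exists:
  obtains b' where "\<And>k l. k < d \<Longrightarrow> l < d \<Longrightarrow> tr (b k * b' l) = (if k = l then 1 else 0)"
proof -
  interpret tr: Vector_Spaces.linear scaleA "(*)" tr by (rule tr_linear)
  define \<Phi> where "\<Phi> = {(\<lambda>x. tr (x * v)) | v. v \<in> AS}"
  have "\<forall>e\<in>b ` {..<d}. \<exists>\<phi>\<in>\<Phi>. \<forall>e'\<in>b ` {..<d}. \<phi> e' = (if e' = e then 1 else 0)"
  proof (rule A.dual_functionals_exist)
    show "finite (b ` {..<d})" by simp
    show "A.independent (b ` {..<d})" using b_E by (intro A.independent_mono[OF E_basis(1)]) auto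
    show "Vector_Spaces.linear scaleA (*) \<phi>" if P: "\<phi> \<in> \<Phi>" for \<phi>
    proof -
      obtain v where v: "\<phi> = (\<lambda>x. tr (x * v))" using P by (auto simp: \<Phi>_def)
      show ?thesis unfolding v
        by unfold_locales (simp_all add: distrib_right A.scale_mult_left tr.add tr.scale)
    qed
    show "(\<lambda>x. \<phi> x + \<psi> x) \<in> \<Phi>" if P: "\<phi> \<in> \<Phi>" "\<psi> \<in> \<Phi>" for \<phi> \<psi>
    proof -
      obtain v v' where v: "\<phi> = (\<lambda>x. tr (x * v))" "\<psi> = (\<lambda>x. tr (x * v'))" "v \<in> AS" "v' \<in> AS"
        using P by (auto simp: \<Phi>_def)
      then show ?thesis unfolding \<Phi>_def
        by (intro CollectI exI[of _ "v + v'"]) (simp add: distrib_left tr.add A.subspace_add[OF AS_subspace])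
    qed
    show "(\<lambda>x. k * \<phi> x) \<in> \<Phi>" if P: "\<phi> \<in> \<Phi>" for k \<phi>
    proof -
      obtain v where v: "\<phi> = (\<lambda>x. tr (x * v))" "v \<in> AS" using P by (auto simp: \<Phi>_def)
      then show ?thesis unfolding \<Phi>_def
        by (intro CollectI exI[of _ "scaleA k v"])
          (simp add: A.scale_mult_right tr.scale A.subspace_scale[OF AS_subspace])
    qed
    show "\<exists>\<phi>\<in>\<Phi>. \<phi> x \<noteq> 0" if x: "x \<in> A.span (b ` {..<d})" "x \<noteq> 0" for x
    proof (rule ccontr)
      assume neg: "\<not> ?thesis"
      have "A.span (b ` {..<d}) \<subseteq> AS" using b_AS AS_subspace by (intro A.span_minimal) auto
      then have xA: "x \<in> AS" using x by auto
      have "tr (x * v) = 0" if "v \<in> AS" for v using neg that by (auto simp: \<Phi>_def)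
      then have xJ: "x \<in> A.J" by (rule trace_form_nondegenerate[OF xA])
      have "coord e x = 0" if "e \<in> E" for e
      proof (cases "e \<in> b ` {..<d}")
        case True
        then show ?thesis using coord_b_J xJ by auto
      next
        case False
        then show ?thesis using b_E by (intro coord_eq_0[OF x(1)]) auto
      qed
      then show False using x(2) coord_sum[of x] by simp
    qed
  qed
  then have "\<forall>k\<in>{..<d}. \<exists>v. \<forall>l\<in>{..<d}. tr (b l * v) = (if b l = b k then 1 else 0)"
    unfolding \<Phi>_def by fastforce
  from bchoice[OF this] obtain b' where b': "\<forall>k\<in>{..<d}. \<forall>l\<in>{..<d}. tr (b l * b' k) = (if b l = b k then 1 else 0)" ..
  have "tr (b k * b' l) = (if k = l then 1 else 0)" if "k < d" "l < d" for k l
    using b' b_inj[OF that] that by auto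
  then show ?thesis by (rule that)
qed

section \<open>Scalar functions realizable in front of the determinant\<close>

definition frame_vars :: "nat \<Rightarrow> (nat \<times> nat \<times> nat) set" where
  "frame_vars N = (\<lambda>k. (0, 0, k)) ` {..<d} \<union> (\<lambda>j. (1, 0, j)) ` {..<N}"

text \<open>The scalar function \<open>c\<close> can be put in front of \<open>det(x) w\<close> by
  an H-polynomial function. The formula is demanded only for arguments in \<open>AS\<close> and for
  the prescribed constants, which suffices because the functions are finally evaluated at points of
  this kind.\<close>

definition Good :: "nat \<Rightarrow> (nat \<Rightarrow> 'a) \<Rightarrow> 'a \<Rightarrow> (nat \<times> nat \<times> nat) set \<Rightarrow>
    ((nat \<times> nat \<times> nat \<Rightarrow> 'a) \<Rightarrow> 'f) \<Rightarrow> bool" where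
  "Good N \<kappa> w V c \<longleftrightarrow> V \<inter> frame_vars N = {} \<and> (\<forall>\<psi> \<psi>'. (\<forall>v\<in>V. \<psi> v = \<psi>' v) \<longrightarrow> c \<psi> = c \<psi>') \<and>
     (\<exists>F. Pfun (frame_vars N \<union> V) F \<and>
       (\<forall>\<psi>. (\<forall>k<d. \<psi> (0, 0, k) \<in> AS) \<longrightarrow> (\<forall>j<N. \<psi> (1, 0, j) = \<kappa> j) \<longrightarrow>
         F \<psi> = scaleA (c \<psi> * ddet d (\<lambda>k l. coord (b k) (\<psi> (0, 0, l)))) w))"

lemma Good_initial: "\<exists>N \<kappa> w. w \<noteq> 0 \<and> Good N \<kappa> w {} (\<lambda>\<psi>. 1)"
proof (rule initial_function)
  fix N \<kappa> F w
  assume F: "Pfun ((\<lambda>k. (0, 0, k)) ` {..<d} \<union> (\<lambda>j. (1, 0, j)) ` {..<N}) F" and w: "w \<noteq> 0"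
    and val: "\<And>\<psi> :: nat \<times> nat \<times> nat \<Rightarrow> 'a. (\<And>k. k < d \<Longrightarrow> \<psi> (0, 0, k) \<in> AS) \<Longrightarrow>
      (\<And>j. j < N \<Longrightarrow> \<psi> (1, 0, j) = \<kappa> j) \<Longrightarrow>
      F \<psi> = scaleA (ddet d (\<lambda>k l. coord (b k) (\<psi> (0, 0, l)))) w"
  have "Good N \<kappa> w {} (\<lambda>\<psi>. 1)"
    unfolding Good_def frame_vars_def
    using F by (intro conjI exI[of _ F] allI impI) (simp_all add: val)
  then show ?thesis using w by blast
qed

text \<open>The multiplier \<open>g\<close> may itself be a polynomial function of new variables:
  every summand of \<open>F'\<close> still contains each variable exactly once, and the changed
  argument stays in \<open>AS\<close> because \<open>AS\<close> is a left ideal.\<close>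

lemma Good_mult_tr:
  assumes c: "Good N \<kappa> w V c" and g: "Pfun Y g" and Y: "Y \<inter> (frame_vars N \<union> V) = {}"
  shows "Good N \<kappa> w (V \<union> Y) (\<lambda>\<psi>. c \<psi> * tr (g \<psi>))"
proof -
  obtain F where F: "Pfun (frame_vars N \<union> V) F"
    "\<And>\<psi>. (\<And>k. k < d \<Longrightarrow> \<psi> (0, 0, k) \<in> AS) \<Longrightarrow> (\<And>j. j < N \<Longrightarrow> \<psi> (1, 0, j) = \<kappa> j) \<Longrightarrow>
      F \<psi> = scaleA (c \<psi> * ddet d (\<lambda>k l. coord (b k) (\<psi> (0, 0, l)))) w"
    using c unfolding Good_def by blast
  have V: "V \<inter> frame_vars N = {}" and cV: "\<And>\<psi> \<psi>'. (\<And>v. v \<in> V \<Longrightarrow> \<psi> v = \<psi>' v) \<Longrightarrow> c \<psi> = c \<psi>'"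
    using c unfolding Good_def by blast+
  define F' where "F' \<psi> = (\<Sum>l<d. F (\<psi>((0, 0, l) := g \<psi> * \<psi> (0, 0, l))))" for \<psi>
  have fv: "(0, 0, l) \<in> frame_vars N" if "l < d" for l using that by (auto simp: frame_vars_def)
  have "Pfun (frame_vars N \<union> (V \<union> Y)) (\<lambda>\<psi>. F (\<psi>((0, 0, l) := g \<psi> * \<psi> (0, 0, l))))" if l: "l < d" for l
  proof -
    have "Pfun (Y \<union> {(0, 0, l)}) (\<lambda>\<psi>. g \<psi> * \<psi> (0, 0, l))"
      using fv[OF l] Y by (intro Pfun.mult[OF g Pfun_var]) auto
    then have "Pfun (frame_vars N \<union> V - {(0, 0, l)} \<union> (Y \<union> {(0, 0, l)}))
        (\<lambda>\<psi>. F (\<psi>((0, 0, l) := g \<psi> * \<psi> (0, 0, l))))"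
      using fv[OF l] Y by (intro Pfun_subst[OF F(1), where k = "\<lambda>\<psi>. g \<psi> * \<psi> (0, 0, l)"]) auto
    moreover have "frame_vars N \<union> V - {(0, 0, l)} \<union> (Y \<union> {(0, 0, l)}) = frame_vars N \<union> (V \<union> Y)"
      using fv[OF l] by auto
    ultimately show ?thesis by simp
  qed
  then have "Pfun (frame_vars N \<union> (V \<union> Y)) F'" unfolding F'_def[abs_def] by (intro Pfun_sum) auto
  moreover have "F' \<psi> = scaleA (c \<psi> * tr (g \<psi>) * ddet d (\<lambda>k l. coord (b k) (\<psi> (0, 0, l)))) w"
    if x: "\<And>k. k < d \<Longrightarrow> \<psi> (0, 0, k) \<in> AS" and cst: "\<And>j. j < N \<Longrightarrow> \<psi> (1, 0, j) = \<kappa> j" for \<psi>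
  proof -
    define x where "x l = \<psi> (0, 0, l)" for l
    have "F (\<psi>((0, 0, l) := g \<psi> * \<psi> (0, 0, l))) =
        scaleA (c \<psi> * ddet d (\<lambda>k l'. coord (b k) ((x(l := g \<psi> * x l)) l'))) w" if l: "l < d" for l
    proof -
      let ?\<psi> = "\<psi>((0, 0, l) := g \<psi> * \<psi> (0, 0, l))"
      have "F ?\<psi> = scaleA (c ?\<psi> * ddet d (\<lambda>k l. coord (b k) (?\<psi> (0, 0, l)))) w"
        using that(1) by (intro F(2)) (use x cst AS_left in auto)
      moreover have "c ?\<psi> = c \<psi>" using V fv[OF l] by (intro cV) auto
      moreover have "(\<lambda>k l'. coord (b k) (?\<psi> (0, 0, l'))) = (\<lambda>k l'. coord (b k) ((x(l := g \<psi> * x l)) l'))"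
        by (auto simp: x_def fun_eq_iff)
      ultimately show ?thesis by simp
    qed
    then have "F' \<psi> = scaleA (c \<psi> * (\<Sum>l<d. ddet d (\<lambda>k l'. coord (b k) ((x(l := g \<psi> * x l)) l')))) w"
      by (simp add: F'_def A.scale_sum_left sum_distrib_left)
    also have "(\<Sum>l<d. ddet d (\<lambda>k l'. coord (b k) ((x(l := g \<psi> * x l)) l'))) =
        tr (g \<psi>) * ddet d (\<lambda>k l. coord (b k) (x l))"
      by (rule ddet_coord_trace) (simp add: x_def x)
    finally show ?thesis by (simp add: x_def mult.assoc)
  qed
  moreover have "c \<psi> * tr (g \<psi>) = c \<psi>' * tr (g \<psi>')" if "\<forall>v\<in>V \<union> Y. \<psi> v = \<psi>' v" for \<psi> \<psi>'
    using cV[of \<psi> \<psi>'] Pfun_cong[OF g, of \<psi> \<psi>'] that by simp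
  moreover have "(V \<union> Y) \<inter> frame_vars N = {}" using V Y by auto
  ultimately show ?thesis unfolding Good_def by blast
qed

lemma Good_lincomb:
  assumes "finite I" "I \<noteq> {}" "\<And>i. i \<in> I \<Longrightarrow> Good N \<kappa> w V (c i)"
  shows "Good N \<kappa> w V (\<lambda>\<psi>. \<Sum>i\<in>I. a i * c i \<psi>)"
proof -
  obtain i where "i \<in> I" using assms(2) by auto
  from assms(3)[OF this] have V: "V \<inter> frame_vars N = {}" unfolding Good_def by (rule conjunct1)
  have dep: "(\<Sum>i\<in>I. a i * c i \<psi>) = (\<Sum>i\<in>I. a i * c i \<psi>')" if "\<forall>v\<in>V. \<psi> v = \<psi>' v" for \<psi> \<psi>'
    using assms(3) that unfolding Good_def by (intro sum.cong refl) metis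
  have "\<forall>i\<in>I. \<exists>F. Pfun (frame_vars N \<union> V) F \<and>
      (\<forall>\<psi>. (\<forall>k<d. \<psi> (0, 0, k) \<in> AS) \<longrightarrow> (\<forall>j<N. \<psi> (1, 0, j) = \<kappa> j) \<longrightarrow>
         F \<psi> = scaleA (c i \<psi> * ddet d (\<lambda>k l. coord (b k) (\<psi> (0, 0, l)))) w)"
    using assms(3) unfolding Good_def by simp
  from bchoice[OF this] obtain F where F: "\<forall>i\<in>I. Pfun (frame_vars N \<union> V) (F i) \<and>
      (\<forall>\<psi>. (\<forall>k<d. \<psi> (0, 0, k) \<in> AS) \<longrightarrow> (\<forall>j<N. \<psi> (1, 0, j) = \<kappa> j) \<longrightarrow>
         F i \<psi> = scaleA (c i \<psi> * ddet d (\<lambda>k l. coord (b k) (\<psi> (0, 0, l)))) w)" ..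
  have "Pfun (frame_vars N \<union> V) (\<lambda>\<psi>. \<Sum>i\<in>I. scaleA (a i) (F i \<psi>))"
    using F by (intro Pfun_sum Pfun.scale) auto
  moreover have "(\<Sum>i\<in>I. scaleA (a i) (F i \<psi>)) =
      scaleA ((\<Sum>i\<in>I. a i * c i \<psi>) * ddet d (\<lambda>k l. coord (b k) (\<psi> (0, 0, l)))) w"
    if "\<forall>k<d. \<psi> (0, 0, k) \<in> AS" "\<forall>j<N. \<psi> (1, 0, j) = \<kappa> j" for \<psi>
    using F that by (simp add: A.scale_sum_left sum_distrib_right mult.assoc)
  ultimately show ?thesis unfolding Good_def using V dep by blast
qed

text \<open>A permutation changes only the pairing of the \<open>p i\<close> with the
  \<open>r j\<close>. All terms of the determinant are thus products of \<open>d\<close> traces in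
  the same variables, and \<open>Good_lincomb\<close> adds them up.\<close>

lemma Good_det:
  assumes c: "Good N \<kappa> w V c"
    and new: "\<And>i. i < d \<Longrightarrow> p i \<notin> frame_vars N \<union> V" "\<And>i. i < d \<Longrightarrow> r i \<notin> frame_vars N \<union> V"
    and inj: "inj_on p {..<d}" "inj_on r {..<d}" and pr: "\<And>i j. i < d \<Longrightarrow> j < d \<Longrightarrow> p i \<noteq> r j"
  shows "Good N \<kappa> w (V \<union> (p ` {..<d} \<union> r ` {..<d})) (\<lambda>\<psi>. c \<psi> * ddet d (\<lambda>i j. tr (\<psi> (p i) * \<psi> (r j))))"
proof -
  have one: "Good N \<kappa> w (V \<union> (p ` {..<d} \<union> r ` {..<d})) (\<lambda>\<psi>. c \<psi> * (\<Prod>i<d. tr (\<psi> (p i) * \<psi> (r (\<sigma> i)))))"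
    if s: "\<sigma> permutes {..<d}" for \<sigma>
  proof -
    have sd: "\<sigma> i < d" if "i < d" for i using permutes_in_image[OF s, of i] that by auto
    have "Good N \<kappa> w (V \<union> (p ` {..<n} \<union> (\<lambda>i. r (\<sigma> i)) ` {..<n})) (\<lambda>\<psi>. c \<psi> * (\<Prod>i<n. tr (\<psi> (p i) * \<psi> (r (\<sigma> i)))))"
      if "n \<le> d" for n
      using that
    proof (induction n)
      case 0
      then show ?case using c by simp
    next
      case (Suc n)
      let ?V = "V \<union> (p ` {..<n} \<union> (\<lambda>i. r (\<sigma> i)) ` {..<n})"
      have n: "n < d" using Suc.prems by simp
      have P: "Pfun ({p n} \<union> {r (\<sigma> n)}) (\<lambda>\<psi>. \<psi> (p n) * \<psi> (r (\<sigma> n)))"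
        using pr[OF n sd[OF n]] by (intro Pfun.mult Pfun_var) auto
      have "p n \<notin> ?V"
      proof -
        have "p n \<noteq> p i" if "i < n" for i using inj_onD[OF inj(1), of n i] that n by auto
        moreover have "p n \<noteq> r (\<sigma> i)" if "i < n" for i using pr[OF n sd[of i]] that n by auto
        ultimately show ?thesis using new(1)[OF n] by auto
      qed
      moreover have "r (\<sigma> n) \<notin> ?V"
      proof -
        have "r (\<sigma> n) \<noteq> r (\<sigma> i)" if "i < n" for i
        proof
          assume "r (\<sigma> n) = r (\<sigma> i)"
          then have "\<sigma> n = \<sigma> i" using inj_onD[OF inj(2), of "\<sigma> n" "\<sigma> i"] sd[OF n] sd[of i] that n by auto
          then show False using permutes_inj[OF s] that by (auto simp: inj_def)
        qed
        moreover have "r (\<sigma> n) \<noteq> p i" if "i < n" for i using pr[of i "\<sigma> n"] sd[OF n] that n by auto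
        ultimately show ?thesis using new(2)[OF sd[OF n]] by auto
      qed
      ultimately have "({p n} \<union> {r (\<sigma> n)}) \<inter> (frame_vars N \<union> ?V) = {}"
        using new(1)[OF n] new(2)[OF sd[OF n]] by auto
      from Good_mult_tr[OF Suc.IH P this]
      have "Good N \<kappa> w (?V \<union> ({p n} \<union> {r (\<sigma> n)}))
          (\<lambda>\<psi>. c \<psi> * (\<Prod>i<n. tr (\<psi> (p i) * \<psi> (r (\<sigma> i)))) * tr (\<psi> (p n) * \<psi> (r (\<sigma> n))))"
        using Suc.prems by simp
      moreover have "?V \<union> ({p n} \<union> {r (\<sigma> n)}) = V \<union> (p ` {..<Suc n} \<union> (\<lambda>i. r (\<sigma> i)) ` {..<Suc n})"
        by (auto simp: lessThan_Suc)
      ultimately show ?case by (simp add: mult.assoc)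
    qed
    from this[of d] have "Good N \<kappa> w (V \<union> (p ` {..<d} \<union> (\<lambda>i. r (\<sigma> i)) ` {..<d}))
        (\<lambda>\<psi>. c \<psi> * (\<Prod>i<d. tr (\<psi> (p i) * \<psi> (r (\<sigma> i)))))" by simp
    moreover have "(\<lambda>i. r (\<sigma> i)) ` {..<d} = r ` {..<d}"
      using permutes_image[OF s] by (metis image_image)
    ultimately show ?thesis by simp
  qed
  have "Good N \<kappa> w (V \<union> (p ` {..<d} \<union> r ` {..<d})) (\<lambda>\<psi>. \<Sum>\<sigma> | \<sigma> permutes {..<d}.
      of_int (sign \<sigma>) * (c \<psi> * (\<Prod>i<d. tr (\<psi> (p i) * \<psi> (r (\<sigma> i))))))"
    using one by (intro Good_lincomb finite_permutations) (auto intro: permutes_id)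
  moreover have "(\<Sum>\<sigma> | \<sigma> permutes {..<d}. of_int (sign \<sigma>) * (c \<psi> * (\<Prod>i<d. tr (\<psi> (p i) * \<psi> (r (\<sigma> i)))))) =
      c \<psi> * ddet d (\<lambda>i j. tr (\<psi> (p i) * \<psi> (r j)))" for \<psi>
    unfolding ddet_def sum_distrib_left by (intro sum.cong refl) (simp add: mult.left_commute)
  ultimately show ?thesis by simp
qed

lemma Good_columns:
  assumes "finite C" and c: "Good N \<kappa> w {} c"
    and frame: "\<And>s i. s \<in> C \<Longrightarrow> i < d \<Longrightarrow> p s i \<notin> frame_vars N \<and> r s i \<notin> frame_vars N"
    and inj: "inj_on (\<lambda>(s, i). p s i) (C \<times> {..<d})" "inj_on (\<lambda>(s, i). r s i) (C \<times> {..<d})"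
    and pr: "\<And>s s' i j. s \<in> C \<Longrightarrow> s' \<in> C \<Longrightarrow> i < d \<Longrightarrow> j < d \<Longrightarrow> p s i \<noteq> r s' j"
  shows "Good N \<kappa> w (\<Union>s\<in>C. p s ` {..<d} \<union> r s ` {..<d})
    (\<lambda>\<psi>. c \<psi> * (\<Prod>s\<in>C. ddet d (\<lambda>i j. tr (\<psi> (p s i) * \<psi> (r s j)))))"
proof -
  have pe: "p s i = p s' i' \<longleftrightarrow> s = s' \<and> i = i'" if "s \<in> C" "s' \<in> C" "i < d" "i' < d" for s s' i i'
    using inj(1) that by (auto simp: inj_on_def)
  have re: "r s i = r s' i' \<longleftrightarrow> s = s' \<and> i = i'" if "s \<in> C" "s' \<in> C" "i < d" "i' < d" for s s' i i'
    using inj(2) that by (auto simp: inj_on_def)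
  have "Good N \<kappa> w (\<Union>s\<in>D. p s ` {..<d} \<union> r s ` {..<d})
      (\<lambda>\<psi>. c \<psi> * (\<Prod>s\<in>D. ddet d (\<lambda>i j. tr (\<psi> (p s i) * \<psi> (r s j)))))" if "D \<subseteq> C" for D
    using finite_subset[OF that \<open>finite C\<close>] that
  proof (induction D)
    case empty
    then show ?case using c by simp
  next
    case (insert s D)
    let ?V = "\<Union>s\<in>D. p s ` {..<d} \<union> r s ` {..<d}"
    have s: "s \<in> C" and D: "\<And>s'. s' \<in> D \<Longrightarrow> s' \<in> C \<and> s' \<noteq> s" using insert by auto
    have "Good N \<kappa> w (?V \<union> (p s ` {..<d} \<union> r s ` {..<d}))
        (\<lambda>\<psi>. c \<psi> * (\<Prod>s\<in>D. ddet d (\<lambda>i j. tr (\<psi> (p s i) * \<psi> (r s j)))) * ddet d (\<lambda>i j. tr (\<psi> (p s i) * \<psi> (r s j))))"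
    proof (rule Good_det)
      show "Good N \<kappa> w ?V (\<lambda>\<psi>. c \<psi> * (\<Prod>s\<in>D. ddet d (\<lambda>i j. tr (\<psi> (p s i) * \<psi> (r s j)))))"
        using insert by auto
      show "p s i \<notin> frame_vars N \<union> ?V" if "i < d" for i
        using frame[OF s that] pe[OF s _ that] pr[OF s _ that] D by force
      show "r s i \<notin> frame_vars N \<union> ?V" if "i < d" for i
        using frame[OF s that] re[OF s _ that] pr[OF _ s _ that] D by force
      show "inj_on (p s) {..<d}" "inj_on (r s) {..<d}" using pe[OF s s] re[OF s s] by (auto simp: inj_on_def)
      show "p s i \<noteq> r s j" if "i < d" "j < d" for i j using pr[OF s s that] .
    qed
    moreover have "?V \<union> (p s ` {..<d} \<union> r s ` {..<d}) = (\<Union>s\<in>insert s D. p s ` {..<d} \<union> r s ` {..<d})" by auto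
    ultimately show ?case using insert.hyps by (simp add: mult_ac)
  qed
  then show ?thesis by blast
qed

text \<open>Fills up the number of variables, so that every sufficiently large degree is
  reached.\<close>

lemma Good_padding:
  assumes "finite P" and c: "Good N \<kappa> w V c" and P: "P \<inter> (frame_vars N \<union> V) = {}"
  shows "Good N \<kappa> w (V \<union> P) (\<lambda>\<psi>. c \<psi> * (\<Prod>v\<in>P. tr (\<psi> v)))"
  using assms(1) P
proof (induction P)
  case empty
  then show ?case using c by simp
next
  case (insert v P)
  have "Good N \<kappa> w ((V \<union> P) \<union> {v}) (\<lambda>\<psi>. c \<psi> * (\<Prod>v\<in>P. tr (\<psi> v)) * tr (\<psi> v))"
    using insert by (intro Good_mult_tr Pfun_var) auto
  then show ?case using insert.hyps by (simp add: mult_ac)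
qed

end

section \<open>Balanced words\<close>

definition balanced :: "nat \<Rightarrow> nat \<Rightarrow> (nat \<Rightarrow> nat) set" where
  "balanced d m = {y \<in> {..<d * m} \<rightarrow>\<^sub>E {..<d}. \<forall>c<d. card {x. x < d * m \<and> y x = c} = m}"

lemma finite_balanced: "finite (balanced d m)"
  by (rule finite_subset[of _ "{..<d * m} \<rightarrow>\<^sub>E {..<d}"]) (auto simp: balanced_def intro: finite_PiE)

lemma fact_add_ge: "fact a * a ^ k \<le> (fact (a + k) :: nat)"
proof (induction k)
  case (Suc k)
  have "fact a * a ^ Suc k = a * (fact a * a ^ k)" by simp
  also have "\<dots> \<le> Suc (a + k) * fact (a + k)" using Suc by (intro mult_mono) auto
  finally show ?case by simp
qed simp

text \<open>The multinomial coefficient with \<open>d\<close> equal parts falls short of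
  \<open>d ^ (d * m)\<close> by at most the factor \<open>(d * m) ^ d\<close>. In the induction step
  it suffices that each of the \<open>d\<close> new factors of the factorial is at least
  \<open>d * m\<close>.\<close>

lemma fact_mult_ge:
  assumes "m \<ge> 1"
  shows "d ^ (d * m) * fact m ^ d \<le> fact (d * m) * (d * m) ^ d"
  using assms
proof (induction m rule: dec_induct)
  case base
  have "d ^ d * 1 \<le> d ^ d * fact d" by (intro mult_left_mono) auto
  then show ?case by (simp add: mult.commute)
next
  case (step m)
  have "fact (Suc m) ^ d = Suc m ^ d * fact m ^ d" by (simp only: fact_Suc of_nat_id power_mult_distrib)
  moreover have "d ^ (d * Suc m) = d ^ d * d ^ (d * m)" by (simp only: mult_Suc_right power_add)
  ultimately have "d ^ (d * Suc m) * fact (Suc m) ^ d = (d ^ (d * m) * fact m ^ d) * (d ^ d * Suc m ^ d)"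
    by (simp only: mult_ac)
  also have "\<dots> \<le> (fact (d * m) * (d * m) ^ d) * (d ^ d * Suc m ^ d)"
    using step.IH by (rule mult_right_mono) simp
  also have "\<dots> \<le> fact (d * m + d) * (d ^ d * Suc m ^ d)"
    using fact_add_ge[of "d * m" d] by (rule mult_right_mono) simp
  also have "\<dots> = fact (d * m + d) * (d * Suc m) ^ d" by (simp only: power_mult_distrib)
  also have "d * m + d = d * Suc m" by simp
  finally show ?case .
qed

text \<open>The arrangements of the multiset with \<open>m\<close> copies of every letter below
  \<open>d\<close> embed into the balanced words; their number is a multinomial coefficient.\<close>

lemma card_balanced_ge:
  assumes m: "m \<ge> 1"
  shows "d ^ (d * m) \<le> card (balanced d m) * (d * m) ^ d"
proof -
  define M where "M = (\<Sum>c<d. replicate_mset m c)"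
  have count: "count M x = (if x < d then m else 0)" for x
    unfolding M_def by (induction d) (auto simp: less_Suc_eq)
  have size: "size M = d * m"
    unfolding M_def by (induction d) auto
  have setM: "set_mset M = {..<d}"
    using m count by (auto simp: set_mset_def)
  have "(\<Prod>x\<in>set_mset M. fact (count M x)) = (\<Prod>x\<in>{..<d}. fact m :: nat)"
    unfolding setM by (rule prod.cong) (auto simp: count)
  then have prod: "(\<Prod>x\<in>set_mset M. fact (count M x)) = (fact m ^ d :: nat)" by simp
  have cardP: "card (permutations_of_multiset M) * fact m ^ d = fact (d * m)"
    using card_permutations_of_multiset[of M] unfolding prod size by simp
  define f where "f xs = restrict (\<lambda>x. xs ! x) {..<d * m}" for xs :: "nat list"
  have len: "length xs = d * m" "mset xs = M" if "xs \<in> permutations_of_multiset M" for xs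
    using that size by (auto simp: permutations_of_multiset_def simp flip: size_mset)
  have sub: "f ` permutations_of_multiset M \<subseteq> balanced d m"
  proof
    fix y assume "y \<in> f ` permutations_of_multiset M"
    then obtain xs where xs: "xs \<in> permutations_of_multiset M" "y = f xs" by auto
    have "xs ! x < d" if "x < d * m" for x
    proof -
      have "xs ! x \<in> set_mset (mset xs)" using that len(1)[OF xs(1)] by simp
      then show ?thesis unfolding len(2)[OF xs(1)] setM by simp
    qed
    moreover have "card {x. x < d * m \<and> y x = c} = m" if "c < d" for c
    proof -
      have "{x. x < d * m \<and> y x = c} = {i. i < length xs \<and> xs ! i = c}"
        using len(1)[OF xs(1)] by (auto simp: xs(2) f_def)
      then have "card {x. x < d * m \<and> y x = c} = length (filter (\<lambda>z. z = c) xs)"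
        by (simp add: length_filter_conv_card)
      also have "filter (\<lambda>z. z = c) xs = filter ((=) c) xs" by (rule filter_cong) auto
      also have "length \<dots> = count (mset xs) c" by (simp add: count_mset count_list_eq_length_filter)
      also have "\<dots> = m" using that by (simp add: len(2)[OF xs(1)] count)
      finally show ?thesis .
    qed
    ultimately show "y \<in> balanced d m" by (auto simp: balanced_def xs(2) f_def)
  qed
  have "inj_on f (permutations_of_multiset M)"
  proof (rule inj_onI)
    fix xs ys assume xy: "xs \<in> permutations_of_multiset M" "ys \<in> permutations_of_multiset M" "f xs = f ys"
    show "xs = ys"
    proof (rule nth_equalityI)
      show "length xs = length ys" using len(1)[OF xy(1)] len(1)[OF xy(2)] by simp
      fix i assume "i < length xs"
      then show "xs ! i = ys ! i" using fun_cong[OF xy(3), of i] len(1)[OF xy(1)] by (simp add: f_def)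
    qed
  qed
  from card_inj_on_le[OF this sub finite_balanced] have "card (permutations_of_multiset M) \<le> card (balanced d m)"
    .
  then have "fact (d * m) \<le> card (balanced d m) * fact m ^ d" unfolding cardP[symmetric] by simp
  then have "fact (d * m) * (d * m) ^ d \<le> card (balanced d m) * fact m ^ d * (d * m) ^ d"
    by (rule mult_right_mono) simp
  then have "d ^ (d * m) * fact m ^ d \<le> card (balanced d m) * fact m ^ d * (d * m) ^ d"
    using fact_mult_ge[OF m, of d] by (rule order_trans[rotated])
  then have "d ^ (d * m) * fact m ^ d \<le> (card (balanced d m) * (d * m) ^ d) * fact m ^ d"
    by (simp only: mult_ac)
  then show ?thesis by (simp only: mult_le_cancel2) simp
qed

text \<open>The first \<open>d\<close> blocks are fixed to start the induction in
  \<open>words_separated\<close>: from a cell of colour \<open>c\<close> a column reaches back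
  \<open>c < d\<close> blocks.\<close>

definition words :: "nat \<Rightarrow> nat \<Rightarrow> nat \<Rightarrow> (nat \<Rightarrow> nat) \<Rightarrow> (nat \<Rightarrow> nat \<Rightarrow> nat) set" where
  "words d m t y0 = {w \<in> {..<t} \<rightarrow>\<^sub>E balanced d m. \<forall>s<d. w s = y0}"

lemma finite_words: "finite (words d m t y0)"
  by (rule finite_subset[of _ "{..<t} \<rightarrow>\<^sub>E balanced d m"])
    (auto simp: words_def intro!: finite_PiE finite_balanced)

lemma card_words_ge:
  assumes "d \<le> t" "y0 \<in> balanced d m"
  shows "card (balanced d m) ^ (t - d) \<le> card (words d m t y0)"
proof -
  define f where "f g = (\<lambda>s. if s < d then y0 else g s)" for g :: "nat \<Rightarrow> nat \<Rightarrow> nat"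
  have sub: "f ` ({d..<t} \<rightarrow>\<^sub>E balanced d m) \<subseteq> words d m t y0"
    using assms by (auto simp: f_def words_def PiE_iff extensional_def)
  have "inj_on f ({d..<t} \<rightarrow>\<^sub>E balanced d m)"
  proof (rule inj_onI)
    fix g h assume gh: "g \<in> {d..<t} \<rightarrow>\<^sub>E balanced d m" "h \<in> {d..<t} \<rightarrow>\<^sub>E balanced d m" "f g = f h"
    show "g = h"
    proof (rule PiE_ext[OF gh(1,2)])
      fix s assume "s \<in> {d..<t}"
      then show "g s = h s" using fun_cong[OF gh(3), of s] by (simp add: f_def)
    qed
  qed
  from card_inj_on_le[OF this sub finite_words] have "card ({d..<t} \<rightarrow>\<^sub>E balanced d m) \<le> card (words d m t y0)"
    .
  then show ?thesis by (simp add: card_PiE)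
qed

definition enum :: "nat \<Rightarrow> nat \<Rightarrow> (nat \<Rightarrow> nat) \<Rightarrow> nat \<Rightarrow> nat \<Rightarrow> nat" where
  "enum d m y c = (SOME f. bij_betw f {..<m} {x. x < d * m \<and> y x = c})"

lemma enum_bij:
  assumes "y \<in> balanced d m" "c < d"
  shows "bij_betw (enum d m y c) {..<m} {x. x < d * m \<and> y x = c}"
proof -
  have "card {x. x < d * m \<and> y x = c} = m" using assms by (simp add: balanced_def)
  then have "\<exists>f. bij_betw f {..<m} {x. x < d * m \<and> y x = c}"
    using ex_bij_betw_nat_finite[of "{x. x < d * m \<and> y x = c}"] by (simp add: lessThan_atLeast0)
  then show ?thesis unfolding enum_def by (rule someI_ex)
qed

text \<open>The cells of a word \<open>w\<close> are arranged into columns \<open>(s, j)\<close> of height \<open>d\<close>: the cell with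
  colour \<open>c\<close> is the \<open>j\<close>-th cell of that colour in block \<open>s + c\<close> (cyclically).\<close>

definition cell :: "nat \<Rightarrow> nat \<Rightarrow> nat \<Rightarrow> (nat \<Rightarrow> nat \<Rightarrow> nat) \<Rightarrow> nat \<times> nat \<Rightarrow> nat \<Rightarrow> nat \<times> nat" where
  "cell d m t w sj c = ((fst sj + c) mod t, enum d m (w ((fst sj + c) mod t)) c (snd sj))"

lemma cell_props:
  assumes w: "w \<in> words d m t y0" and "t \<ge> 1" "sj \<in> {..<t} \<times> {..<m}" "c < d"
  shows "cell d m t w sj c \<in> {..<t} \<times> {..<d * m}"
    "w (fst (cell d m t w sj c)) (snd (cell d m t w sj c)) = c"
proof -
  let ?B = "(fst sj + c) mod t"
  have "?B < t" using assms by simp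
  then have "w ?B \<in> balanced d m" using w by (auto simp: words_def)
  from bij_betwE[OF enum_bij[OF this \<open>c < d\<close>]] have "enum d m (w ?B) c (snd sj) \<in> {x. x < d * m \<and> w ?B x = c}"
    using assms by auto
  then show "cell d m t w sj c \<in> {..<t} \<times> {..<d * m}"
    "w (fst (cell d m t w sj c)) (snd (cell d m t w sj c)) = c"
    using \<open>?B < t\<close> by (auto simp: cell_def)
qed

text \<open>Everything can be recovered from a cell: its colour \<open>c\<close> through
  \<open>w\<close>, then \<open>s\<close> from the block index modulo \<open>t\<close>, and
  \<open>j\<close> from the enumeration of the cells of that colour in the block.\<close>

lemma cell_inj:
  assumes w: "w \<in> words d m t y0" and t: "t \<ge> 1"
  shows "inj_on (\<lambda>(sj, c). cell d m t w sj c) (({..<t} \<times> {..<m}) \<times> {..<d})"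
proof (rule inj_onI)
  fix p p' assume p: "p \<in> ({..<t} \<times> {..<m}) \<times> {..<d}" "p' \<in> ({..<t} \<times> {..<m}) \<times> {..<d}"
    and eq: "(\<lambda>(sj, c). cell d m t w sj c) p = (\<lambda>(sj, c). cell d m t w sj c) p'"
  obtain s j c s' j' c' where pp: "p = ((s, j), c)" "p' = ((s', j'), c')" by (metis prod.exhaust)
  have b: "s < t" "j < m" "c < d" "s' < t" "j' < m" "c' < d" using p by (auto simp: pp)
  have eq': "cell d m t w (s, j) c = cell d m t w (s', j') c'" using eq by (simp add: pp)
  have c: "c = c'"
    using cell_props(2)[OF w t, of "(s, j)" c] cell_props(2)[OF w t, of "(s', j')" c'] b eq' by simp
  have B: "(s + c) mod t = (s' + c) mod t" using eq' by (simp add: cell_def c)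
  then obtain q1 q2 where "s + c + t * q1 = s' + c + t * q2" unfolding nat_mod_eq_iff by blast
  then have "s + t * q1 = s' + t * q2" by simp
  then have "s mod t = s' mod t" unfolding nat_mod_eq_iff by blast
  then have s: "s = s'" using b by simp
  let ?B = "(s + c) mod t"
  have "?B < t" using t by simp
  then have "w ?B \<in> balanced d m" using w by (auto simp: words_def)
  from bij_betw_imp_inj_on[OF enum_bij[OF this b(3)]] have "j = j'"
    using eq' b by (auto simp: cell_def c s inj_on_def)
  then show "p = p'" by (simp add: pp c s)
qed

lemma cell_image:
  assumes w: "w \<in> words d m t y0" and t: "t \<ge> 1"
  shows "(\<Union>sj\<in>{..<t} \<times> {..<m}. cell d m t w sj ` {..<d}) = {..<t} \<times> {..<d * m}"
proof -
  have "(\<Union>sj\<in>{..<t} \<times> {..<m}. cell d m t w sj ` {..<d}) =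
      (\<lambda>(sj, c). cell d m t w sj c) ` (({..<t} \<times> {..<m}) \<times> {..<d})" by force
  also have "\<dots> = {..<t} \<times> {..<d * m}"
  proof (rule card_subset_eq)
    show "(\<lambda>(sj, c). cell d m t w sj c) ` (({..<t} \<times> {..<m}) \<times> {..<d}) \<subseteq> {..<t} \<times> {..<d * m}"
      using cell_props(1)[OF w t] by fastforce
    show "card ((\<lambda>(sj, c). cell d m t w sj c) ` (({..<t} \<times> {..<m}) \<times> {..<d})) = card ({..<t} \<times> {..<d * m})"
      by (simp add: card_image[OF cell_inj[OF w t]] card_cartesian_product mult_ac)
  qed simp
  finally show ?thesis .
qed

text \<open>All balanced words have the same letter sum, so a letterwise inequality between two of
  them is an equality.\<close>

lemma balanced_sum:
  assumes "y \<in> balanced d m"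
  shows "(\<Sum>x<d * m. y x) = (\<Sum>c<d. m * c)"
proof -
  have "(\<Sum>x<d * m. y x) = (\<Sum>c<d. \<Sum>x\<in>{x \<in> {..<d * m}. y x = c}. y x)"
    using assms by (intro sum.group[symmetric]) (auto simp: balanced_def)
  also have "\<dots> = (\<Sum>c<d. \<Sum>x\<in>{x \<in> {..<d * m}. y x = c}. c)" by (intro sum.cong refl) auto
  also have "\<dots> = (\<Sum>c<d. m * c)"
    using assms by (intro sum.cong refl) (auto simp: balanced_def lessThan_def)
  finally show ?thesis .
qed

text \<open>By induction over the blocks: if \<open>v\<close> agrees with \<open>w\<close> on the earlier blocks, the column through
  a cell of colour \<open>c\<close> already contains the colours below \<open>c\<close>, so \<open>v \<ge> w\<close> on the block; both words
  are balanced there.\<close>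

lemma words_separated:
  assumes v: "v \<in> words d m t y0" and w: "w \<in> words d m t y0" and t: "t \<ge> 1"
    and inj: "\<And>sj. sj \<in> {..<t} \<times> {..<m} \<Longrightarrow>
      inj_on (\<lambda>c. v (fst (cell d m t w sj c)) (snd (cell d m t w sj c))) {..<d}"
  shows "v = w"
proof -
  have "v B = w B" if "B < t" for B
    using that
  proof (induction B rule: less_induct)
    case (less B)
    show ?case
    proof (cases "B < d")
      case True
      then show ?thesis using v w by (simp add: words_def)
    next
      case False
      have vB: "v B \<in> balanced d m" and wB: "w B \<in> balanced d m"
        using v w less.prems by (auto simp: words_def)
      have ge: "w B x \<le> v B x" if x: "x < d * m" for x
      proof (rule ccontr)
        assume lt: "\<not> w B x \<le> v B x"
        define c where "c = w B x"
        define c' where "c' = v B x"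
        have c: "c < d" "c' < c" using wB x lt by (auto simp: c_def c'_def balanced_def)
        have "x \<in> {x. x < d * m \<and> w B x = c}" using x by (simp add: c_def)
        then have "x \<in> enum d m (w B) c ` {..<m}"
          using bij_betw_imp_surj_on[OF enum_bij[OF wB c(1)]] by simp
        then obtain j where j: "j < m" "enum d m (w B) c j = x" by auto
        \<comment> \<open>Here \<open>B \<ge> d > c\<close>, so the column through this cell starts
          at \<open>B - c\<close> without wrapping around, and its cells of smaller colour lie in
          earlier blocks.\<close>
        define s where "s = B - c"
        have s: "s < t" "s + c = B" using False c(1) less.prems by (auto simp: s_def)
        have sj: "(s, j) \<in> {..<t} \<times> {..<m}" using s j by simp
        have cellc: "cell d m t w (s, j) c = (B, x)" using s less.prems j by (simp add: cell_def)
        have "fst (cell d m t w (s, j) c') = s + c'" using s c less.prems by (simp add: cell_def)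
        moreover have "v (s + c') = w (s + c')" using s c less by simp
        ultimately have "v (fst (cell d m t w (s, j) c')) (snd (cell d m t w (s, j) c')) = c'"
          using cell_props(2)[OF w t sj, of c'] c by simp
        moreover have "v (fst (cell d m t w (s, j) c)) (snd (cell d m t w (s, j) c)) = c'"
          by (simp add: cellc c'_def)
        ultimately have "c = c'" using inj_onD[OF inj[OF sj], of c c'] c by simp
        then show False using c by simp
      qed
      have "w B x = v B x" if "x \<in> {..<d * m}" for x
        using balanced_sum[OF wB] balanced_sum[OF vB] ge that
        by (intro sum_mono_inv[of "w B" "{..<d * m}" "v B"]) auto
      then show ?thesis
        using vB wB by (intro PiE_ext[of _ "{..<d * m}" "\<lambda>_. {..<d}"]) (auto simp: balanced_def)
    qed
  qed
  then show ?thesis using v w by (intro PiE_ext[of _ "{..<t}" "\<lambda>_. balanced d m"]) (auto simp: words_def)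
qed

section \<open>The limit\<close>

text \<open>In the lower estimate \<open>m\<close> is fixed first. It gives the growth rate
  \<open>root (d * m) K\<close>, which is arbitrarily close to \<open>d\<close> for large
  \<open>m\<close>. The free summand \<open>e\<close> covers the degrees between the multiples of
  \<open>2 * d * m\<close>, so that the sequence itself and not only a subsequence is bounded
  below.\<close>

lemma root_tendsto_of_bounds:
  fixes c :: "nat \<Rightarrow> nat" and d :: nat and D :: real
  assumes D: "D \<ge> 0"
    and up: "\<And>\<epsilon>::real. 0 < \<epsilon> \<Longrightarrow> \<epsilon> \<le> 1 \<Longrightarrow> \<exists>C>0. \<forall>n\<ge>1. real (c n) \<le> C * (real d + \<epsilon> * D) ^ n"
    and low: "\<And>m. d \<ge> 1 \<Longrightarrow> m \<ge> 1 \<Longrightarrow> \<exists>(K::real) n0. K \<ge> 1 \<and> real d ^ (d * m) \<le> K * real (d * m) ^ d \<and>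
      (\<forall>t\<ge>d. \<forall>e. K ^ (2 * (t - d)) \<le> real (c (n0 + 2 * d * m * t + e)))"
  shows "(\<lambda>n. root n (real (c n))) \<longlonglongrightarrow> real d"
proof (rule order_tendstoI)
  fix a :: real assume a: "a < real d"
  show "\<forall>\<^sub>F n in sequentially. a < root n (real (c n))"
  proof (cases "a < 0")
    case True
    have "a < root n (real (c n))" if "n \<ge> 1" for n
      using True real_root_ge_zero[of "real (c n)" n] by linarith
    then show ?thesis by (auto simp: eventually_sequentially)
  next
    case False
    then have d: "d \<ge> 1" using a by simp
    \<comment> \<open>Under the root of order \<open>d * m\<close> the loss
      \<open>(d * m) ^ d\<close> becomes the \<open>m\<close>-th root of \<open>d * m\<close>, which
      tends to 1.\<close>
    have "(\<lambda>m. real d / (root m (real d) * root m (real m))) \<longlonglongrightarrow> real d / (1 * 1)"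
      using d by (intro tendsto_intros LIMSEQ_root LIMSEQ_root_const) auto
    then have "\<forall>\<^sub>F m in sequentially. a < real d / (root m (real d) * root m (real m))"
      using a by (intro order_tendstoD) auto
    then obtain m where m: "m \<ge> 1" "a < real d / (root m (real d) * root m (real m))"
      unfolding eventually_sequentially by (metis nat_le_linear)
    obtain K :: real and n0 where K: "K \<ge> 1" "real d ^ (d * m) \<le> K * real (d * m) ^ d"
      and cK: "\<And>t e. t \<ge> d \<Longrightarrow> K ^ (2 * (t - d)) \<le> real (c (n0 + 2 * d * m * t + e))"
      using low[OF d m(1)] by blast
    have dm: "d * m > 0" using d m by simp
    define k where "k = root (d * m) K"
    have k1: "k \<ge> 1" using K(1) dm by (simp add: k_def)
    have kK: "k ^ (d * m) = K" using K(1) dm by (simp add: k_def real_root_pow_pos2)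
    have "real d = root (d * m) (real d ^ (d * m))" using dm by (simp add: real_root_power_cancel)
    also have "\<dots> \<le> root (d * m) (K * real (d * m) ^ d)" using K(2) dm by (intro real_root_le_mono) auto
    also have "\<dots> = k * root m (root d (real (d * m) ^ d))"
    proof -
      have "root (d * m) (x ^ d) = root m (root d (x ^ d))" for x
        using real_root_mult_exp[of m d] by (simp only: mult.commute[of d m])
      then show ?thesis by (simp only: real_root_mult k_def)
    qed
    also have "root d (real (d * m) ^ d) = real d * real m" using d by (simp add: real_root_power_cancel)
    finally have "real d \<le> k * (root m (real d) * root m (real m))" by (simp add: real_root_mult)
    then have "real d / (root m (real d) * root m (real m)) \<le> k"
      using d m by (simp add: divide_le_eq)
    then have ak: "a < k" using m(2) by linarith
    \<comment> \<open>\<open>C\<close> absorbs the offset \<open>n0\<close>, one incomplete period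
      and the \<open>d\<close> fixed blocks: from there on \<open>t \<ge> d\<close>, and
      \<open>n - C\<close> does not exceed \<open>d * m * (2 * (t - d))\<close>.\<close>
    define C where "C = n0 + 2 * d * m + 2 * d * m * d"
    have ck: "k ^ n / k ^ C \<le> real (c n)" if n: "n \<ge> C" for n
    proof -
      define t where "t = (n - n0) div (2 * d * m)"
      define e where "e = (n - n0) mod (2 * d * m)"
      have neq: "n = n0 + 2 * d * m * t + e" using n by (simp add: t_def e_def C_def)
      have e: "e < 2 * d * m" using dm by (simp add: e_def)
      have "2 * d * m * d \<le> 2 * d * m * t"
      proof -
        have "d * (2 * d * m) \<le> n - n0" using n by (simp add: C_def mult_ac)
        then have "d \<le> t" unfolding t_def using dm by (subst less_eq_div_iff_mult_less_eq) (auto simp: mult_ac)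
        then show ?thesis by simp
      qed
      then have td: "t \<ge> d" using dm by simp
      have "n - C \<le> d * m * (2 * (t - d))"
      proof -
        have "n \<le> n0 + 2 * d * m * t + 2 * d * m" using neq e by simp
        then have "n \<le> C + (2 * d * m * t - 2 * d * m * d)"
          using td by (simp add: C_def)
        moreover have "d * m * (2 * (t - d)) = 2 * d * m * (t - d)" by (simp only: mult_ac)
        moreover have "2 * d * m * (t - d) = 2 * d * m * t - 2 * d * m * d" by (rule diff_mult_distrib2)
        ultimately show ?thesis by linarith
      qed
      then have "k ^ (n - C) \<le> k ^ (d * m * (2 * (t - d)))" using k1 by (intro power_increasing)
      also have "\<dots> = K ^ (2 * (t - d))" by (subst power_mult) (simp only: kK)
      also have "\<dots> \<le> real (c n)" using cK[OF td, of e] neq by simp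
      finally show ?thesis using n k1 by (simp add: power_diff)
    qed
    have "(\<lambda>n. k / root n (k ^ C)) \<longlonglongrightarrow> k / 1"
      using k1 by (intro tendsto_intros LIMSEQ_root_const) auto
    then have "\<forall>\<^sub>F n in sequentially. a < k / root n (k ^ C)"
      using ak by (intro order_tendstoD) auto
    moreover have "\<forall>\<^sub>F n in sequentially. n \<ge> max C 1" by (rule eventually_ge_at_top)
    ultimately show ?thesis
    proof eventually_elim
      case (elim n)
      have "k / root n (k ^ C) = root n (k ^ n / k ^ C)"
        using elim k1 by (simp add: real_root_divide real_root_power_cancel)
      also have "\<dots> \<le> root n (real (c n))" using elim ck by (intro real_root_le_mono) auto
      finally show ?case using elim by linarith
    qed
  qed
next
  fix y :: real assume y: "real d < y"
  \<comment> \<open>\<open>\<epsilon> * D\<close> uses up at most half of the gap between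
    \<open>d\<close> and \<open>y\<close>; \<open>D + 1\<close> keeps the denominator
    positive.\<close>
  define \<epsilon> where "\<epsilon> = min 1 ((y - real d) / (2 * (D + 1)))"
  have \<epsilon>: "0 < \<epsilon>" "\<epsilon> \<le> 1" using y D by (auto simp: \<epsilon>_def)
  have "\<epsilon> * D \<le> (y - real d) / (2 * (D + 1)) * D" using D by (intro mult_right_mono) (auto simp: \<epsilon>_def)
  also have "\<dots> \<le> (y - real d) / (2 * (D + 1)) * (D + 1)" using D y by (intro mult_left_mono) auto
  also have "\<dots> = (y - real d) / 2" using D by (simp add: field_simps)
  also have "\<dots> < y - real d" using y by simp
  finally have zy: "real d + \<epsilon> * D < y" by simp
  obtain C where C: "C > 0" "\<forall>n\<ge>1. real (c n) \<le> C * (real d + \<epsilon> * D) ^ n" using up[OF \<epsilon>] by auto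
  have "(\<lambda>n. root n C * (real d + \<epsilon> * D)) \<longlonglongrightarrow> 1 * (real d + \<epsilon> * D)"
    using C by (intro tendsto_intros LIMSEQ_root_const) auto
  then have "\<forall>\<^sub>F n in sequentially. root n C * (real d + \<epsilon> * D) < y"
    using zy by (intro order_tendstoD) auto
  moreover have "\<forall>\<^sub>F n in sequentially. n \<ge> (1::nat)" by (rule eventually_ge_at_top)
  ultimately show "\<forall>\<^sub>F n in sequentially. root n (real (c n)) < y"
  proof eventually_elim
    case (elim n)
    have "root n (real (c n)) \<le> root n (C * (real d + \<epsilon> * D) ^ n)"
      using elim C by (intro real_root_le_mono) auto
    also have "\<dots> = root n C * (real d + \<epsilon> * D)"
      using elim D \<epsilon> by (simp add: real_root_mult real_root_power_cancel)
    finally show ?case using elim by linarith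
  qed
qed

section \<open>The lower bound\<close>

text \<open>Carries the structured variables over to \<open>{1..n}\<close>, for functions and points
  alike.\<close>

lemma (in H_basis) codim_ge_of_points:
  assumes E: "A.independent E" "A.span E = UNIV" "finite E"
    and X: "finite X" "card X = n" "n \<ge> 1" and K: "finite K"
    and F: "\<And>k. k \<in> K \<Longrightarrow> Pfun X (F k)" "\<And>k. k \<in> K \<Longrightarrow> F k (\<Psi> k) \<noteq> 0"
      "\<And>k l. k \<in> K \<Longrightarrow> l \<in> K \<Longrightarrow> k \<noteq> l \<Longrightarrow> F k (\<Psi> l) = 0"
  shows "card K \<le> H_codim scaleH scaleA act \<Gamma> n"
proof -
  obtain h where h: "bij_betw h {1..n} X" using ex_bij_betw_nat_finite_1[OF X(1)] X(2) by auto
  define \<rho> where "\<rho> = the_inv_into {1..n} h"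
  have \<rho>: "bij_betw \<rho> X {1..n}" unfolding \<rho>_def by (rule bij_betw_the_inv_into[OF h])
  have h\<rho>: "h (\<rho> v) = v" if "v \<in> X" for v
    unfolding \<rho>_def by (rule f_the_inv_into_f_bij_betw[OF h that])
  define F' where "F' k \<psi> = F k (\<lambda>v. \<psi> (\<rho> v))" for k \<psi>
  have PF: "Pfun {1..n} (F' k)" if "k \<in> K" for k
    using Pfun_rename[OF F(1)[OF that] bij_betw_imp_inj_on[OF \<rho>]] bij_betw_imp_surj_on[OF \<rho>]
    unfolding F'_def[abs_def] by simp
  have val: "F' k (\<lambda>i. \<Psi> l (h i)) = F k (\<Psi> l)" if "k \<in> K" for k l
    unfolding F'_def by (rule Pfun_cong[OF F(1)[OF that]]) (simp add: h\<rho>)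
  show ?thesis
  proof (rule codim_bounds(2)[OF X(3) E K, where F = F' and \<psi> = "\<lambda>l i. \<Psi> l (h i)"])
    show "Pfun {1..n} (F' k)" if "k \<in> K" for k using that by (rule PF)
    show "F' k (\<lambda>i. \<Psi> k (h i)) \<noteq> 0" if "k \<in> K" for k using F(2)[OF that] val[OF that] by simp
    show "F' k (\<lambda>i. \<Psi> l (h i)) = 0" if "k \<in> K" "l \<in> K" "k \<noteq> l" for k l
      using F(3)[OF that] val[OF that(1)] by simp
  qed
qed

context H_frame
begin

lemma d_pos: "d \<ge> 1"
proof -
  obtain i where i: "i \<in> S" using S_nonempty by auto
  then obtain e where "e \<in> (\<Union>i\<in>S. EE i)" using EE_nonempty[OF S_sub[OF i]] by auto
  then have "{..<d} \<noteq> {}" using b_bij by (auto simp: bij_betw_def)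
  then show ?thesis by auto
qed

text \<open>A pair of words plays two roles. As the index of a function it tells, through its cells,
  how the variables are grouped into determinants. As the index of a point it assigns to each
  variable, by its letter, an element of \<open>b\<close> or of the dual basis, which turns the
  matrices of traces into 0-1 matrices.\<close>

lemma codim_ge_words:
  assumes "H_basis scaleH scaleA act \<Gamma>"
    and w0: "w0 \<noteq> 0" and G0: "Good N \<kappa> w0 {} (\<lambda>\<psi>. 1)" and t: "t \<ge> d"
  shows "card (words d m t y0) ^ 2 \<le> H_codim scaleH scaleA act \<Gamma> (N + d + 2 * d * m * t + e)"
proof -
  interpret HB: H_basis scaleH scaleA act \<Gamma> by fact
  have t1: "t \<ge> 1" using d_pos t by simp
  obtain b' where b': "\<And>k l. k < d \<Longrightarrow> l < d \<Longrightarrow> tr (b k * b' l) = (if k = l then 1 else 0)"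
    using dual_basis_exists by blast
  \<comment> \<open>The value of the padding variables: it has trace 1, so they contribute the
    factor 1.\<close>
  define u0 where "u0 = b 0 * b' 0"
  have u0: "tr u0 = 1" using b'[of 0 0] d_pos by (simp add: u0_def)
  define W where "W = words d m t y0"
  define C where "C = {..<t} \<times> {..<m}"
  \<comment> \<open>Tags 2 and 3 mark the two families of variables paired by the trace form, with
    cells as names; tag 4 marks the padding.\<close>
  define VV :: "(nat \<times> nat \<times> nat) set" where
    "VV = Pair 2 ` ({..<t} \<times> {..<d * m}) \<union> Pair 3 ` ({..<t} \<times> {..<d * m})"
  define P :: "(nat \<times> nat \<times> nat) set" where "P = (\<lambda>j. (4, 0, j)) ` {..<e}"
  define p :: "nat \<Rightarrow> (nat \<Rightarrow> nat \<Rightarrow> nat) \<Rightarrow> nat \<times> nat \<Rightarrow> nat \<Rightarrow> nat \<times> nat \<times> nat"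
    where "p a w sj i = (a, cell d m t w sj i)" for a w sj i
  define cc where "cc k \<psi> = 1 * (\<Prod>sj\<in>C. ddet d (\<lambda>i j. tr (\<psi> (p 2 (fst k) sj i) * \<psi> (p 3 (snd k) sj j)))) *
      (\<Prod>v\<in>P. tr (\<psi> v))" for k \<psi>
  define X where "X = frame_vars N \<union> (VV \<union> P)"
  have frame: "v \<notin> frame_vars N" if "fst v \<ge> 2" for v using that by (auto simp: frame_vars_def)
  have good: "Good N \<kappa> w0 (VV \<union> P) (cc k)" if k: "k \<in> W \<times> W" for k
  proof -
    have w: "fst k \<in> words d m t y0" "snd k \<in> words d m t y0" using k by (auto simp: W_def)
    have inj: "inj_on (\<lambda>(sj, i). p a w sj i) (C \<times> {..<d})" if "w \<in> words d m t y0" for a w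
      using cell_inj[OF that t1] unfolding C_def by (auto simp: inj_on_def p_def)
    have "Good N \<kappa> w0 (\<Union>sj\<in>C. p 2 (fst k) sj ` {..<d} \<union> p 3 (snd k) sj ` {..<d})
        (\<lambda>\<psi>. 1 * (\<Prod>sj\<in>C. ddet d (\<lambda>i j. tr (\<psi> (p 2 (fst k) sj i) * \<psi> (p 3 (snd k) sj j)))))"
    proof (rule Good_columns[OF _ G0])
      show "finite C" by (simp add: C_def)
      show "p 2 (fst k) sj i \<notin> frame_vars N \<and> p 3 (snd k) sj i \<notin> frame_vars N" for sj i
        by (intro conjI frame) (simp_all add: p_def)
      show "inj_on (\<lambda>(s, i). p 2 (fst k) s i) (C \<times> {..<d})" by (rule inj[OF w(1)])
      show "inj_on (\<lambda>(s, i). p 3 (snd k) s i) (C \<times> {..<d})" by (rule inj[OF w(2)])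
    qed (simp add: p_def)
    moreover have "(\<Union>sj\<in>C. p 2 (fst k) sj ` {..<d} \<union> p 3 (snd k) sj ` {..<d}) = VV"
    proof -
      have "(\<Union>sj\<in>C. p a w sj ` {..<d}) = Pair a ` (\<Union>sj\<in>C. cell d m t w sj ` {..<d})" for a w
        by (auto simp: p_def)
      then show ?thesis
        using cell_image[OF w(1) t1] cell_image[OF w(2) t1] by (simp add: UN_Un_distrib VV_def C_def)
    qed
    ultimately have "Good N \<kappa> w0 VV
        (\<lambda>\<psi>. 1 * (\<Prod>sj\<in>C. ddet d (\<lambda>i j. tr (\<psi> (p 2 (fst k) sj i) * \<psi> (p 3 (snd k) sj j)))))" by simp
    then show ?thesis
      unfolding cc_def[abs_def]
    proof (rule Good_padding[rotated])
      show "finite P" by (simp add: P_def)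
      show "P \<inter> (frame_vars N \<union> VV) = {}" by (auto simp: P_def VV_def frame_vars_def)
    qed
  qed
  then have "\<forall>k\<in>W \<times> W. \<exists>F. Pfun X F \<and> (\<forall>\<psi>. (\<forall>j<d. \<psi> (0, 0, j) \<in> AS) \<longrightarrow> (\<forall>j<N. \<psi> (1, 0, j) = \<kappa> j) \<longrightarrow>
      F \<psi> = scaleA (cc k \<psi> * ddet d (\<lambda>j l. coord (b j) (\<psi> (0, 0, l)))) w0)"
    unfolding Good_def X_def by simp
  from bchoice[OF this] obtain F where F: "\<forall>k\<in>W \<times> W. Pfun X (F k) \<and>
      (\<forall>\<psi>. (\<forall>j<d. \<psi> (0, 0, j) \<in> AS) \<longrightarrow> (\<forall>j<N. \<psi> (1, 0, j) = \<kappa> j) \<longrightarrow>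
      F k \<psi> = scaleA (cc k \<psi> * ddet d (\<lambda>j l. coord (b j) (\<psi> (0, 0, l)))) w0)" ..
  define \<Psi> where "\<Psi> l = (\<lambda>(a :: nat, B, x). if a = 0 then b x else if a = 1 then \<kappa> x
      else if a = 2 then b (fst l B x) else if a = 3 then b' (snd l B x) else u0)"
    for l :: "(nat \<Rightarrow> nat \<Rightarrow> nat) \<times> (nat \<Rightarrow> nat \<Rightarrow> nat)"
  have val: "F k (\<Psi> l) = scaleA (cc k (\<Psi> l)) w0" if k: "k \<in> W \<times> W" for k l
  proof -
    have "F k (\<Psi> l) = scaleA (cc k (\<Psi> l) * ddet d (\<lambda>j i. coord (b j) (\<Psi> l (0, 0, i)))) w0"
      using F k b_AS by (auto simp: \<Psi>_def)
    also have "ddet d (\<lambda>j i. coord (b j) (\<Psi> l (0, 0, i))) = ddet d (\<lambda>j i. if j = i then 1 else 0)"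
      by (rule ddet_cong) (simp add: \<Psi>_def coord_b)
    finally show ?thesis by (simp add: ddet_identity)
  qed
  \<comment> \<open>The matrix in column \<open>sj\<close> of the function \<open>k\<close> at the
    point \<open>l\<close>. For \<open>l = k\<close> the \<open>i\<close>-th cell has colour
    \<open>i\<close> in both words, so that it is the identity matrix.\<close>
  define M :: "_ \<Rightarrow> (nat \<Rightarrow> nat \<Rightarrow> nat) \<times> (nat \<Rightarrow> nat \<Rightarrow> nat) \<Rightarrow> _ \<Rightarrow> nat \<Rightarrow> nat \<Rightarrow> 'f" where
    "M k l sj = (\<lambda>i j. if fst l (fst (cell d m t (fst k) sj i)) (snd (cell d m t (fst k) sj i)) =
      snd l (fst (cell d m t (snd k) sj j)) (snd (cell d m t (snd k) sj j)) then 1 else 0)" for k l sj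
  have cc: "cc k (\<Psi> l) = (\<Prod>sj\<in>C. ddet d (M k l sj))" if k: "k \<in> W \<times> W" and l: "l \<in> W \<times> W" for k l
  proof -
    have col: "v (fst (cell d m t w sj i)) (snd (cell d m t w sj i)) < d"
      if "v \<in> W" "w \<in> W" "sj \<in> C" "i < d" for v w sj i
    proof -
      have "cell d m t w sj i \<in> {..<t} \<times> {..<d * m}"
        using cell_props(1)[of w d m t y0 sj i] that t1 by (simp add: W_def C_def)
      then have "v (fst (cell d m t w sj i)) \<in> balanced d m" "snd (cell d m t w sj i) < d * m"
        using that(1) by (auto simp: W_def words_def)
      then show ?thesis by (auto simp: balanced_def)
    qed
    have "(\<Prod>v\<in>P. tr (\<Psi> l v)) = 1"
      by (rule prod.neutral) (auto simp: P_def \<Psi>_def u0)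
    moreover have "ddet d (\<lambda>i j. tr (\<Psi> l (p 2 (fst k) sj i) * \<Psi> l (p 3 (snd k) sj j))) = ddet d (M k l sj)"
      if sj: "sj \<in> C" for sj
    proof (rule ddet_cong)
      fix i j assume ij: "i < d" "j < d"
      have W': "fst k \<in> W" "snd k \<in> W" "fst l \<in> W" "snd l \<in> W" using k l by auto
      show "tr (\<Psi> l (p 2 (fst k) sj i) * \<Psi> l (p 3 (snd k) sj j)) = M k l sj i j"
        using b'[OF col[OF W'(3,1) sj ij(1)] col[OF W'(4,2) sj ij(2)]]
        by (simp add: \<Psi>_def p_def M_def case_prod_beta)
    qed
    ultimately show ?thesis by (simp add: cc_def)
  qed
  have diag: "cc k (\<Psi> k) = 1" if k: "k \<in> W \<times> W" for k
  proof -
    have "ddet d (M k k sj) = 1" if sj: "sj \<in> C" for sj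
    proof -
      have "ddet d (M k k sj) = ddet d (\<lambda>i j. if i = j then 1 else 0)"
        using cell_props(2)[of "fst k" d m t y0 sj] cell_props(2)[of "snd k" d m t y0 sj] k t1 sj
        by (intro ddet_cong) (auto simp: M_def W_def C_def)
      then show ?thesis by (simp add: ddet_identity)
    qed
    then show ?thesis using cc[OF k k] by simp
  qed
  \<comment> \<open>A colour of \<open>fst l\<close> repeated within a column makes two rows equal,
    and one of \<open>snd l\<close> makes two columns of the matrix equal. If all determinants are
    nonzero, no colour repeats, which is the hypothesis of \<open>words_separated\<close> for both
    words.\<close>
  have off: "k = l" if k: "k \<in> W \<times> W" and l: "l \<in> W \<times> W" and nz: "cc k (\<Psi> l) \<noteq> 0" for k l
  proof -
    have det: "ddet d (M k l sj) \<noteq> 0" if "sj \<in> C" for sj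
    proof
      assume "ddet d (M k l sj) = 0"
      moreover have "finite C" by (simp add: C_def)
      ultimately have "(\<Prod>sj\<in>C. ddet d (M k l sj)) = 0" using that by (intro prod_zero) auto
      then show False using nz cc[OF k l] by simp
    qed
    have "fst l = fst k"
    proof (rule words_separated[of _ d m t y0])
      show "fst l \<in> words d m t y0" "fst k \<in> words d m t y0" using k l by (auto simp: W_def)
      fix sj assume sj: "sj \<in> {..<t} \<times> {..<m}"
      show "inj_on (\<lambda>c. fst l (fst (cell d m t (fst k) sj c)) (snd (cell d m t (fst k) sj c))) {..<d}"
      proof (rule inj_onI, rule ccontr)
        fix i i' assume "i \<in> {..<d}" "i' \<in> {..<d}" "i \<noteq> i'"
          "fst l (fst (cell d m t (fst k) sj i)) (snd (cell d m t (fst k) sj i)) =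
           fst l (fst (cell d m t (fst k) sj i')) (snd (cell d m t (fst k) sj i'))"
        then have "ddet d (M k l sj) = 0" by (intro ddet_equal_rows[of i d i']) (auto simp: M_def)
        then show False using det sj by (simp add: C_def)
      qed
    qed (rule t1)
    moreover have "snd l = snd k"
    proof (rule words_separated[of _ d m t y0])
      show "snd l \<in> words d m t y0" "snd k \<in> words d m t y0" using k l by (auto simp: W_def)
      fix sj assume sj: "sj \<in> {..<t} \<times> {..<m}"
      show "inj_on (\<lambda>c. snd l (fst (cell d m t (snd k) sj c)) (snd (cell d m t (snd k) sj c))) {..<d}"
      proof (rule inj_onI, rule ccontr)
        fix i i' assume "i \<in> {..<d}" "i' \<in> {..<d}" "i \<noteq> i'"
          "snd l (fst (cell d m t (snd k) sj i)) (snd (cell d m t (snd k) sj i)) =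
           snd l (fst (cell d m t (snd k) sj i')) (snd (cell d m t (snd k) sj i'))"
        then have "ddet d (M k l sj) = 0" by (intro ddet_equal_columns[of i d i']) (auto simp: M_def)
        then show False using det sj by (simp add: C_def)
      qed
    qed (rule t1)
    ultimately show ?thesis by (simp add: prod_eq_iff)
  qed
  have card_frame: "card (frame_vars N) = d + N"
  proof -
    have "card (frame_vars N) = card ((\<lambda>k. (0::nat, 0::nat, k)) ` {..<d}) + card ((\<lambda>j. (1::nat, 0::nat, j)) ` {..<N})"
      unfolding frame_vars_def by (rule card_Un_disjoint) auto
    then show ?thesis by (simp add: card_image inj_on_def)
  qed
  have card_VV: "card VV = 2 * (t * (d * m))"
  proof -
    have "card VV = card (Pair (2::nat) ` ({..<t} \<times> {..<d * m})) + card (Pair (3::nat) ` ({..<t} \<times> {..<d * m}))"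
      unfolding VV_def by (rule card_Un_disjoint) auto
    then show ?thesis by (simp add: card_image inj_on_def card_cartesian_product)
  qed
  have card_P: "card P = e" by (simp add: P_def card_image inj_on_def)
  have fin: "finite (frame_vars N)" "finite VV" "finite P" by (auto simp: frame_vars_def VV_def P_def)
  have "card X = card (frame_vars N) + (card VV + card P)"
  proof -
    have "card (VV \<union> P) = card VV + card P" using fin by (intro card_Un_disjoint) (auto simp: VV_def P_def)
    moreover have "card X = card (frame_vars N) + card (VV \<union> P)"
      unfolding X_def using fin by (intro card_Un_disjoint) (auto simp: VV_def P_def frame_vars_def)
    ultimately show ?thesis by simp
  qed
  then have cardX: "card X = N + d + 2 * d * m * t + e"
    by (simp add: card_frame card_VV card_P mult_ac)
  have "card (W \<times> W) \<le> H_codim scaleH scaleA act \<Gamma> (N + d + 2 * d * m * t + e)"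
  proof (rule HB.codim_ge_of_points[OF E_basis _ cardX, where F = F and \<Psi> = \<Psi>])
    show "finite X" using fin by (simp add: X_def)
    show "1 \<le> N + d + 2 * d * m * t + e" using d_pos by simp
    show "finite (W \<times> W)" by (simp add: W_def finite_words)
    show "Pfun X (F k)" if "k \<in> W \<times> W" for k using F that by blast
    show "F k (\<Psi> k) \<noteq> 0" if "k \<in> W \<times> W" for k using val[OF that] diag[OF that] w0 by simp
    show "F k (\<Psi> l) = 0" if "k \<in> W \<times> W" "l \<in> W \<times> W" "k \<noteq> l" for k l
      using val[OF that(1), of l] off[OF that(1,2)] that(3) by auto
  qed
  then show ?thesis by (simp add: W_def card_cartesian_product power2_eq_square)
qed

text \<open>\<open>K\<close> is the number of balanced words. The exponent has the factor 2 because
  pairs of words are counted, and \<open>t - d\<close> because the first \<open>d\<close> blocks are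
  fixed; \<open>n0\<close> counts the variables of the initial function.\<close>

lemma codim_lower_bound:
  assumes HB: "H_basis scaleH scaleA act \<Gamma>"
  shows "\<exists>n0. \<forall>m\<ge>1. \<exists>K::real. K \<ge> 1 \<and> real d ^ (d * m) \<le> K * real (d * m) ^ d \<and>
    (\<forall>t\<ge>d. \<forall>e. K ^ (2 * (t - d)) \<le> real (H_codim scaleH scaleA act \<Gamma> (n0 + 2 * d * m * t + e)))"
proof -
  obtain N \<kappa> w0 where G: "w0 \<noteq> 0" "Good N \<kappa> w0 {} (\<lambda>\<psi>. 1)" using Good_initial by blast
  have "\<exists>K::real. K \<ge> 1 \<and> real d ^ (d * m) \<le> K * real (d * m) ^ d \<and>
    (\<forall>t\<ge>d. \<forall>e. K ^ (2 * (t - d)) \<le> real (H_codim scaleH scaleA act \<Gamma> (N + d + 2 * d * m * t + e)))"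
    if m: "m \<ge> 1" for m
  proof -
    define k where "k = card (balanced d m)"
    have le: "d ^ (d * m) \<le> k * (d * m) ^ d" unfolding k_def by (rule card_balanced_ge[OF m])
    have "k \<noteq> 0"
    proof
      assume "k = 0"
      then show False using le d_pos by simp
    qed
    then obtain y0 where y0: "y0 \<in> balanced d m" unfolding k_def by fastforce
    have "real d ^ (d * m) \<le> real k * real (d * m) ^ d"
      using le by (metis of_nat_le_iff of_nat_mult of_nat_power)
    moreover have "real k ^ (2 * (t - d)) \<le> real (H_codim scaleH scaleA act \<Gamma> (N + d + 2 * d * m * t + e))"
      if t: "t \<ge> d" for t e
    proof -
      have "k ^ (2 * (t - d)) = (k ^ (t - d)) ^ 2" by (simp add: power_mult[symmetric] mult.commute)
      also have "\<dots> \<le> card (words d m t y0) ^ 2"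
        using card_words_ge[OF t y0] unfolding k_def by (rule power_mono) simp
      also have "\<dots> \<le> H_codim scaleH scaleA act \<Gamma> (N + d + 2 * d * m * t + e)"
        by (rule codim_ge_words[OF HB G t])
      finally show ?thesis by (metis of_nat_le_iff of_nat_power)
    qed
    ultimately show ?thesis using \<open>k \<noteq> 0\<close> by (intro exI[of _ "real k"]) auto
  qed
  then show ?thesis by blast
qed

end

section \<open>From the quotient to ideals of the algebra\<close>

lemma coset_eq_iff:
  fixes J :: "'a::ring set"
  assumes "0 \<in> J" "\<And>x y. x \<in> J \<Longrightarrow> y \<in> J \<Longrightarrow> x + y \<in> J" "\<And>x. x \<in> J \<Longrightarrow> - x \<in> J"
  shows "a +o J = c +o J \<longleftrightarrow> a - c \<in> J"
proof
  assume "a +o J = c +o J"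
  moreover have "a \<in> a +o J" using assms(1) by (auto simp: elt_set_plus_def intro: bexI[of _ 0])
  ultimately show "a - c \<in> J" by (auto simp: elt_set_plus_def)
next
  assume ac: "a - c \<in> J"
  show "a +o J = c +o J"
  proof (rule set_eqI)
    fix x
    have "x - a \<in> J \<longleftrightarrow> x - c \<in> J"
      using assms(2)[OF _ ac, of "x - a"] assms(2)[OF _ assms(3)[OF ac], of "x - c"] by auto
    moreover have "x \<in> u +o J \<longleftrightarrow> x - u \<in> J" for u
      by (auto simp: elt_set_plus_def intro: bexI[of _ "x - u"])
    ultimately show "x \<in> a +o J \<longleftrightarrow> x \<in> c +o J" by simp
  qed
qed

text \<open>Cosets are replaced by representatives. \<open>AA_indep\<close> is the uniqueness of the
  decomposition of the zero coset, and \<open>AA_simple\<close> comes from the images of the ideals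
  \<open>K\<close> in \<open>B i\<close>.\<close>

lemma (in fd_H_algebra) H_decomposition_of_quotient:
  assumes J_inv: "\<And>h x. x \<in> A.J \<Longrightarrow> act h x \<in> A.J"
    and dec: "direct_sum_of_ideals (quotient_H_structure scaleA act A.J) q B"
    and simple: "\<forall>i<q. H_simple ((quotient_H_structure scaleA act A.J)\<lparr>hcarrier := B i\<rparr>)"
  shows "H_decomposition scaleH scaleA act Basis q (\<lambda>i. {a. a +o A.J \<in> B i})"
proof -
  let ?J = "A.J"
  define R where "R = quotient_H_structure scaleA act ?J"
  have J_ideal: "\<And>a x. x \<in> ?J \<Longrightarrow> a * x \<in> ?J \<and> x * a \<in> ?J" using A.J_left A.J_right by auto
  have R_add: "hadd R (a +o ?J) (c +o ?J) = (a + c) +o ?J" for a c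
    unfolding R_def using A.subspace_J J_ideal J_inv by (rule quotient_add)
  have R_mult: "hmult R (a +o ?J) (c +o ?J) = (a * c) +o ?J" for a c
    unfolding R_def using A.subspace_J J_ideal J_inv by (rule quotient_mult)
  have R_scale: "hscale R r (a +o ?J) = scaleA r a +o ?J" for r a
    unfolding R_def using A.subspace_J J_ideal J_inv by (rule quotient_scale)
  have R_act: "hact R h (a +o ?J) = act h a +o ?J" for h a
    unfolding R_def using A.subspace_J J_ideal J_inv by (rule quotient_act)
  have R_zero: "hzero R = ?J" and R_carrier: "hcarrier R = range (\<lambda>a. a +o ?J)"
    by (simp_all add: R_def quotient_H_structure_def)
  have eq: "a +o ?J = c +o ?J \<longleftrightarrow> a - c \<in> ?J" for a c
    using A.subspace_J by (intro coset_eq_iff) (auto intro: A.subspace_0 A.subspace_add A.subspace_neg)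
  have zero: "0 +o ?J = ?J" by (auto simp: elt_set_plus_def)
  have eqJ: "a +o ?J = ?J \<longleftrightarrow> a \<in> ?J" for a using eq[of a 0] by (simp add: zero)
  have absorb: "a +o ?J = ?J" if "a \<in> ?J" for a using that eqJ by simp
  have Bi: "B i \<subseteq> hcarrier R" "?J \<in> B i" "\<And>x y. x \<in> B i \<Longrightarrow> y \<in> B i \<Longrightarrow> hadd R x y \<in> B i"
    "\<And>c x. x \<in> B i \<Longrightarrow> hscale R c x \<in> B i"
    "\<And>r x. r \<in> hcarrier R \<Longrightarrow> x \<in> B i \<Longrightarrow> hmult R r x \<in> B i"
    "\<And>r x. r \<in> hcarrier R \<Longrightarrow> x \<in> B i \<Longrightarrow> hmult R x r \<in> B i"
    "\<And>h x. x \<in> B i \<Longrightarrow> hact R h x \<in> B i" if "i < q" for i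
    using dec that R_zero unfolding direct_sum_of_ideals_def H_invariant_ideal_def R_def by auto
  have inC: "a +o ?J \<in> hcarrier R" for a by (simp add: R_carrier)
  have hsum: "hsum R q bb = (\<Sum>i<q. s i) +o ?J" if bb: "\<And>i. i < q \<Longrightarrow> bb i = s i +o ?J" for bb s
  proof -
    have "foldr (\<lambda>i. hadd R (bb i)) [0..<n] (c +o ?J) = ((\<Sum>i<n. s i) + c) +o ?J" if "n \<le> q" for n c
      using that
    proof (induction n arbitrary: c)
      case (Suc n)
      then show ?case using bb[of n] by (simp add: R_add add.assoc)
    qed simp
    from this[of q 0] show ?thesis by (simp add: hsum_def R_zero zero)
  qed
  have ex1: "\<exists>!bb. bb \<in> (\<Pi>\<^sub>E i\<in>{..<q}. B i) \<and> x = hsum R q bb" if "x \<in> hcarrier R" for x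
    using dec that unfolding direct_sum_of_ideals_def R_def by blast
  let ?AA = "\<lambda>i. {a. a +o ?J \<in> B i}"
  show ?thesis
  proof unfold_locales
    fix h x assume "x \<in> ?J"
    then show "act h x \<in> ?J" by (rule J_inv)
  next
    fix i assume i: "i < q"
    show "A.subspace (?AA i)"
    proof (rule A.subspaceI)
      show "0 \<in> ?AA i" using Bi(2)[OF i] by (simp add: zero)
      show "x + y \<in> ?AA i" if "x \<in> ?AA i" "y \<in> ?AA i" for x y
        using Bi(3)[OF i, of "x +o ?J" "y +o ?J"] that by (simp add: R_add)
      show "scaleA c x \<in> ?AA i" if "x \<in> ?AA i" for c x
        using Bi(4)[OF i, of "x +o ?J"] that by (simp add: R_scale)
    qed
    show "?J \<subseteq> ?AA i"
    proof
      fix x assume "x \<in> ?J"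
      then have "x +o ?J = ?J" by (simp only: eqJ)
      then show "x \<in> ?AA i" using Bi(2)[OF i] by simp
    qed
    fix x a h assume x: "x \<in> ?AA i"
    show "a * x \<in> ?AA i" using Bi(5)[OF i inC, of "x +o ?J" a] x by (simp add: R_mult)
    show "x * a \<in> ?AA i" using Bi(6)[OF i inC, of "x +o ?J" a] x by (simp add: R_mult)
    show "act h x \<in> ?AA i" using Bi(7)[OF i, of "x +o ?J"] x by (simp add: R_act)
  next
    fix x
    obtain bb where bb: "bb \<in> (\<Pi>\<^sub>E i\<in>{..<q}. B i)" "x +o ?J = hsum R q bb" using ex1[OF inC, of x] by blast
    have "\<forall>i\<in>{..<q}. \<exists>a. bb i = a +o ?J"
    proof
      fix i assume i: "i \<in> {..<q}"
      then have "bb i \<in> hcarrier R" using bb(1) Bi(1)[of i] by auto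
      then show "\<exists>a. bb i = a +o ?J" by (auto simp: R_carrier)
    qed
    from bchoice[OF this] obtain s where s: "\<forall>i\<in>{..<q}. bb i = s i +o ?J" ..
    have "x - (\<Sum>i<q. s i) \<in> ?J" using bb(2) hsum[of bb s] s eq by simp
    moreover have "\<forall>i<q. s i \<in> ?AA i" using bb(1) s by (auto simp: PiE_iff)
    ultimately show "\<exists>a. (\<forall>i<q. a i \<in> ?AA i) \<and> x - (\<Sum>i<q. a i) \<in> ?J" by blast
  next
    fix s i assume s: "\<And>i. i < q \<Longrightarrow> s i \<in> ?AA i" and sum: "(\<Sum>i<q. s i) \<in> ?J" and i: "i < q"
    \<comment> \<open>Two decompositions of the zero coset, by the given elements and by zeros;
      \<open>restrict\<close> supplies the extensionality that the uniqueness refers to.\<close>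
    define b1 where "b1 = restrict (\<lambda>i. s i +o ?J) {..<q}"
    define b2 where "b2 = restrict (\<lambda>i. 0 +o ?J) {..<q}"
    have "b1 \<in> (\<Pi>\<^sub>E i\<in>{..<q}. B i)" using s by (auto simp: b1_def)
    moreover have "b2 \<in> (\<Pi>\<^sub>E i\<in>{..<q}. B i)" using Bi(2) by (auto simp: b2_def zero)
    moreover have "?J = hsum R q b1" using hsum[of b1 s] absorb[OF sum] by (simp add: b1_def)
    moreover have "?J = hsum R q b2" using hsum[of b2 "\<lambda>_. 0"] by (simp add: b2_def zero)
    moreover have "?J \<in> hcarrier R" using inC[of 0] by (simp add: zero)
    ultimately have "b1 = b2" using ex1[of ?J] by blast
    then have "b1 i = b2 i" by simp
    then have "s i +o ?J = ?J" using i by (simp add: b1_def b2_def zero)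
    then show "s i \<in> ?J" by (simp add: eqJ)
  next
    fix i K assume i: "i < q" and K: "A.subspace K" "?J \<subseteq> K" "K \<subseteq> ?AA i"
      "\<And>a x. x \<in> K \<Longrightarrow> a * x \<in> K \<and> x * a \<in> K" "\<And>h x. x \<in> K \<Longrightarrow> act h x \<in> K"
    define K' where "K' = (\<lambda>a. a +o ?J) ` K"
    have "H_invariant_ideal (R\<lparr>hcarrier := B i\<rparr>) K'"
      unfolding H_invariant_ideal_def
    proof (intro conjI ballI allI)
      show "K' \<subseteq> hcarrier (R\<lparr>hcarrier := B i\<rparr>)" using K(3) by (auto simp: K'_def)
      show "hzero (R\<lparr>hcarrier := B i\<rparr>) \<in> K'"
        using A.subspace_0[OF K(1)] zero by (auto simp: K'_def R_zero image_iff intro!: bexI[of _ 0])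
      show "hadd (R\<lparr>hcarrier := B i\<rparr>) x y \<in> K'" if "x \<in> K'" "y \<in> K'" for x y
        using that A.subspace_add[OF K(1)] by (auto simp: K'_def R_add)
      show "hscale (R\<lparr>hcarrier := B i\<rparr>) c x \<in> K'" if "x \<in> K'" for c x
        using that A.subspace_scale[OF K(1)] by (auto simp: K'_def R_scale)
      show "hact (R\<lparr>hcarrier := B i\<rparr>) h x \<in> K'" if "x \<in> K'" for h x
        using that K(5) by (auto simp: K'_def R_act)
      fix r x assume r: "r \<in> hcarrier (R\<lparr>hcarrier := B i\<rparr>)" and x: "x \<in> K'"
      obtain a c where "r = a +o ?J" "x = c +o ?J" "c \<in> K"
        using r x Bi(1)[OF i] by (auto simp: K'_def R_carrier)
      then show "hmult (R\<lparr>hcarrier := B i\<rparr>) r x \<in> K'" "hmult (R\<lparr>hcarrier := B i\<rparr>) x r \<in> K'"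
        using K(4)[of c a] by (auto simp: K'_def R_mult)
    qed
    then have "K' = {hzero (R\<lparr>hcarrier := B i\<rparr>)} \<or> K' = hcarrier (R\<lparr>hcarrier := B i\<rparr>)"
      using simple i unfolding H_simple_def R_def by blast
    then have "K' = {?J} \<or> K' = B i" by (simp add: R_zero)
    then show "K = ?J \<or> K = ?AA i"
    proof
      assume "K' = {?J}"
      have "x \<in> ?J" if "x \<in> K" for x
      proof -
        have "x +o ?J \<in> K'" using that by (simp add: K'_def)
        then show ?thesis using \<open>K' = {?J}\<close> eqJ by simp
      qed
      then have "K \<subseteq> ?J" by blast
      then show ?thesis using K(2) by auto
    next
      assume K': "K' = B i"
      have "?AA i \<subseteq> K"
      proof
        fix a assume "a \<in> ?AA i"
        then obtain c where c: "c \<in> K" "a +o ?J = c +o ?J" using K' by (auto simp: K'_def)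
        then have "(a - c) + c \<in> K" using K(2) eq by (intro A.subspace_add[OF K(1)]) auto
        then show "a \<in> K" by simp
      qed
      then show ?thesis using K(3) by auto
    qed
  next
    fix i assume i: "i < q"
    have "\<exists>x\<in>B i. \<exists>y\<in>B i. hmult R x y \<noteq> hzero R"
      using simple i unfolding H_simple_def R_def by simp
    then obtain x y where xy: "x \<in> B i" "y \<in> B i" "hmult R x y \<noteq> ?J" by (auto simp: R_zero)
    then obtain a c where "x = a +o ?J" "y = c +o ?J" using Bi(1)[OF i] unfolding R_carrier by blast
    then show "\<exists>x\<in>?AA i. \<exists>y\<in>?AA i. x * y \<notin> ?J"
      using xy by (auto simp: R_mult eqJ)
  qed
qed

theorem mainTheorem2:
  fixes scaleH :: "'f::{alg_closed_field, field_char_0} \<Rightarrow> 'h::{ring, monoid_mult} \<Rightarrow> 'h"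
    and scaleA :: "'f \<Rightarrow> 'a::ring \<Rightarrow> 'a"
    and act :: "'h \<Rightarrow> 'a \<Rightarrow> 'a"
    and \<Gamma> :: "'h set"
    and q :: nat
    and B :: "nat \<Rightarrow> 'a set set"
  assumes action: "generalized_action scaleH scaleA act"
    and basis: "\<not> module.dependent scaleH \<Gamma>" "module.span scaleH \<Gamma> = UNIV"
    and finite_dim: "\<exists>E. finite_dimensional_vector_space scaleA E"
    and J_invariant: "\<forall>h. \<forall>x\<in>jacobson_radical scaleA. act h x \<in> jacobson_radical scaleA"
    and decomposition: "direct_sum_of_ideals (quotient_H_structure scaleA act (jacobson_radical scaleA)) q B"
    and simple: "\<forall>i<q. H_simple ((quotient_H_structure scaleA act (jacobson_radical scaleA))\<lparr>hcarrier := B i\<rparr>)"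
  shows "\<exists>d::nat. (\<lambda>n. root n (real (H_codim scaleH scaleA act \<Gamma> n))) \<longlonglongrightarrow> real d"
proof -
  obtain Basis where fd: "finite_dimensional_vector_space scaleA Basis" using finite_dim by blast
  interpret ga: generalized_action scaleH scaleA act by (rule action)
  have HB: "H_basis scaleH scaleA act \<Gamma>"
    by (intro H_basis.intro action H_basis_axioms.intro basis)
  interpret HB: H_basis scaleH scaleA act \<Gamma> by (rule HB)
  have "fd_algebra scaleA Basis"
    by (intro fd_algebra.intro ga.A.assoc_algebra_axioms fd)
  then interpret fdH: fd_H_algebra scaleH scaleA act Basis
    by (intro fd_H_algebra.intro action)
  define AA where "AA i = {a. a +o fdH.A.J \<in> B i}" for i
  have "H_decomposition scaleH scaleA act Basis q AA"
    unfolding AA_def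
  proof (rule fdH.H_decomposition_of_quotient)
    show "act h x \<in> fdH.A.J" if "x \<in> fdH.A.J" for h x
      using J_invariant that unfolding fdH.A.J_def by blast
    show "direct_sum_of_ideals (quotient_H_structure scaleA act fdH.A.J) q B"
      using decomposition unfolding fdH.A.J_def .
    show "\<forall>i<q. H_simple ((quotient_H_structure scaleA act fdH.A.J)\<lparr>hcarrier := B i\<rparr>)"
      using simple unfolding fdH.A.J_def .
  qed
  then interpret HD: H_decomposition scaleH scaleA act Basis q AA .
  obtain EE where EE: "HD.adapted_basis EE" using HD.adapted_basis_exists by blast
  have "H_decomposition_ac scaleH scaleA act Basis q AA EE"
    by (intro H_decomposition_ac.intro HD.H_decomposition_axioms H_decomposition_ac_axioms.intro EE)
  then interpret HE: H_decomposition_ac scaleH scaleA act Basis q AA EE .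
  let ?c = "H_codim scaleH scaleA act \<Gamma>"
  let ?sizes = "(\<lambda>S. card (\<Union>i\<in>S. EE i)) ` {S. HD.admissible S}"
  define d where "d = Max ?sizes"
  have fin: "finite {S. HD.admissible S}"
    by (rule finite_subset[of _ "Pow {..<q}"]) (auto simp: HD.admissible_def)
  have "HD.admissible {}" by (simp add: HD.admissible_def)
  then have "d \<in> ?sizes" unfolding d_def using fin by (intro Max_in) auto
  then obtain S where S: "HD.admissible S" "d = card (\<Union>i\<in>S. EE i)" by auto
  have max: "card (\<Union>i\<in>S. EE i) \<le> d" if "HD.admissible S" for S
    unfolding d_def using fin that by (intro Max_ge) auto
  have "(\<lambda>n. root n (real (?c n))) \<longlonglongrightarrow> real d"
  proof (rule root_tendsto_of_bounds)
    show "0 \<le> real (card (EE q))" by simp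
  next
    obtain p where p: "\<And>n (\<epsilon>::real). n \<ge> 1 \<Longrightarrow> 0 < \<epsilon> \<Longrightarrow> \<epsilon> \<le> 1 \<Longrightarrow>
      real (card {t \<in> {1..n} \<rightarrow>\<^sub>E (\<Union>k\<le>q. EE k). \<exists>f. ga.Pfun {1..n} f \<and> f t \<noteq> 0})
        \<le> 2 ^ q * (real d + \<epsilon> * real (card (EE q))) ^ n / \<epsilon> ^ p"
      using HD.nonzero_tuples_le[OF EE max] by blast
    fix \<epsilon> :: real assume \<epsilon>: "0 < \<epsilon>" "\<epsilon> \<le> 1"
    define z where "z = real d + \<epsilon> * real (card (EE q))"
    \<comment> \<open>The summand 1 keeps \<open>C\<close> positive for the zero algebra, whose
      basis is empty.\<close>
    define C where "C = 2 ^ q / \<epsilon> ^ p * real (card HE.E) + 1"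
    have z: "z \<ge> 0" using \<epsilon> by (simp add: z_def)
    have "real (?c n) \<le> C * z ^ n" if n: "n \<ge> 1" for n
    proof -
      let ?T = "{t \<in> {1..n} \<rightarrow>\<^sub>E HE.E. \<exists>f. ga.Pfun {1..n} f \<and> f t \<noteq> 0}"
      have "?c n \<le> card ?T * card HE.E" by (rule HB.codim_bounds(1)[OF n HE.E_basis])
      then have "real (?c n) \<le> real (card ?T * card HE.E)" by (rule of_nat_mono)
      then have "real (?c n) \<le> real (card ?T) * real (card HE.E)" by (simp only: of_nat_mult)
      also have "\<dots> \<le> (2 ^ q * z ^ n / \<epsilon> ^ p) * real (card HE.E)"
        using p[OF n \<epsilon>] unfolding z_def HE.E_def by (rule mult_right_mono) (rule of_nat_0_le_iff)
      also have "\<dots> = (C - 1) * z ^ n" by (simp add: C_def)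
      also have "\<dots> \<le> C * z ^ n" using z by (intro mult_right_mono) simp_all
      finally show ?thesis .
    qed
    moreover have "C > 0" using \<epsilon> by (simp add: C_def add_nonneg_pos)
    ultimately show "\<exists>C>0. \<forall>n\<ge>1. real (?c n) \<le> C * (real d + \<epsilon> * real (card (EE q))) ^ n"
      unfolding z_def by blast
  next
    \<comment> \<open>A frame requires a nonempty \<open>S\<close>, which \<open>d \<ge> 1\<close>
      guarantees; for \<open>d = 0\<close> the lower estimate of the limit is the nonnegativity of
      the roots.\<close>
    fix m :: nat assume d1: "d \<ge> 1" and m: "m \<ge> 1"
    have "finite (\<Union>i\<in>S. EE i)" using S(2) d1 by (intro card_ge_0_finite) linarith
    then obtain b where b: "bij_betw b {..<d} (\<Union>i\<in>S. EE i)"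
      using ex_bij_betw_nat_finite[of "\<Union>i\<in>S. EE i"] S(2) by (auto simp: lessThan_atLeast0)
    have "\<forall>k\<in>{..<d}. \<exists>i. i \<in> S \<and> b k \<in> EE i" using bij_betwE[OF b] by auto
    from bchoice[OF this] obtain bl where bl: "\<forall>k\<in>{..<d}. bl k \<in> S \<and> b k \<in> EE (bl k)" ..
    have "S \<noteq> {}" using S(2) d1 by auto
    then have "H_frame scaleH scaleA act Basis q AA EE S d b bl"
      using S(1) b bl by (intro H_frame.intro HE.H_decomposition_ac_axioms H_frame_axioms.intro) auto
    from H_frame.codim_lower_bound[OF this HB] obtain n0 where
      "\<forall>m\<ge>1. \<exists>K::real. K \<ge> 1 \<and> real d ^ (d * m) \<le> K * real (d * m) ^ d \<and>
        (\<forall>t\<ge>d. \<forall>e. K ^ (2 * (t - d)) \<le> real (?c (n0 + 2 * d * m * t + e)))" ..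
    then show "\<exists>K n0. K \<ge> 1 \<and> real d ^ (d * m) \<le> K * real (d * m) ^ d \<and>
        (\<forall>t\<ge>d. \<forall>e. K ^ (2 * (t - d)) \<le> real (?c (n0 + 2 * d * m * t + e)))"
      using m by blast
  qed
  then show ?thesis by blast
qed

end
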